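(* Let $M\geq2$, let $\mathsf{A}=(A_1,\ldots,A_M)\in M_d(\mathbb{R})^M$ be irreducible, let $s>0$, and let $\mu\in\mathcal{M}_\sigma$ be the unique equilibrium state of $(\mathsf{A},s)$. Then: (i) If for every $n\geq1$ the set of all products $A_{i_n}\cdots A_{i_1}$ with $i_1,\ldots,i_n\in\{1,\ldots,M\}$ is irreducible, then $\mu$ is totally ergodic. (ii) If $\mu$ is totally ergodic, then it is mixing.
   Context: $\Sigma_M:=\{1,\ldots,M\}^{\mathbb{N}}$ with the product topology; $\sigma$ is the shift $\sigma[(x_n)_{n=1}^\infty]=(x_{n+1})_{n=1}^\infty$; $\mathcal{M}_\sigma$ is the set of $\sigma$-invariant Borel probability measures on $\Sigma_M$; $h(\nu)$ is the metric entropy of $\nu\in\mathcal{M}_\sigma$. $M_d(\mathbb{R})$ is the set of real $d\times d$ matrices and $\|\cdot\|$ is the operator norm induced by the Euclidean norm. The top Lyapunov exponent is $\Lambda(\mathsf{A},\nu):=\lim_{n\to\infty}\frac1n\int_{\Sigma_M}\log\|A_{x_n}\cdots A_{x_1}\|\,d\nu(x)\in[-\infty,\infty)$ (with $\log 0=-\infty$). An equilibrium state of $(\mathsf{A},s)$ is a measure $\mu\in\mathcal{M}_\sigma$ attaining $\sup_{\nu\in\mathcal{M}_\sigma}\bigl(h(\nu)+s\Lambda(\mathsf{A},\nu)\bigr)$. A tuple or set of $d\times d$ matrices is irreducible if there is no linear subspace $U\subset\mathbb{R}^d$ with $0<\dim U<d$ which is mapped into itself by every matrix of the tuple or set. It is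 known (Feng–Käenmäki) that if $d\geq2$ and $\mathsf{A}$ is irreducible then $(\mathsf{A},s)$ has exactly one equilibrium state. The measure $\mu$ is totally ergodic if it is ergodic with respect to $\sigma^n$ for every $n\geq1$, and mixing if $\lim_{n\to\infty}\mu(X\cap\sigma^{-n}Y)=\mu(X)\mu(Y)$ for all Borel sets $X,Y\subseteq\Sigma_M$. *)

theory Defs
  imports "HOL-Probability.Probability"
begin

(* Sequences are indexed from 0, so that  x n  stands for x_{n+1} in the usual one-sided notation. *)

definition full_shift :: "nat \<Rightarrow> (nat \<Rightarrow> nat) set" where
  "full_shift M = {x. \<forall>n. x n \<in> {1..M}}"

definition left_shift :: "(nat \<Rightarrow> nat) \<Rightarrow> nat \<Rightarrow> nat" where
  "left_shift x = (\<lambda>n. x (Suc n))"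

(* The topology on  nat => nat  is the product of the discrete topologies (HOL-Analysis.Function_Topology),
   so this is the Borel sigma-algebra of the subspace {1..M}^N; the measure carried by it is irrelevant. *)

definition shift_borel :: "nat \<Rightarrow> (nat \<Rightarrow> nat) measure" where
  "shift_borel M = restrict_space borel (full_shift M)"

definition invariant_measures :: "nat \<Rightarrow> (nat \<Rightarrow> nat) measure set" where
  "invariant_measures M =
     {\<nu>. prob_space \<nu> \<and> sets \<nu> = sets (shift_borel M) \<and> distr \<nu> \<nu> left_shift = \<nu>}"

definition finite_measurable_partition :: "'a measure \<Rightarrow> 'a set set \<Rightarrow> bool" where
  "finite_measurable_partition \<nu> P \<longleftrightarrow> finite P \<and> P \<subseteq> sets \<nu> \<and> partition_on (space \<nu>) P"

(* Natural logarithm;  ln 0 = 0  gives the usual convention 0 log 0 = 0. *)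

definition partition_entropy :: "'a measure \<Rightarrow> 'a set set \<Rightarrow> real" where
  "partition_entropy \<nu> P = - (\<Sum>C\<in>P. measure \<nu> C * ln (measure \<nu> C))"

(* The join of P, T^{-1}P, ..., T^{-(n-1)}P.  Some choices c may yield the empty set; it contributes
   0 to the entropy. *)

definition refined_partition :: "'a measure \<Rightarrow> ('a \<Rightarrow> 'a) \<Rightarrow> 'a set set \<Rightarrow> nat \<Rightarrow> 'a set set" where
  "refined_partition \<nu> T P n =
     (\<lambda>c. {x \<in> space \<nu>. \<forall>i<n. (T ^^ i) x \<in> c i}) ` (\<Pi>\<^sub>E i\<in>{..<n}. P)"

definition partition_entropy_rate :: "'a measure \<Rightarrow> ('a \<Rightarrow> 'a) \<Rightarrow> 'a set set \<Rightarrow> real" where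
  "partition_entropy_rate \<nu> T P = lim (\<lambda>n. partition_entropy \<nu> (refined_partition \<nu> T P n) / real n)"

definition metric_entropy :: "'a measure \<Rightarrow> ('a \<Rightarrow> 'a) \<Rightarrow> ereal" where
  "metric_entropy \<nu> T =
     (SUP P\<in>{P. finite_measurable_partition \<nu> P}. ereal (partition_entropy_rate \<nu> T P))"

definition log_ext :: "real \<Rightarrow> ereal" where
  "log_ext t = (if t \<le> 0 then - \<infinity> else ereal (ln t))"

(* Integral of an extended-real function as the difference of the integrals of its positive and
   negative parts ( e2ennreal  maps negative numbers to 0). *)

definition ereal_integral :: "'a measure \<Rightarrow> ('a \<Rightarrow> ereal) \<Rightarrow> ereal" where
  "ereal_integral \<nu> f =
     enn2ereal (\<integral>\<^sup>+x. e2ennreal (f x) \<partial>\<nu>) - enn2ereal (\<integral>\<^sup>+x. e2ennreal (- f x) \<partial>\<nu>)"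

definition opnorm :: "real^'n^'n \<Rightarrow> real" where
  "opnorm B = onorm (\<lambda>v. B *v v)"

(* The product A_{x_n} ... A_{x_1}, later matrices on the left. *)

primrec matrix_product :: "(nat \<Rightarrow> real^'n^'n) \<Rightarrow> (nat \<Rightarrow> nat) \<Rightarrow> nat \<Rightarrow> real^'n^'n" where
  "matrix_product A x 0 = mat 1"
| "matrix_product A x (Suc n) = A (x n) ** matrix_product A x n"

definition top_lyapunov :: "(nat \<Rightarrow> real^'n^'n) \<Rightarrow> (nat \<Rightarrow> nat) measure \<Rightarrow> ereal" where
  "top_lyapunov A \<nu> =
     lim (\<lambda>n. ereal (1 / real n) * ereal_integral \<nu> (\<lambda>x. log_ext (opnorm (matrix_product A x n))))"

(* No undefined sums occur: for invariant \<nu> the entropy is at most log M, and the exponent is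
   less than \<infinity>. *)

definition equilibrium_states :: "nat \<Rightarrow> (nat \<Rightarrow> real^'n^'n) \<Rightarrow> real \<Rightarrow> (nat \<Rightarrow> nat) measure set" where
  "equilibrium_states M A s =
     {\<mu> \<in> invariant_measures M.
        metric_entropy \<mu> left_shift + ereal s * top_lyapunov A \<mu> =
        (SUP \<nu>\<in>invariant_measures M. metric_entropy \<nu> left_shift + ereal s * top_lyapunov A \<nu>)}"

definition irreducible_matrices :: "(real^'n^'n) set \<Rightarrow> bool" where
  "irreducible_matrices S \<longleftrightarrow>
     \<not> (\<exists>U :: (real^'n) set. subspace U \<and> 0 < dim U \<and> dim U < CARD('n) \<and>
          (\<forall>B\<in>S. (\<lambda>v. B *v v) ` U \<subseteq> U))"

definition matrix_products :: "nat \<Rightarrow> (nat \<Rightarrow> real^'n^'n) \<Rightarrow> nat \<Rightarrow> (real^'n^'n) set" where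
  "matrix_products M A n = {matrix_product A i n | i. \<forall>k<n. i k \<in> {1..M}}"

definition ergodic :: "'a measure \<Rightarrow> ('a \<Rightarrow> 'a) \<Rightarrow> bool" where
  "ergodic \<mu> T \<longleftrightarrow>
     (\<forall>X\<in>sets \<mu>. T -` X \<inter> space \<mu> = X \<longrightarrow> measure \<mu> X = 0 \<or> measure \<mu> X = 1)"

definition totally_ergodic :: "'a measure \<Rightarrow> ('a \<Rightarrow> 'a) \<Rightarrow> bool" where
  "totally_ergodic \<mu> T \<longleftrightarrow> (\<forall>n\<ge>1. ergodic \<mu> (T ^^ n))"

definition mixing :: "'a measure \<Rightarrow> ('a \<Rightarrow> 'a) \<Rightarrow> bool" where
  "mixing \<mu> T \<longleftrightarrow>
     (\<forall>X\<in>sets \<mu>. \<forall>Y\<in>sets \<mu>.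
        (\<lambda>n. measure \<mu> (X \<inter> ((T ^^ n) -` Y \<inter> space \<mu>))) \<longlonglongrightarrow> measure \<mu> X * measure \<mu> Y)"

end

theory Submission
  imports Defs
begin

text \<open>
  The equilibrium state is a Gibbs measure, and both claims are read off from its Gibbs inequalities.
  Write \<open>\<phi>(w) = \<parallel>A\<^sub>w\<parallel>\<^sup>s\<close>, where \<open>A\<^sub>w\<close> is the product of the matrices along a word \<open>w\<close>.
  Irreducibility makes the vectors \<open>A\<^sub>w x\<close> span the whole space for every \<open>x \<noteq> 0\<close>, so that any two nonzero
  matrices have a nonzero product after a suitable \<open>A\<^sub>w\<close> is inserted between them; by compactness finitely
  many \<open>w\<close> suffice and the loss is bounded, \<open>c \<phi>(u) \<phi>(v) \<le> \<phi>(u w v)\<close> (\<open>irreducible_connecting_words\<close>).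
  Together with submultiplicativity this gives \<open>Z\<^sub>n = \<Sum>\<^bsub>|w| = n\<^esub> \<phi>(w)\<close> the exact growth \<open>e\<^bsup>nP\<^esup>\<close> up to constants,
  and a limit of the mean frequencies of subwords in \<open>\<phi>\<close>-weighted long words is an invariant measure \<open>m\<close> for
  which \<open>m[w]\<close> is comparable to \<open>\<phi>(w) e\<^bsup>-nP\<^esup>\<close> (\<open>gibbs_measure_exists\<close>).

  Metric entropy is a supremum over all finite partitions; \<open>kolmogorov_sinai\<close> replaces it by the entropy rate of
  blocks of letters, after which Gibbs' inequality yields \<open>h + s\<Lambda> \<le> P\<close> for every invariant measure
  (\<open>variational_inequality\<close>) and \<open>h + s\<Lambda> \<ge> P\<close> for \<open>m\<close> (\<open>gibbs_upper_bound_attains_pressure\<close>). Hence \<open>m\<close> is an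
  equilibrium state, and by uniqueness it is \<open>\<mu>\<close>. The only tuple for which this construction breaks down
  is the zero tuple; then every invariant measure is an equilibrium state, against uniqueness.

  If the \<open>n\<close>-step products are irreducible, the connecting words can be taken of length divisible by \<open>n\<close>, and the
  Gibbs inequalities turn the connecting inequality into
  \<open>\<Sum>\<^bsub>j\<in>J\<^esub> \<mu>([u] \<inter> \<sigma>\<^bsup>-(|u|+j)\<^esup>Y) \<ge> c \<mu>[u] \<mu>(Y)\<close> with a finite set \<open>J\<close> of multiples of \<open>n\<close>.
  The point is to apply this to a set \<open>X\<close> with \<open>X = \<sigma>\<^bsup>-|u|\<^esup>Y\<close>: then the left-hand side is
  \<open>\<Sum>\<^sub>j \<mu>([u] \<inter> \<sigma>\<^bsup>-j\<^esup>X)\<close>, so \<open>\<Union>\<^sub>j \<sigma>\<^bsup>-j\<^esup>X\<close> fills a fixed proportion of every cylinder and thus has full measure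
  (\<open>tail_event_translates_cover\<close>). A \<open>\<sigma>\<^sup>n\<close>-invariant set is its own translate, which proves the first claim.

  For the second claim take \<open>n = 1\<close>. Tail events of positive measure have measure at least \<open>1 / |J|\<close>, so the
  tail algebra has an atom; by recurrence the atom is invariant under some \<open>\<sigma>\<^sup>j\<close>, and total ergodicity
  makes it the whole space (\<open>totally_ergodic_tail_trivial\<close>). A trivial tail implies mixing, since events
  \<open>\<sigma>\<^bsup>-n\<^esup>Y\<^sub>n\<close> that keep a covariance with \<open>X\<close> as \<open>n\<close> grows would have a nontrivial upper limit in the tail
  (\<open>decreasing_algebras_asymptotic_independence\<close>).
\<close>

section \<open>Subadditive sequences\<close>

text \<open>
  Division with remainder, \<open>n = q k + r\<close> with \<open>1 \<le> r \<le> k\<close>: the remainder is kept positive because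
  subadditivity is only assumed for positive arguments.
\<close>

lemma subadditive_ratio_bound:
  fixes a :: "nat \<Rightarrow> real"
  assumes sub: "\<And>n m. n \<ge> 1 \<Longrightarrow> m \<ge> 1 \<Longrightarrow> a (n + m) \<le> a n + a m" and k: "k \<ge> 1"
  obtains B where "\<And>n. n \<ge> 1 \<Longrightarrow> a n / real n \<le> a k / real k + B / real n"
proof -
  define B where "B = \<bar>a k\<bar> + (\<Sum>r\<in>{1..k}. \<bar>a r\<bar>)"
  have multiple: "a (q * k + r) \<le> real q * a k + a r" if "r \<ge> 1" for q r
  proof (induction q)
    case (Suc q)
    have "a (Suc q * k + r) = a (k + (q * k + r))" by (simp add: algebra_simps)
    also have "\<dots> \<le> a k + a (q * k + r)" using that k by (intro sub) auto
    finally show ?case using Suc by (simp add: algebra_simps)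
  qed auto
  have "a n / real n \<le> a k / real k + B / real n" if n: "n \<ge> 1" for n
  proof -
    define q r where "q = (n - 1) div k" and "r = (n - 1) mod k + 1"
    have n_eq: "n = q * k + r" and r: "1 \<le> r" "r \<le> k"
      using n k div_mult_mod_eq[of "n - 1" k] mod_less_divisor[of k "n - 1"]
      by (auto simp: q_def r_def Suc_le_eq)
    have "a r \<le> (\<Sum>r\<in>{1..k}. \<bar>a r\<bar>)"
      using member_le_sum[of r "{1..k}" "\<lambda>r. \<bar>a r\<bar>"] r by auto
    moreover have "real q * a k \<le> real n * (a k / real k) + \<bar>a k\<bar>"
    proof -
      have "real q = (real n - real r) / real k" using n_eq k by (simp add: field_simps)
      then have "real q * a k = real n * (a k / real k) - (real r / real k) * a k"
        using k by (simp add: diff_divide_distrib left_diff_distrib)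
      moreover have "\<bar>(real r / real k) * a k\<bar> \<le> 1 * \<bar>a k\<bar>"
        unfolding abs_mult using r k by (intro mult_right_mono) auto
      ultimately show ?thesis by linarith
    qed
    ultimately have "a n \<le> real n * (a k / real k) + B"
      using multiple[of r q] r n_eq unfolding B_def by auto
    then show ?thesis using n by (simp add: field_simps)
  qed
  then show ?thesis using that by blast
qed

text \<open>
  The limit may be \<open>- \<infinity>\<close>, as it can be for Lyapunov exponents of products of singular matrices.
\<close>

lemma fekete_ereal:
  fixes a :: "nat \<Rightarrow> real"
  assumes sub: "\<And>n m. n \<ge> 1 \<Longrightarrow> m \<ge> 1 \<Longrightarrow> a (n + m) \<le> a n + a m"
  shows "(\<lambda>n. ereal (a n / real n)) \<longlonglongrightarrow> (INF n\<in>{1..}. ereal (a n / real n))"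
proof -
  let ?L = "INF n\<in>{1..}. ereal (a n / real n)"
  have "?L \<le> liminf (\<lambda>n. ereal (a n / real n))"
    by (intro Liminf_bounded eventually_sequentiallyI[of 1]) (auto intro: INF_lower)
  moreover have "limsup (\<lambda>n. ereal (a n / real n)) \<le> ?L"
  proof (rule INF_greatest)
    fix k :: nat assume "k \<in> {1..}"
    then have k: "k \<ge> 1" by simp
    obtain B where B: "\<And>n. n \<ge> 1 \<Longrightarrow> a n / real n \<le> a k / real k + B / real n"
      using subadditive_ratio_bound[of a k] sub k by blast
    have "(\<lambda>n. a k / real k + B / real n) \<longlonglongrightarrow> a k / real k + 0"
      by (intro tendsto_intros tendsto_divide_0[OF tendsto_const] filterlim_at_top_imp_at_infinity
          filterlim_real_sequentially)
    then have "limsup (\<lambda>n. ereal (a k / real k + B / real n)) = ereal (a k / real k)"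
      by (intro lim_imp_Limsup) auto
    moreover have "limsup (\<lambda>n. ereal (a n / real n)) \<le> limsup (\<lambda>n. ereal (a k / real k + B / real n))"
      by (intro Limsup_mono eventually_sequentiallyI[of 1]) (use B in auto)
    ultimately show "limsup (\<lambda>n. ereal (a n / real n)) \<le> ereal (a k / real k)" by simp
  qed
  ultimately show ?thesis
    using Liminf_le_Limsup[of sequentially "\<lambda>n. ereal (a n / real n)"]
    by (subst tendsto_iff_Liminf_eq_Limsup) auto
qed

lemma fekete:
  fixes a :: "nat \<Rightarrow> real"
  assumes sub: "\<And>n m. n \<ge> 1 \<Longrightarrow> m \<ge> 1 \<Longrightarrow> a (n + m) \<le> a n + a m"
    and low: "\<And>n. n \<ge> 1 \<Longrightarrow> B \<le> a n / real n"
  obtains l where "(\<lambda>n. a n / real n) \<longlonglongrightarrow> l" "\<And>n. n \<ge> 1 \<Longrightarrow> l \<le> a n / real n"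
proof -
  let ?L = "INF n\<in>{1..}. ereal (a n / real n)"
  have "ereal B \<le> ?L" using low by (intro INF_greatest) auto
  moreover have "?L \<le> ereal (a 1 / real 1)" by (intro INF_lower) auto
  ultimately obtain l where l: "?L = ereal l" by (cases ?L) auto
  have "(\<lambda>n. a n / real n) \<longlonglongrightarrow> l"
    using fekete_ereal[of a] sub unfolding l by auto
  moreover have "l \<le> a n / real n" if "n \<ge> 1" for n
  proof -
    have "?L \<le> ereal (a n / real n)" using that by (intro INF_lower) auto
    then show ?thesis unfolding l by simp
  qed
  ultimately show ?thesis using that by blast
qed

section \<open>Words and clopen subsets of the full shift\<close>

definition words :: "nat \<Rightarrow> nat \<Rightarrow> nat list set" where
  "words M n = {w. length w = n \<and> set w \<subseteq> {1..M}}"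

definition initial :: "nat \<Rightarrow> (nat \<Rightarrow> 'a) \<Rightarrow> 'a list" where
  "initial n x = map x [0..<n]"

text \<open>
  As \<open>n\<close> and \<open>S\<close> vary these sets form the algebra of clopen subsets of the full shift.
\<close>

definition clopen :: "nat \<Rightarrow> nat \<Rightarrow> nat list set \<Rightarrow> (nat \<Rightarrow> nat) set" where
  "clopen M n S = {x \<in> full_shift M. initial n x \<in> S}"

abbreviation cylinder :: "nat \<Rightarrow> nat list \<Rightarrow> (nat \<Rightarrow> nat) set" where
  "cylinder M w \<equiv> clopen M (length w) {w}"

abbreviation shift_vimage :: "nat \<Rightarrow> nat \<Rightarrow> (nat \<Rightarrow> nat) set \<Rightarrow> (nat \<Rightarrow> nat) set" where
  "shift_vimage M k Y \<equiv> (left_shift ^^ k) -` Y \<inter> full_shift M"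

lemma finite_words [simp, intro]: "finite (words M n)"
  unfolding words_def using finite_lists_length_eq[of "{1..M}" n] by (simp add: conj_commute)

lemma words_0 [simp]: "words M 0 = {[]}"
  by (auto simp: words_def)

lemma append_in_words: "u \<in> words M n \<Longrightarrow> v \<in> words M m \<Longrightarrow> u @ v \<in> words M (n + m)"
  by (auto simp: words_def)

lemma sum_words_add: "(\<Sum>w\<in>words M (n + m). f w) = (\<Sum>u\<in>words M n. \<Sum>v\<in>words M m. f (u @ v))"
proof -
  have "(\<Sum>(u, v)\<in>words M n \<times> words M m. f (u @ v)) = (\<Sum>w\<in>words M (n + m). f w)"
    by (rule sum.reindex_bij_witness[of _ "\<lambda>w. (take n w, drop n w)" "\<lambda>(u, v). u @ v"])
      (auto simp: words_def dest: in_set_takeD in_set_dropD)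
  then show ?thesis by (simp add: sum.cartesian_product)
qed

lemma sum_words_1: "(\<Sum>w\<in>words M (Suc 0). f w) = (\<Sum>i\<in>{1..M}. f [i])"
  by (rule sum.reindex_bij_witness[of _ "\<lambda>i. [i]" hd]) (auto simp: words_def length_Suc_conv)

lemma length_initial [simp]: "length (initial n x) = n"
  by (simp add: initial_def)

lemma initial_nth [simp]: "i < n \<Longrightarrow> initial n x ! i = x i"
  by (simp add: initial_def)

lemma left_shift_funpow: "(left_shift ^^ k) x = (\<lambda>n. x (n + k))"
  by (induction k arbitrary: x) (auto simp: left_shift_def)

lemma initial_add: "initial (n + m) x = initial n x @ initial m ((left_shift ^^ n) x)"
  by (rule nth_equalityI) (auto simp: nth_append left_shift_funpow)

lemma initial_Suc: "initial (Suc n) x = initial n x @ [x n]"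
  by (simp add: initial_def)

lemma initial_in_words: "x \<in> full_shift M \<Longrightarrow> initial n x \<in> words M n"
  by (auto simp: words_def initial_def full_shift_def)

lemma take_initial: "n \<le> m \<Longrightarrow> take n (initial m x) = initial n x"
  by (rule nth_equalityI) auto

lemma left_shift_funpow_in [simp]: "x \<in> full_shift M \<Longrightarrow> (left_shift ^^ k) x \<in> full_shift M"
  by (auto simp: full_shift_def left_shift_funpow)

lemma left_shift_in [simp]: "x \<in> full_shift M \<Longrightarrow> left_shift x \<in> full_shift M"
  by (auto simp: full_shift_def left_shift_def)

lemma space_shift_borel [simp]: "space (shift_borel M) = full_shift M"
  by (simp add: shift_borel_def space_restrict_space)

lemma coordinate_measurable: "(\<lambda>x. x i) \<in> shift_borel M \<rightarrow>\<^sub>M count_space UNIV"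
proof -
  have "(\<lambda>x. x i) \<in> borel_measurable (PiM UNIV (\<lambda>_. borel :: nat measure))"
    by (rule measurable_component_singleton) simp
  then have "(\<lambda>x. x i :: nat) \<in> borel_measurable borel"
    by (simp cong: measurable_cong_sets add: sets_PiM_equal_borel)
  then have "(\<lambda>x. x i :: nat) \<in> borel_measurable (shift_borel M)"
    unfolding shift_borel_def by (rule measurable_restrict_space1)
  then show ?thesis
    by (subst measurable_cong_sets[OF refl sets_borel_eq_count_space[symmetric]])
qed

lemma initial_measurable [measurable]: "initial n \<in> shift_borel M \<rightarrow>\<^sub>M count_space UNIV"
proof (induction n)
  case 0
  then show ?case by (simp add: initial_def[abs_def])
next
  case (Suc n)
  note [measurable] = Suc coordinate_measurable
  show ?case unfolding initial_Suc[abs_def] by measurable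
qed

lemma clopen_in_sets [measurable]: "clopen M n S \<in> sets (shift_borel M)"
proof -
  have "clopen M n S = initial n -` S \<inter> space (shift_borel M)"
    by (auto simp: clopen_def)
  also have "\<dots> \<in> sets (shift_borel M)"
    by (rule measurable_sets[OF initial_measurable]) simp
  finally show ?thesis .
qed

lemma clopen_lift:
  assumes "n \<le> m"
  shows "clopen M n S = clopen M m {w. take n w \<in> S}"
  using assms by (auto simp: clopen_def take_initial)

lemma shift_vimage_clopen:
  "shift_vimage M k (clopen M n S) = clopen M (k + n) {w. drop k w \<in> S}"
  by (auto simp: clopen_def initial_add)

text \<open>
  Inequalities between measures are established on cylinders; this additivity carries them over to clopen sets.
\<close>

lemma measure_shift_clopen:
  assumes "finite_measure \<nu>" "sets \<nu> = sets (shift_borel M)" "U \<in> sets \<nu>"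
  shows "measure \<nu> (U \<inter> shift_vimage M k (clopen M n S))
    = (\<Sum>w\<in>words M n \<inter> S. measure \<nu> (U \<inter> shift_vimage M k (cylinder M w)))"
proof -
  interpret finite_measure \<nu> by fact
  let ?B = "\<lambda>w. U \<inter> shift_vimage M k (clopen M n {w})"
  have cyl: "cylinder M w = clopen M n {w}" if "w \<in> words M n \<inter> S" for w
    using that by (simp add: words_def)
  have "U \<inter> shift_vimage M k (clopen M n S) = (\<Union>w\<in>words M n \<inter> S. ?B w)"
    using initial_in_words[of _ M n] by (auto simp: clopen_def)
  also have "measure \<nu> \<dots> = (\<Sum>w\<in>words M n \<inter> S. measure \<nu> (?B w))"
  proof (intro finite_measure_finite_Union)
    show "?B ` (words M n \<inter> S) \<subseteq> sets \<nu>"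
      by (intro image_subsetI sets.Int[OF assms(3)]) (simp add: assms(2) shift_vimage_clopen)
    show "disjoint_family_on ?B (words M n \<inter> S)"
      unfolding disjoint_family_on_def by (auto simp: clopen_def)
  qed auto
  also have "\<dots> = (\<Sum>w\<in>words M n \<inter> S. measure \<nu> (U \<inter> shift_vimage M k (cylinder M w)))"
    by (intro sum.cong refl) (simp only: cyl)
  finally show ?thesis .
qed

lemma measure_clopen:
  assumes "finite_measure \<nu>" "sets \<nu> = sets (shift_borel M)" "U \<in> sets \<nu>"
  shows "measure \<nu> (U \<inter> clopen M n S) = (\<Sum>w\<in>words M n \<inter> S. measure \<nu> (U \<inter> cylinder M w))"
proof -
  have "shift_vimage M 0 (clopen M m T) = clopen M m T" for m T by (auto simp: clopen_def)
  then show ?thesis using measure_shift_clopen[OF assms, of 0 n S] by simp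
qed

definition clopen_algebra :: "nat \<Rightarrow> (nat \<Rightarrow> nat) set set" where
  "clopen_algebra M = {clopen M n S | n S. True}"

lemma clopen_algebra_algebra: "algebra (full_shift M) (clopen_algebra M)"
  unfolding algebra_iff_Un
proof (intro conjI ballI)
  show "clopen_algebra M \<subseteq> Pow (full_shift M)" by (auto simp: clopen_algebra_def clopen_def)
  have "{} = clopen M 0 {}" by (simp add: clopen_def)
  then show "{} \<in> clopen_algebra M" unfolding clopen_algebra_def by blast
next
  fix a assume "a \<in> clopen_algebra M"
  then obtain n S where "a = clopen M n S" by (auto simp: clopen_algebra_def)
  then have "full_shift M - a = clopen M n (- S)" by (auto simp: clopen_def)
  then show "full_shift M - a \<in> clopen_algebra M" unfolding clopen_algebra_def by blast
next
  fix a b assume "a \<in> clopen_algebra M" "b \<in> clopen_algebra M"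
  then obtain n S m R where ab: "a = clopen M n S" "b = clopen M m R" by (auto simp: clopen_algebra_def)
  have "a = clopen M (max n m) {w. take n w \<in> S}" "b = clopen M (max n m) {w. take m w \<in> R}"
    unfolding ab by (rule clopen_lift, simp)+
  then have "a \<union> b = clopen M (max n m) ({w. take n w \<in> S} \<union> {w. take m w \<in> R})"
    by (auto simp: clopen_def)
  then show "a \<union> b \<in> clopen_algebra M" unfolding clopen_algebra_def by blast
qed

lemma sets_shift_borel: "sets (shift_borel M) = sigma_sets (full_shift M) (clopen_algebra M)"
proof
  show "sigma_sets (full_shift M) (clopen_algebra M) \<subseteq> sets (shift_borel M)"
    using sets.sigma_sets_subset[of "clopen_algebra M" "shift_borel M"] clopen_in_sets
    unfolding clopen_algebra_def space_shift_borel by blast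
next
  interpret A: algebra "full_shift M" "clopen_algebra M" by (rule clopen_algebra_algebra)
  let ?N = "sigma (full_shift M) (clopen_algebra M)"
  have sp: "space ?N = full_shift M" and se: "sets ?N = sigma_sets (full_shift M) (clopen_algebra M)"
    using A.space_closed by auto
  have "(\<lambda>x. x) \<in> ?N \<rightarrow>\<^sub>M PiM UNIV (\<lambda>_. borel :: nat measure)"
  proof (rule measurable_PiM_single)
    fix A :: "nat set" and i :: nat
    have "{x \<in> space ?N. x i \<in> A} = clopen M (Suc i) {w. w ! i \<in> A}"
      unfolding sp by (auto simp: clopen_def)
    then show "{x \<in> space ?N. x i \<in> A} \<in> sets ?N"
      unfolding se by (auto simp: clopen_algebra_def)
  qed auto
  then have id: "(\<lambda>x. x) \<in> ?N \<rightarrow>\<^sub>M borel" by (simp cong: measurable_cong_sets add: sets_PiM_equal_borel)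
  show "sets (shift_borel M) \<subseteq> sigma_sets (full_shift M) (clopen_algebra M)"
  proof
    fix X assume "X \<in> sets (shift_borel M)"
    then obtain Y where "Y \<in> sets borel" "X = full_shift M \<inter> Y"
      by (auto simp: shift_borel_def sets_restrict_space)
    then have "X = (\<lambda>x. x) -` Y \<inter> space ?N" unfolding sp by auto
    then show "X \<in> sigma_sets (full_shift M) (clopen_algebra M)"
      using measurable_sets[OF id \<open>Y \<in> sets borel\<close>] se by simp
  qed
qed

lemma left_shift_measurable [measurable]: "left_shift \<in> shift_borel M \<rightarrow>\<^sub>M shift_borel M"
proof -
  interpret A: algebra "full_shift M" "clopen_algebra M" by (rule clopen_algebra_algebra)
  show ?thesis
  proof (rule measurable_sigma_sets[OF sets_shift_borel A.space_closed])
    fix X assume "X \<in> clopen_algebra M"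
    then obtain n S where X: "X = clopen M n S" by (auto simp: clopen_algebra_def)
    have "initial (Suc n) x = x 0 # initial n (left_shift x)" for x :: "nat \<Rightarrow> nat"
      using initial_add[of 1 n x] by (simp add: initial_def)
    then have "left_shift -` X \<inter> space (shift_borel M) = clopen M (Suc n) {w. tl w \<in> S}"
      by (auto simp: X clopen_def)
    then show "left_shift -` X \<inter> space (shift_borel M) \<in> sets (shift_borel M)" by simp
  qed auto
qed

lemma funpow_measurable: "f \<in> N \<rightarrow>\<^sub>M N \<Longrightarrow> (f ^^ k) \<in> N \<rightarrow>\<^sub>M N"
  by (induction k) (auto simp: id_def[symmetric])

lemma distr_funpow:
  assumes "f \<in> N \<rightarrow>\<^sub>M N" "distr N N f = N"
  shows "distr N N (f ^^ k) = N"
proof (induction k)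
  case (Suc k)
  have "distr (distr N N (f ^^ k)) N f = distr N N (f \<circ> f ^^ k)"
    by (rule distr_distr[OF assms(1) funpow_measurable[OF assms(1)]])
  with Suc assms show ?case by (simp add: comp_def)
qed (simp add: id_def)

locale invariant_measure =
  fixes M :: nat and \<nu> :: "(nat \<Rightarrow> nat) measure"
  assumes invariant: "\<nu> \<in> invariant_measures M"
begin

sublocale prob_space \<nu>
  using invariant by (simp add: invariant_measures_def)

lemma sets_eq [simp, measurable_cong]: "sets \<nu> = sets (shift_borel M)"
  using invariant by (simp add: invariant_measures_def)

lemma space_eq [simp]: "space \<nu> = full_shift M"
  using sets_eq_imp_space_eq[OF sets_eq] by simp

lemma shift_measurable: "(left_shift ^^ k) \<in> \<nu> \<rightarrow>\<^sub>M \<nu>"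
  by (rule funpow_measurable) measurable

lemma shift_vimage_sets: "Y \<in> sets (shift_borel M) \<Longrightarrow> shift_vimage M k Y \<in> sets (shift_borel M)"
  using measurable_sets[OF shift_measurable, of Y k] by simp

lemma distr_shift: "distr \<nu> \<nu> (left_shift ^^ k) = \<nu>"
proof (rule distr_funpow)
  show "left_shift \<in> \<nu> \<rightarrow>\<^sub>M \<nu>" using shift_measurable[of 1] by simp
  show "distr \<nu> \<nu> left_shift = \<nu>" using invariant by (simp add: invariant_measures_def)
qed

lemma measure_shift_vimage:
  assumes "Y \<in> sets (shift_borel M)"
  shows "measure \<nu> (shift_vimage M k Y) = measure \<nu> Y"
  using measure_distr[OF shift_measurable, of Y k] assms by (simp add: distr_shift)

text \<open>
  The sets that can be approximated in measure by clopen sets form a \<open>\<sigma>\<close>-algebra: for a countable union,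
  a finite subunion already has almost full measure and is approximated piece by piece.
\<close>

lemma clopen_approximation:
  assumes "Y \<in> sets (shift_borel M)" "e > 0"
  shows "\<exists>n S. measure \<nu> (Y - clopen M n S) + measure \<nu> (clopen M n S - Y) < e"
proof -
  interpret A: algebra "full_shift M" "clopen_algebra M" by (rule clopen_algebra_algebra)
  let ?d = "\<lambda>Y E. measure \<nu> (Y - E) + measure \<nu> (E - Y)"
  have ssets: "sigma_sets (full_shift M) (clopen_algebra M) = sets (shift_borel M)"
    by (simp add: sets_shift_borel)
  have cl: "E \<in> sets (shift_borel M)" if "E \<in> clopen_algebra M" for E
    using that by (auto simp: clopen_algebra_def)
  have "Y \<in> sigma_sets (full_shift M) (clopen_algebra M)"
    using assms by (simp add: sets_shift_borel)
  then have "\<forall>e>0. \<exists>E\<in>clopen_algebra M. ?d Y E < e"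
  proof induction
    case (Basic a)
    then show ?case by (auto intro!: bexI[of _ a])
  next
    case Empty
    then show ?case using A.empty_sets by (auto intro!: bexI[of _ "{}"])
  next
    case (Compl a)
    show ?case
    proof (intro allI impI)
      fix e :: real assume "e > 0"
      then obtain E where E: "E \<in> clopen_algebra M" "?d a E < e" using Compl(2) by meson
      have "a \<subseteq> full_shift M" "E \<subseteq> full_shift M"
        using E(1) A.space_closed sigma_sets_into_sp[OF A.space_closed Compl(1)] by auto
      then have "full_shift M - a - (full_shift M - E) = E - a"
        "full_shift M - E - (full_shift M - a) = a - E" by auto
      with E show "\<exists>E\<in>clopen_algebra M. ?d (full_shift M - a) E < e"
        by (intro bexI[of _ "full_shift M - E"]) auto
    qed
  next
    case (Union a)
    have a[measurable]: "a i \<in> sets (shift_borel M)" for i using Union(1) by (simp add: ssets)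
    show ?case
    proof (intro allI impI)
      fix e :: real assume e: "e > 0"
      have "(\<lambda>n. measure \<nu> (\<Union>i\<le>n. a i)) \<longlonglongrightarrow> measure \<nu> (\<Union>n. \<Union>i\<le>n. a i)"
      proof (intro finite_Lim_measure_incseq)
        show "range (\<lambda>n. \<Union>i\<le>n. a i) \<subseteq> sets \<nu>" using a by auto
        show "incseq (\<lambda>n. \<Union>i\<le>n. a i)" unfolding incseq_def by force
      qed
      moreover have "(\<Union>n. \<Union>i\<le>n. a i) = (\<Union>i. a i)" by auto
      ultimately have "\<forall>\<^sub>F n in sequentially. dist (measure \<nu> (\<Union>i\<le>n. a i)) (measure \<nu> (\<Union>i. a i)) < e / 2"
        using e tendstoD[of _ _ sequentially "e / 2"] by auto
      then obtain N where N: "dist (measure \<nu> (\<Union>i\<le>N. a i)) (measure \<nu> (\<Union>i. a i)) < e / 2"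
        by (auto simp: eventually_sequentially)
      have "\<forall>i. \<exists>E\<in>clopen_algebra M. ?d (a i) E < e / (2 * real (Suc N))"
        using Union(2) e by simp
      then obtain E where "\<forall>i. E i \<in> clopen_algebra M \<and> ?d (a i) (E i) < e / (2 * real (Suc N))"
        unfolding Bex_def choice_iff by blast
      then have E: "\<And>i. E i \<in> clopen_algebra M" "\<And>i. ?d (a i) (E i) < e / (2 * real (Suc N))"
        by blast+
      define F where "F = (\<Union>i\<le>N. E i)"
      have F: "F \<in> clopen_algebra M" unfolding F_def using E(1) by (intro A.finite_UN) auto
      have [measurable]: "E i \<in> sets (shift_borel M)" for i using E(1) cl by blast
      have [measurable]: "F \<in> sets (shift_borel M)" using F cl by blast
      have "measure \<nu> ((\<Union>i. a i) - F) \<le>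
        measure \<nu> (((\<Union>i. a i) - (\<Union>i\<le>N. a i)) \<union> (\<Union>i\<le>N. a i - E i))"
        by (intro finite_measure_mono) (auto simp: F_def)
      also have "\<dots> \<le> measure \<nu> ((\<Union>i. a i) - (\<Union>i\<le>N. a i)) + measure \<nu> (\<Union>i\<le>N. a i - E i)"
        by (intro measure_Un_le) auto
      finally have 1: "measure \<nu> ((\<Union>i. a i) - F) \<le>
        measure \<nu> ((\<Union>i. a i) - (\<Union>i\<le>N. a i)) + measure \<nu> (\<Union>i\<le>N. a i - E i)" .
      have 2: "measure \<nu> (F - (\<Union>i. a i)) \<le> measure \<nu> (\<Union>i\<le>N. E i - a i)"
        by (intro finite_measure_mono) (auto simp: F_def)
      have "measure \<nu> ((\<Union>i. a i) - (\<Union>i\<le>N. a i)) = measure \<nu> (\<Union>i. a i) - measure \<nu> (\<Union>i\<le>N. a i)"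
        by (intro finite_measure_Diff) auto
      then have 3: "measure \<nu> ((\<Union>i. a i) - (\<Union>i\<le>N. a i)) < e / 2"
        using N unfolding dist_real_def by linarith
      have 4: "measure \<nu> (\<Union>i\<le>N. a i - E i) \<le> (\<Sum>i\<le>N. measure \<nu> (a i - E i))"
        by (intro measure_UNION_le) auto
      have 5: "measure \<nu> (\<Union>i\<le>N. E i - a i) \<le> (\<Sum>i\<le>N. measure \<nu> (E i - a i))"
        by (intro measure_UNION_le) auto
      have "?d (\<Union>i. a i) F < e / 2 + (\<Sum>i\<le>N. ?d (a i) (E i))"
        unfolding sum.distrib using 1 2 3 4 5 by linarith
      also have "(\<Sum>i\<le>N. ?d (a i) (E i)) \<le> (\<Sum>i\<le>N. e / (2 * real (Suc N)))"
        by (intro sum_mono less_imp_le E(2))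
      also have "\<dots> = e / 2" using e by (simp add: divide_simps)
      finally have "?d (\<Union>i. a i) F < e" by simp
      with F show "\<exists>E\<in>clopen_algebra M. ?d (\<Union>i. a i) E < e" by (rule bexI[rotated])
    qed
  qed
  then obtain E where E: "E \<in> clopen_algebra M" "?d Y E < e" using assms(2) by meson
  then obtain n S where "E = clopen M n S" unfolding clopen_algebra_def by blast
  with E(2) show ?thesis by meson
qed

end

section \<open>Entropy of functions with finitely many values\<close>

text \<open>
  Concavity of the logarithm, in the form \<open>ln t \<le> t - 1\<close>. The inequality serves twice: with \<open>q\<close> a product of
  marginals it is subadditivity of entropy, and with \<open>q\<close> a potential it is the variational inequality.
\<close>

lemma gibbs_inequality:
  fixes p q :: "'a \<Rightarrow> real"
  assumes V: "finite V" and p: "\<And>v. v \<in> V \<Longrightarrow> 0 \<le> p v" "(\<Sum>v\<in>V. p v) = 1"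
    and q: "\<And>v. v \<in> V \<Longrightarrow> 0 \<le> q v" "\<And>v. v \<in> V \<Longrightarrow> q v = 0 \<Longrightarrow> p v = 0"
  shows "(\<Sum>v\<in>V. p v * ln (q v)) - (\<Sum>v\<in>V. p v * ln (p v)) \<le> ln (\<Sum>v\<in>V. q v)"
proof -
  define Q where "Q = (\<Sum>v\<in>V. q v)"
  have "Q \<noteq> 0"
  proof
    assume "Q = 0"
    then have "\<forall>v\<in>V. q v = 0" using V q(1) by (simp add: Q_def sum_nonneg_eq_0_iff)
    then have "(\<Sum>v\<in>V. p v) = 0" using q(2) by (intro sum.neutral) auto
    then show False using p(2) by simp
  qed
  then have Q: "Q > 0" using q(1) sum_nonneg[of V q] by (auto simp: Q_def less_le)
  have "p v * ln (q v) - p v * ln (p v) - p v * ln Q \<le> q v / Q - p v" if v: "v \<in> V" for v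
  proof (cases "p v = 0")
    case False
    then have pos: "p v > 0" "q v > 0" using p(1) q v by (auto simp: less_le)
    have "p v * ln (q v) - p v * ln (p v) - p v * ln Q = p v * ln (q v / (p v * Q))"
      using pos Q by (simp add: ln_div ln_mult algebra_simps)
    also have "\<dots> \<le> p v * (q v / (p v * Q) - 1)"
      using pos Q by (intro mult_left_mono ln_le_minus_one) auto
    also have "\<dots> = q v / Q - p v" using pos Q by (simp add: field_simps)
    finally show ?thesis .
  qed (use q(1) v Q in simp)
  then have "(\<Sum>v\<in>V. p v * ln (q v) - p v * ln (p v) - p v * ln Q) \<le> (\<Sum>v\<in>V. q v / Q - p v)"
    by (rule sum_mono)
  also have "\<dots> = 0"
    using Q p(2) by (simp add: sum_subtractf Q_def flip: sum_divide_distrib)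
  finally show ?thesis
    using p(2) by (simp add: sum_subtractf Q_def flip: sum_distrib_right)
qed

lemma minus_mult_ln_le_sqrt:
  fixes t :: real
  assumes "0 \<le> t"
  shows "- (t * ln t) \<le> 2 * sqrt t"
proof (cases "t = 0")
  case False
  then have t: "t > 0" using assms by simp
  have "- ln t = 2 * ln (1 / sqrt t)" using t by (simp add: ln_div ln_sqrt)
  also have "\<dots> \<le> 2 * (1 / sqrt t - 1)" using t by (intro mult_left_mono ln_le_minus_one) auto
  finally have "t * (- ln t) \<le> t * (2 * (1 / sqrt t - 1))" using t by (intro mult_left_mono) auto
  also have "\<dots> = 2 * (t / sqrt t) - 2 * t" by (simp add: algebra_simps)
  also have "t / sqrt t = sqrt t" using t by (simp add: real_div_sqrt)
  finally show ?thesis using t by simp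
qed simp

definition level_prob :: "'a measure \<Rightarrow> ('a \<Rightarrow> 'b) \<Rightarrow> 'b \<Rightarrow> real" where
  "level_prob \<nu> f v = measure \<nu> {x \<in> space \<nu>. f x = v}"

text \<open>
  Entropy is developed for functions with finite range rather than for partitions: joins of partitions become
  pairs and lists of values, and refinement becomes functional dependence.
\<close>

definition entropy_of :: "'a measure \<Rightarrow> ('a \<Rightarrow> 'b) \<Rightarrow> real" where
  "entropy_of \<nu> f = - (\<Sum>v\<in>f ` space \<nu>. level_prob \<nu> f v * ln (level_prob \<nu> f v))"

lemma simple_function_level_sets:
  "simple_function \<nu> f \<Longrightarrow> {x \<in> space \<nu>. f x = v} \<in> sets \<nu>"
  using simple_functionD(2)[of \<nu> f "{v}"] by (simp add: vimage_def Int_def conj_commute)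

lemma entropy_of_superset:
  assumes "finite V" "f ` space \<nu> \<subseteq> V"
  shows "entropy_of \<nu> f = - (\<Sum>v\<in>V. level_prob \<nu> f v * ln (level_prob \<nu> f v))"
proof -
  have "level_prob \<nu> f v = 0" if "v \<notin> f ` space \<nu>" for v
  proof -
    have "{x \<in> space \<nu>. f x = v} = {}" using that by auto
    then show ?thesis unfolding level_prob_def by (simp only: measure_empty)
  qed
  then show ?thesis unfolding entropy_of_def
    using assms by (intro arg_cong[where f = uminus] sum.mono_neutral_left) auto
qed

context prob_space
begin

lemma level_prob_bounds: "0 \<le> level_prob M f v" "level_prob M f v \<le> 1"
  by (auto simp: level_prob_def)

lemma entropy_of_nonneg: "0 \<le> entropy_of M f"
proof -
  have "level_prob M f v * ln (level_prob M f v) \<le> 0" for v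
    using level_prob_bounds[of f v] by (intro mult_nonneg_nonpos) (auto simp: ln_le_zero_iff le_less)
  then show ?thesis unfolding entropy_of_def by (simp add: sum_nonpos)
qed

lemma level_prob_marginal:
  assumes f: "simple_function M f" and g: "simple_function M g"
    and fg: "\<And>x. x \<in> space M \<Longrightarrow> g x = k (f x)"
  shows "level_prob M g w = (\<Sum>v\<in>{v\<in>f ` space M. k v = w}. level_prob M f v)"
proof -
  have fin: "finite {v\<in>f ` space M. k v = w}" using simple_functionD(1)[OF f] by auto
  have "{x \<in> space M. g x = w} = (\<Union>v\<in>{v\<in>f ` space M. k v = w}. {x \<in> space M. f x = v})"
    using fg by auto
  also have "prob \<dots> = (\<Sum>v\<in>{v\<in>f ` space M. k v = w}. prob {x \<in> space M. f x = v})"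
    by (intro finite_measure_finite_Union fin)
      (auto simp: disjoint_family_on_def intro: simple_function_level_sets[OF f])
  finally show ?thesis by (simp add: level_prob_def)
qed

lemma sum_level_prob:
  assumes "simple_function M f"
  shows "(\<Sum>v\<in>f ` space M. level_prob M f v) = 1"
  using level_prob_marginal[OF assms, of "\<lambda>_. ()" "\<lambda>_. ()" "()"] prob_space
  by (simp add: level_prob_def)

text \<open>
  A function of \<open>f\<close> carries no more information than \<open>f\<close>; dependence on \<open>f\<close> is expressed by kernels, so that no
  factorising function has to be named.
\<close>

lemma entropy_of_mono:
  assumes f: "simple_function M f" and g: "simple_function M g"
    and ker: "\<And>x y. x \<in> space M \<Longrightarrow> y \<in> space M \<Longrightarrow> f x = f y \<Longrightarrow> g x = g y"
  shows "entropy_of M g \<le> entropy_of M f"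
proof -
  let ?p = "level_prob M f" and ?q = "level_prob M g"
  define k where "k v = g (SOME x. x \<in> space M \<and> f x = v)" for v
  have k: "g x = k (f x)" if "x \<in> space M" for x
  proof -
    have "\<exists>y. y \<in> space M \<and> f y = f x" using that by auto
    from someI_ex[OF this] show ?thesis unfolding k_def using ker[of x] that by metis
  qed
  have fin: "finite (f ` space M)" "finite (g ` space M)" using f g by (auto dest: simple_functionD)
  have marg: "?q w = (\<Sum>v\<in>{v\<in>f ` space M. k v = w}. ?p v)" for w
    by (rule level_prob_marginal[OF f g k])
  have "(\<Sum>v\<in>f ` space M. ?p v * ln (?p v)) \<le> (\<Sum>v\<in>f ` space M. ?p v * ln (?q (k v)))"
  proof (rule sum_mono)
    fix v assume v: "v \<in> f ` space M"
    have "?p v \<le> ?q (k v)" unfolding marg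
      using v fin by (intro member_le_sum) (auto simp: level_prob_bounds)
    then show "?p v * ln (?p v) \<le> ?p v * ln (?q (k v))"
      using level_prob_bounds(1)[of f v] by (cases "?p v = 0") (auto intro!: mult_left_mono)
  qed
  also have "\<dots> = (\<Sum>w\<in>g ` space M. \<Sum>v\<in>{v\<in>f ` space M. k v = w}. ?p v * ln (?q (k v)))"
    using fin k by (intro sum.group[symmetric]) auto
  also have "\<dots> = (\<Sum>w\<in>g ` space M. ?q w * ln (?q w))"
    unfolding marg by (intro sum.cong refl) (simp add: sum_distrib_right)
  finally show ?thesis unfolding entropy_of_def by simp
qed

text \<open>
  Gibbs' inequality for the joint distribution against the product of its marginals.
\<close>

lemma entropy_of_pair:
  assumes f: "simple_function M f" and g: "simple_function M g"
  shows "entropy_of M (\<lambda>x. (f x, g x)) \<le> entropy_of M f + entropy_of M g"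
proof -
  let ?p = "level_prob M f" and ?q = "level_prob M g" and ?r = "level_prob M (\<lambda>x. (f x, g x))"
  let ?V = "f ` space M" and ?W = "g ` space M"
  have fg: "simple_function M (\<lambda>x. (f x, g x))" using f g by (rule simple_function_Pair)
  have fin: "finite ?V" "finite ?W" using f g by (auto dest: simple_functionD)
  have sub: "(\<lambda>x. (f x, g x)) ` space M \<subseteq> ?V \<times> ?W" by auto
  have zero: "?r z = 0" if "z \<notin> (\<lambda>x. (f x, g x)) ` space M" for z
  proof -
    have "{x \<in> space M. (f x, g x) = z} = {}" using that by auto
    then show ?thesis unfolding level_prob_def by (simp only: measure_empty)
  qed
  have p: "?p v = (\<Sum>w\<in>?W. ?r (v, w))" if "v \<in> ?V" for v
  proof -
    have "?p v = (\<Sum>z\<in>{z\<in>(\<lambda>x. (f x, g x)) ` space M. fst z = v}. ?r z)"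
      by (rule level_prob_marginal[OF fg f]) simp
    also have "\<dots> = (\<Sum>z\<in>{v} \<times> ?W. ?r z)"
      using fin zero that by (intro sum.mono_neutral_left) auto
    finally show ?thesis by (simp add: sum.cartesian_product')
  qed
  have q: "?q w = (\<Sum>v\<in>?V. ?r (v, w))" if "w \<in> ?W" for w
  proof -
    have "?q w = (\<Sum>z\<in>{z\<in>(\<lambda>x. (f x, g x)) ` space M. snd z = w}. ?r z)"
      by (rule level_prob_marginal[OF fg g]) simp
    also have "\<dots> = (\<Sum>z\<in>?V \<times> {w}. ?r z)"
      using fin zero that by (intro sum.mono_neutral_left) auto
    finally show ?thesis by (simp add: sum.cartesian_product')
  qed
  have pq: "?r (v, w) \<le> ?p v" "?r (v, w) \<le> ?q w" if "v \<in> ?V" "w \<in> ?W" for v w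
    unfolding p[OF that(1)] q[OF that(2)] using fin that
    by (auto intro!: member_le_sum level_prob_bounds simp: member_le_sum[of v ?V "\<lambda>v. ?r (v, w)"])
  have sum1: "(\<Sum>z\<in>?V \<times> ?W. ?r z) = 1"
    using sum_level_prob[OF f] p by (simp add: sum.cartesian_product')
  have prod1: "(\<Sum>z\<in>?V \<times> ?W. ?p (fst z) * ?q (snd z)) = 1"
    using sum_level_prob[OF f] sum_level_prob[OF g]
    by (simp add: sum.cartesian_product' flip: sum_distrib_left sum_distrib_right)
  have "(\<Sum>z\<in>?V \<times> ?W. ?r z * ln (?p (fst z) * ?q (snd z))) - (\<Sum>z\<in>?V \<times> ?W. ?r z * ln (?r z))
      \<le> ln (\<Sum>z\<in>?V \<times> ?W. ?p (fst z) * ?q (snd z))"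
  proof (rule gibbs_inequality)
    fix z assume z: "z \<in> ?V \<times> ?W" and "?p (fst z) * ?q (snd z) = 0"
    then have "?p (fst z) = 0 \<or> ?q (snd z) = 0" by simp
    then have "?r z \<le> 0" using pq[of "fst z" "snd z"] z by (cases z) auto
    then show "?r z = 0" using level_prob_bounds(1)[of _ z] by (simp add: order_antisym)
  qed (use fin sum1 in \<open>auto simp: level_prob_bounds\<close>)
  moreover have "(\<Sum>z\<in>?V \<times> ?W. ?r z * ln (?p (fst z) * ?q (snd z)))
      = (\<Sum>z\<in>?V \<times> ?W. ?r z * ln (?p (fst z))) + (\<Sum>z\<in>?V \<times> ?W. ?r z * ln (?q (snd z)))"
    unfolding sum.distrib[symmetric]
  proof (intro sum.cong refl)
    fix z assume z: "z \<in> ?V \<times> ?W"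
    show "?r z * ln (?p (fst z) * ?q (snd z)) = ?r z * ln (?p (fst z)) + ?r z * ln (?q (snd z))"
    proof (cases "?r z = 0")
      case False
      then have "?r z > 0" using level_prob_bounds(1)[of _ z] by (simp add: less_le)
      then have "?p (fst z) > 0" "?q (snd z) > 0" using pq[of "fst z" "snd z"] z by (cases z; auto)+
      then show ?thesis by (simp add: ln_mult distrib_left)
    qed simp
  qed
  moreover have "(\<Sum>z\<in>?V \<times> ?W. ?r z * ln (?p (fst z))) = (\<Sum>v\<in>?V. ?p v * ln (?p v))"
    using p by (simp add: sum.cartesian_product' flip: sum_distrib_right)
  moreover have "(\<Sum>z\<in>?V \<times> ?W. ?r z * ln (?q (snd z))) = (\<Sum>w\<in>?W. ?q w * ln (?q w))"
  proof -
    have "(\<Sum>z\<in>?V \<times> ?W. ?r z * ln (?q (snd z))) = (\<Sum>v\<in>?V. \<Sum>w\<in>?W. ?r (v, w) * ln (?q w))"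
      by (simp add: sum.cartesian_product')
    also have "\<dots> = (\<Sum>w\<in>?W. \<Sum>v\<in>?V. ?r (v, w) * ln (?q w))" by (rule sum.swap)
    also have "\<dots> = (\<Sum>w\<in>?W. ?q w * ln (?q w))" using q by (simp flip: sum_distrib_right)
    finally show ?thesis .
  qed
  ultimately have "- (\<Sum>z\<in>?V \<times> ?W. ?r z * ln (?r z)) \<le> entropy_of M f + entropy_of M g"
    unfolding entropy_of_def prod1 by simp
  then show ?thesis using entropy_of_superset[OF _ sub] fin by simp
qed

text \<open>
  The dominant value contributes at most \<open>d\<close> and each of the others at most \<open>2 \<surd>d\<close>, hence the entropy vanishes
  with \<open>d\<close>. This is what makes approximation of partitions in measure good enough for entropy.
\<close>

lemma entropy_of_nearly_constant:
  assumes f: "simple_function M f" and V: "finite V" "f ` space M \<subseteq> insert v0 V"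
    and d: "1 - d \<le> level_prob M f v0"
  shows "entropy_of M f \<le> d + 2 * real (card V) * sqrt d"
proof -
  let ?p = "level_prob M f"
  have d0: "d \<ge> 0" using d level_prob_bounds(2)[of f v0] by simp
  have small: "?p v \<le> d" if "v \<noteq> v0" for v
  proof -
    have "{x \<in> space M. f x = v} \<subseteq> space M - {x \<in> space M. f x = v0}" using that by auto
    then have "?p v \<le> prob (space M - {x \<in> space M. f x = v0})"
      unfolding level_prob_def
      using simple_function_level_sets[OF f, of v0] by (intro finite_measure_mono) auto
    also have "\<dots> = 1 - ?p v0"
      unfolding level_prob_def by (rule prob_compl[OF simple_function_level_sets[OF f]])
    finally show ?thesis using d by simp
  qed
  have "- (?p v0 * ln (?p v0)) \<le> d"
  proof (cases "?p v0 = 0")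
    case False
    then have pos: "?p v0 > 0" using level_prob_bounds(1)[of f v0] by simp
    have "- ln (?p v0) = ln (1 / ?p v0)" using pos by (simp add: ln_div)
    also have "\<dots> \<le> 1 / ?p v0 - 1" using pos by (intro ln_le_minus_one) auto
    finally have "?p v0 * (- ln (?p v0)) \<le> ?p v0 * (1 / ?p v0 - 1)"
      using pos by (intro mult_left_mono) auto
    then show ?thesis using pos d by (simp add: algebra_simps)
  qed (use d0 in simp)
  moreover have "(\<Sum>v\<in>V - {v0}. - (?p v * ln (?p v))) \<le> (\<Sum>v\<in>V - {v0}. 2 * sqrt d)"
  proof (rule sum_mono)
    fix v assume "v \<in> V - {v0}"
    then have "sqrt (?p v) \<le> sqrt d" using small by simp
    then show "- (?p v * ln (?p v)) \<le> 2 * sqrt d"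
      using minus_mult_ln_le_sqrt[OF level_prob_bounds(1), of f v] by linarith
  qed
  moreover have "(\<Sum>v\<in>V - {v0}. 2 * sqrt d) \<le> 2 * real (card V) * sqrt d"
    using d0 card_mono[OF V(1), of "V - {v0}"] by (simp add: mult_right_mono)
  moreover have "entropy_of M f = (\<Sum>v\<in>insert v0 (V - {v0}). - (?p v * ln (?p v)))"
    using entropy_of_superset[of "insert v0 (V - {v0})" f M] V by (simp add: sum_negf)
  moreover have "\<dots> = - (?p v0 * ln (?p v0)) + (\<Sum>v\<in>V - {v0}. - (?p v * ln (?p v)))"
    using V(1) by (subst sum.insert) auto
  ultimately show ?thesis by linarith
qed

end

section \<open>The Kolmogorov-Sinai theorem for the coordinate partition\<close>

text \<open>
  The values of \<open>f\<close> along the first \<open>n\<close> points of an orbit; for \<open>f = cell P\<close> the level sets are the nonempty cells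
  of the refined partition.
\<close>

definition orbit :: "((nat \<Rightarrow> nat) \<Rightarrow> 'b) \<Rightarrow> nat \<Rightarrow> (nat \<Rightarrow> nat) \<Rightarrow> 'b list" where
  "orbit f n x = map (\<lambda>i. f ((left_shift ^^ i) x)) [0..<n]"

definition cell :: "'a set set \<Rightarrow> 'a \<Rightarrow> 'a set" where
  "cell P x = (THE C. C \<in> P \<and> x \<in> C)"

lemma length_orbit [simp]: "length (orbit f n x) = n"
  by (simp add: orbit_def)

lemma orbit_nth [simp]: "i < n \<Longrightarrow> orbit f n x ! i = f ((left_shift ^^ i) x)"
  by (simp add: orbit_def)

lemma orbit_eq_iff: "orbit f n x = orbit g n y \<longleftrightarrow> (\<forall>i<n. f ((left_shift ^^ i) x) = g ((left_shift ^^ i) y))"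
  by (auto simp: list_eq_iff_nth_eq)

lemma initial_eq_iff: "initial n x = initial n y \<longleftrightarrow> (\<forall>i<n. x i = y i)"
  by (auto simp: list_eq_iff_nth_eq)

lemma cell_eq:
  assumes "partition_on A P" "C \<in> P" "x \<in> C"
  shows "cell P x = C"
  unfolding cell_def
proof (rule the_equality)
  fix D assume "D \<in> P \<and> x \<in> D"
  then show "D = C" using assms unfolding partition_on_def disjoint_def by blast
qed (use assms in auto)

lemma cell_in:
  assumes "partition_on A P" "x \<in> A"
  shows "cell P x \<in> P" "x \<in> cell P x"
proof -
  obtain C where "C \<in> P" "x \<in> C" using assms by (auto simp: partition_on_def)
  then show "cell P x \<in> P" "x \<in> cell P x" using cell_eq[OF assms(1)] by auto
qed

lemma simple_function_cell:
  assumes "finite_measurable_partition \<nu> P"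
  shows "simple_function \<nu> (cell P)"
  unfolding simple_function_def
proof (intro conjI ballI)
  have part: "partition_on (space \<nu>) P" and fin: "finite P" and sets: "P \<subseteq> sets \<nu>"
    using assms by (auto simp: finite_measurable_partition_def)
  show "finite (cell P ` space \<nu>)"
    using cell_in(1)[OF part] by (intro finite_subset[OF _ fin]) auto
  fix C assume "C \<in> cell P ` space \<nu>"
  then have C: "C \<in> P" using cell_in(1)[OF part] by auto
  then have "cell P -` {C} \<inter> space \<nu> = C"
    using cell_eq[OF part C] cell_in(2)[OF part] sets.sets_into_space[of C \<nu>] sets by auto
  then show "cell P -` {C} \<inter> space \<nu> \<in> sets \<nu>" using C sets by auto
qed

text \<open>
  Empty cells contribute \<open>0 ln 0 = 0\<close>, so it is harmless that a refined partition may contain the empty set.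
\<close>

lemma partition_entropy_eq_entropy_of:
  assumes "R - {{}} = (\<lambda>v. {x \<in> space \<nu>. f x = v}) ` (f ` space \<nu>)" and fin: "finite R"
  shows "partition_entropy \<nu> R = entropy_of \<nu> f"
proof -
  have "(\<Sum>C\<in>R. measure \<nu> C * ln (measure \<nu> C)) = (\<Sum>C\<in>R - {{}}. measure \<nu> C * ln (measure \<nu> C))"
    using fin by (intro sum.mono_neutral_right) auto
  also have "\<dots> = (\<Sum>v\<in>f ` space \<nu>. level_prob \<nu> f v * ln (level_prob \<nu> f v))"
    unfolding assms(1) by (subst sum.reindex) (auto simp: inj_on_def level_prob_def)
  finally show ?thesis by (simp add: partition_entropy_def entropy_of_def)
qed

context invariant_measure
begin

lemma refined_partition_entropy:
  assumes P: "finite_measurable_partition \<nu> P"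
  shows "partition_entropy \<nu> (refined_partition \<nu> left_shift P n) = entropy_of \<nu> (orbit (cell P) n)"
proof (rule partition_entropy_eq_entropy_of)
  have part: "partition_on (full_shift M) P" and fin: "finite P"
    using P by (auto simp: finite_measurable_partition_def)
  show "finite (refined_partition \<nu> left_shift P n)"
    unfolding refined_partition_def using fin by (intro finite_imageI finite_PiE) auto
  let ?S = "\<lambda>c. {x \<in> full_shift M. \<forall>i<n. (left_shift ^^ i) x \<in> c i}"
  let ?lev = "\<lambda>v. {x \<in> full_shift M. orbit (cell P) n x = v}"
  have mem: "?S c = ?lev (orbit (cell P) n x)" if "c \<in> (\<Pi>\<^sub>E i\<in>{..<n}. P)" "x \<in> ?S c" for c x
  proof -
    have "(left_shift ^^ i) y \<in> c i \<longleftrightarrow> cell P ((left_shift ^^ i) y) = cell P ((left_shift ^^ i) x)"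
      if "i < n" "y \<in> full_shift M" for i y
    proof -
      have c: "c i \<in> P" "cell P ((left_shift ^^ i) x) = c i"
        using \<open>c \<in> _\<close> \<open>x \<in> ?S c\<close> \<open>i < n\<close> cell_eq[OF part] by (auto simp: PiE_iff)
      show ?thesis using cell_eq[OF part c(1)] cell_in(2)[OF part, of "(left_shift ^^ i) y"] c(2) that
        by auto
    qed
    then show ?thesis by (auto simp: orbit_eq_iff)
  qed
  show "refined_partition \<nu> left_shift P n - {{}}
      = (\<lambda>v. {x \<in> space \<nu>. orbit (cell P) n x = v}) ` (orbit (cell P) n ` space \<nu>)"
  proof (intro set_eqI iffI)
    fix C assume "C \<in> refined_partition \<nu> left_shift P n - {{}}"
    then obtain c x where c: "c \<in> (\<Pi>\<^sub>E i\<in>{..<n}. P)" "C = ?S c" "x \<in> ?S c"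
      unfolding refined_partition_def by auto
    then show "C \<in> (\<lambda>v. {x \<in> space \<nu>. orbit (cell P) n x = v}) ` (orbit (cell P) n ` space \<nu>)"
      using mem[OF c(1,3)] by auto
  next
    fix C assume "C \<in> (\<lambda>v. {x \<in> space \<nu>. orbit (cell P) n x = v}) ` (orbit (cell P) n ` space \<nu>)"
    then obtain x where x: "x \<in> full_shift M" "C = ?lev (orbit (cell P) n x)" by auto
    define c where "c = restrict (\<lambda>i. cell P ((left_shift ^^ i) x)) {..<n}"
    have c: "c \<in> (\<Pi>\<^sub>E i\<in>{..<n}. P)" "x \<in> ?S c"
      using cell_in[OF part] x by (auto simp: c_def)
    have "C = ?S c" using mem[OF c] x by simp
    then show "C \<in> refined_partition \<nu> left_shift P n - {{}}"
      using c unfolding refined_partition_def by auto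
  qed
qed

lemma simple_function_initial [intro, simp]: "simple_function \<nu> (initial n)"
  unfolding simple_function_def
proof (intro conjI ballI)
  show "finite (initial n ` space \<nu>)"
    using initial_in_words by (intro finite_subset[OF _ finite_words[of M n]]) auto
  fix w
  have "initial n -` {w} \<inter> space \<nu> = clopen M n {w}" by (auto simp: clopen_def)
  then show "initial n -` {w} \<inter> space \<nu> \<in> sets \<nu>" by simp
qed

lemma simple_function_shift:
  assumes "simple_function \<nu> f"
  shows "simple_function \<nu> (\<lambda>x. f ((left_shift ^^ k) x))"
  unfolding simple_function_def
proof (intro conjI ballI)
  show "finite ((\<lambda>x. f ((left_shift ^^ k) x)) ` space \<nu>)"
    using simple_functionD(1)[OF assms] by (rule finite_subset[rotated]) auto
  fix v
  have "(\<lambda>x. f ((left_shift ^^ k) x)) -` {v} \<inter> space \<nu> = shift_vimage M k {x \<in> full_shift M. f x = v}"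
    by auto
  then show "(\<lambda>x. f ((left_shift ^^ k) x)) -` {v} \<inter> space \<nu> \<in> sets \<nu>"
    using shift_vimage_sets[of "{x \<in> full_shift M. f x = v}" k] simple_function_level_sets[OF assms, of v] by simp
qed

lemma simple_function_orbit:
  assumes f: "simple_function \<nu> f"
  shows "simple_function \<nu> (orbit f n)"
proof (induction n)
  case 0
  then show ?case by (simp add: orbit_def[abs_def])
next
  case (Suc n)
  have "orbit f (Suc n) = (\<lambda>x. orbit f n x @ [f ((left_shift ^^ n) x)])"
    by (simp add: orbit_def fun_eq_iff)
  then show ?case using simple_function_compose2[OF Suc simple_function_shift[OF f], of "\<lambda>u v. u @ [v]"]
    by simp
qed

lemma entropy_of_shift:
  assumes f: "simple_function \<nu> f"
  shows "entropy_of \<nu> (\<lambda>x. f ((left_shift ^^ k) x)) = entropy_of \<nu> f"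
proof -
  let ?g = "\<lambda>x. f ((left_shift ^^ k) x)"
  have "level_prob \<nu> ?g v = level_prob \<nu> f v" for v
  proof -
    have "{x \<in> full_shift M. ?g x = v} = shift_vimage M k {x \<in> full_shift M. f x = v}" by auto
    then show ?thesis
      using measure_shift_vimage[of "{x \<in> full_shift M. f x = v}" k] simple_function_level_sets[OF f, of v]
      by (simp add: level_prob_def)
  qed
  moreover have "finite (f ` space \<nu>)" "?g ` space \<nu> \<subseteq> f ` space \<nu>"
    using simple_functionD(1)[OF f] by auto
  ultimately show ?thesis
    using entropy_of_superset[of "f ` space \<nu>" ?g \<nu>] by (simp add: entropy_of_def)
qed

lemma orbit_entropy_subadditive:
  assumes f: "simple_function \<nu> f"
  shows "entropy_of \<nu> (orbit f (n + m)) \<le> entropy_of \<nu> (orbit f n) + entropy_of \<nu> (orbit f m)"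
proof -
  let ?g = "\<lambda>x. orbit f m ((left_shift ^^ n) x)"
  have orb: "simple_function \<nu> (orbit f k)" for k by (rule simple_function_orbit[OF f])
  have "entropy_of \<nu> (orbit f (n + m)) \<le> entropy_of \<nu> (\<lambda>x. (orbit f n x, ?g x))"
  proof (rule entropy_of_mono[OF simple_function_Pair[OF orb simple_function_shift[OF orb]] orb])
    fix x y assume eq: "(orbit f n x, ?g x) = (orbit f n y, ?g y)"
    have "f ((left_shift ^^ i) x) = f ((left_shift ^^ i) y)" if i: "i < n + m" for i
    proof (cases "i < n")
      case False
      then have "(left_shift ^^ (i - n)) ((left_shift ^^ n) z) = (left_shift ^^ i) z" for z
        by (simp add: left_shift_funpow)
      moreover have "i - n < m" using False i by simp
      ultimately show ?thesis using eq by (auto simp: orbit_eq_iff)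
    qed (use eq in \<open>auto simp: orbit_eq_iff\<close>)
    then show "orbit f (n + m) x = orbit f (n + m) y" by (simp add: orbit_eq_iff)
  qed
  also have "\<dots> \<le> entropy_of \<nu> (orbit f n) + entropy_of \<nu> ?g"
    by (rule entropy_of_pair[OF orb simple_function_shift[OF orb]])
  also have "entropy_of \<nu> ?g = entropy_of \<nu> (orbit f m)"
    by (rule entropy_of_shift[OF orb])
  finally show ?thesis .
qed

lemma orbit_entropy_le:
  assumes f: "simple_function \<nu> f"
  shows "entropy_of \<nu> (orbit f n) \<le> real n * entropy_of \<nu> f"
proof (induction n)
  case 0
  have "entropy_of \<nu> (orbit f 0) \<le> 0"
    using prob_space by (auto simp: entropy_of_def orbit_def level_prob_def image_constant_conv)
  then show ?case by simp
next
  case (Suc n)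
  have "entropy_of \<nu> (orbit f 1) \<le> entropy_of \<nu> f"
    by (rule entropy_of_mono[OF f simple_function_orbit[OF f]]) (auto simp: orbit_eq_iff)
  then show ?case using Suc orbit_entropy_subadditive[OF f, of n 1] by (simp add: algebra_simps)
qed

lemma orbit_entropy_rate:
  assumes f: "simple_function \<nu> f"
  obtains h where "(\<lambda>n. entropy_of \<nu> (orbit f n) / real n) \<longlonglongrightarrow> h"
proof (rule fekete)
  show "entropy_of \<nu> (orbit f (n + m)) \<le> entropy_of \<nu> (orbit f n) + entropy_of \<nu> (orbit f m)" for n m
    by (rule orbit_entropy_subadditive[OF f])
  show "0 \<le> entropy_of \<nu> (orbit f n) / real n" for n
    by (simp add: entropy_of_nonneg)
qed (rule that)

lemma initial_entropy_eq: "entropy_of \<nu> (initial n) = entropy_of \<nu> (orbit (\<lambda>x. x 0) n)"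
proof -
  have "orbit (\<lambda>x. x 0) n = initial n" by (simp add: fun_eq_iff list_eq_iff_nth_eq left_shift_funpow)
  then show ?thesis by simp
qed

lemma simple_function_coordinate: "simple_function \<nu> (\<lambda>x. x 0)"
  using simple_function_compose1[OF simple_function_initial[of 1], of hd] by (simp add: initial_def)

definition block_entropy_rate :: real where
  "block_entropy_rate = lim (\<lambda>n. entropy_of \<nu> (initial n) / real n)"

lemma block_entropy_rate: "(\<lambda>n. entropy_of \<nu> (initial n) / real n) \<longlonglongrightarrow> block_entropy_rate"
  unfolding block_entropy_rate_def initial_entropy_eq
  using orbit_entropy_rate[OF simple_function_coordinate] by (metis limI)

text \<open>
  Approximate each cell by a clopen set. The finitely many clopen sets depend on a common number \<open>k\<close> of letters,
  and off a small set exactly one of them contains the given point.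
\<close>

lemma approximation_by_block_function:
  assumes P: "finite_measurable_partition \<nu> P" and d: "d > 0"
  obtains k R where "\<And>x y. initial k x = initial k y \<Longrightarrow> R x = R y"
    "\<And>x. x \<in> full_shift M \<Longrightarrow> R x \<in> insert {} P" "prob {x \<in> full_shift M. cell P x \<noteq> R x} \<le> d"
proof -
  have part: "partition_on (full_shift M) P" and fin: "finite P" and sets: "P \<subseteq> sets (shift_borel M)"
    using P by (auto simp: finite_measurable_partition_def)
  define e where "e = d / (real (card P) + 1)"
  have e: "e > 0" using d by (simp add: e_def add_nonneg_pos)
  have "\<forall>C\<in>P. \<exists>n S. prob (C - clopen M n S) + prob (clopen M n S - C) < e"
    using sets e by (intro ballI clopen_approximation) auto
  from bchoice[OF this] obtain n
    where "\<forall>C\<in>P. \<exists>S. prob (C - clopen M (n C) S) + prob (clopen M (n C) S - C) < e" by blast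
  from bchoice[OF this] obtain S
    where nS: "\<And>C. C \<in> P \<Longrightarrow> prob (C - clopen M (n C) (S C)) + prob (clopen M (n C) (S C) - C) < e"
    by blast
  define E where "E C = clopen M (n C) (S C)" for C
  define k where "k = (\<Sum>C\<in>P. n C)"
  \<comment> \<open>The value \<open>{}\<close> is not a cell, so an ambiguous point counts as an error.\<close>
  define R where "R x = (if \<exists>!C. C \<in> P \<and> initial (n C) x \<in> S C then THE C. C \<in> P \<and> initial (n C) x \<in> S C else {})" for x
  have "R x = R y" if "initial k x = initial k y" for x y
  proof -
    have "initial (n C) x = initial (n C) y" if "C \<in> P" for C
    proof -
      have "n C \<le> k" unfolding k_def using that fin by (intro member_le_sum) auto
      with \<open>initial k x = initial k y\<close> show ?thesis by (auto simp: initial_eq_iff)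
    qed
    then have "(C \<in> P \<and> initial (n C) x \<in> S C) = (C \<in> P \<and> initial (n C) y \<in> S C)" for C by auto
    then show ?thesis unfolding R_def by simp
  qed
  moreover have "R x \<in> insert {} P" for x
  proof (cases "\<exists>!C. C \<in> P \<and> initial (n C) x \<in> S C")
    case True
    from theI'[OF True] True show ?thesis by (simp add: R_def)
  qed (simp add: R_def)
  moreover have "prob {x \<in> full_shift M. cell P x \<noteq> R x} \<le> d"
  proof -
    have "{x \<in> full_shift M. cell P x \<noteq> R x} \<subseteq> (\<Union>C\<in>P. (C - E C) \<union> (E C - C))"
    proof (rule ccontr)
      assume "\<not> ?thesis"
      then obtain x where x: "x \<in> full_shift M" "cell P x \<noteq> R x"
        and eq: "\<And>C. C \<in> P \<Longrightarrow> x \<in> C \<longleftrightarrow> x \<in> E C" by blast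
      have "C \<in> P \<and> initial (n C) x \<in> S C \<longleftrightarrow> C = cell P x" for C
        using eq[of C] x(1) cell_eq[OF part, of C x] cell_in[OF part x(1)] eq[of "cell P x"]
        by (auto simp: E_def clopen_def)
      then have "R x = cell P x" by (simp add: R_def)
      with x show False by simp
    qed
    then have "prob {x \<in> full_shift M. cell P x \<noteq> R x} \<le> prob (\<Union>C\<in>P. (C - E C) \<union> (E C - C))"
      using sets fin by (intro finite_measure_mono sets.finite_UN) (auto simp: E_def)
    also have "\<dots> \<le> (\<Sum>C\<in>P. prob ((C - E C) \<union> (E C - C)))"
      using sets fin by (intro measure_UNION_le) (auto simp: E_def)
    also have "\<dots> \<le> (\<Sum>C\<in>P. e)"
    proof (rule sum_mono)
      fix C assume C: "C \<in> P"
      have "prob ((C - E C) \<union> (E C - C)) \<le> prob (C - E C) + prob (E C - C)"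
        using C sets by (intro measure_Un_le) (auto simp: E_def)
      then show "prob ((C - E C) \<union> (E C - C)) \<le> e" using nS[OF C] by (simp add: E_def)
    qed
    also have "\<dots> \<le> d" using d by (simp add: e_def field_simps)
    finally show ?thesis .
  qed
  ultimately show ?thesis by (rule that)
qed

text \<open>
  Let \<open>R\<close> depend on \<open>k\<close> letters and agree with the partition function \<open>q\<close> off a small set, and let \<open>D\<close> record \<open>q\<close>
  only where the two differ. The values of \<open>q\<close> along \<open>n\<close> steps are determined by \<open>n + k\<close> letters together with the
  values of \<open>D\<close>, whose entropy per step is small. This avoids conditional entropies altogether.
\<close>

lemma partition_entropy_rate_le:
  assumes P: "finite_measurable_partition \<nu> P"
  shows "partition_entropy_rate \<nu> left_shift P \<le> block_entropy_rate"
proof -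
  let ?q = "cell P"
  have q: "simple_function \<nu> ?q" by (rule simple_function_cell[OF P])
  have fin: "finite P" and part: "partition_on (full_shift M) P"
    using P by (auto simp: finite_measurable_partition_def)
  obtain h where h: "(\<lambda>n. entropy_of \<nu> (orbit ?q n) / real n) \<longlonglongrightarrow> h"
    using orbit_entropy_rate[OF q] .
  have "h \<le> block_entropy_rate + (d + 2 * real (card P) * sqrt d)" if d: "d > 0" for d
  proof -
    obtain k R where R: "\<And>x y. initial k x = initial k y \<Longrightarrow> R x = R y"
      "\<And>x. x \<in> full_shift M \<Longrightarrow> R x \<in> insert {} P" "prob {x \<in> full_shift M. ?q x \<noteq> R x} \<le> d"
      by (rule approximation_by_block_function[OF P d]) (rule that)
    have "simple_function \<nu> R"
    proof -
      define r where "r w = R (SOME x. initial k x = w)" for w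
      have "R x = r (initial k x)" for x
        unfolding r_def by (rule R(1)[OF sym], rule someI[of "\<lambda>y. initial k y = initial k x" x]) simp
      then have "R = (\<lambda>x. r (initial k x))" by (rule ext)
      then show ?thesis using simple_function_compose1[OF simple_function_initial[of k], of r] by simp
    qed
    \<comment> \<open>The correction needed to recover \<open>q\<close> from \<open>R\<close>; it is almost always trivial.\<close>
    define D where "D x = (if ?q x = R x then None else Some (?q x))" for x
    have D: "simple_function \<nu> D"
      unfolding D_def
      using simple_function_compose2[OF q \<open>simple_function \<nu> R\<close>, of "\<lambda>a b. if a = b then None else Some a"]
      by simp
    have HD: "entropy_of \<nu> D \<le> d + 2 * real (card P) * sqrt d"
    proof -
      have "1 - d \<le> level_prob \<nu> D None"
      proof -
        have "{x \<in> full_shift M. ?q x \<noteq> R x} = space \<nu> - {x \<in> space \<nu>. D x = None}"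
          by (auto simp: D_def)
        then have "prob {x \<in> full_shift M. ?q x \<noteq> R x} = 1 - level_prob \<nu> D None"
          unfolding level_prob_def using prob_compl[OF simple_function_level_sets[OF D, of None]] by simp
        then show ?thesis using R(3) by simp
      qed
      moreover have "D ` space \<nu> \<subseteq> insert None (Some ` P)"
        using cell_in(1)[OF part] by (auto simp: D_def)
      ultimately have "entropy_of \<nu> D \<le> d + 2 * real (card (Some ` P)) * sqrt d"
        using fin by (intro entropy_of_nearly_constant[OF D]) auto
      then show ?thesis by (simp add: card_image)
    qed
    have orb: "simple_function \<nu> (orbit D n)" for n by (rule simple_function_orbit[OF D])
    have "entropy_of \<nu> (orbit ?q n) \<le> entropy_of \<nu> (initial (n + k)) + real n * entropy_of \<nu> D" for n
    proof -
      have "entropy_of \<nu> (orbit ?q n) \<le> entropy_of \<nu> (\<lambda>x. (initial (n + k) x, orbit D n x))"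
      proof (rule entropy_of_mono[OF simple_function_Pair[OF simple_function_initial orb] simple_function_orbit[OF q]])
        fix x y assume eq: "(initial (n + k) x, orbit D n x) = (initial (n + k) y, orbit D n y)"
        have "?q ((left_shift ^^ i) x) = ?q ((left_shift ^^ i) y)" if i: "i < n" for i
        proof -
          have "initial k ((left_shift ^^ i) x) = initial k ((left_shift ^^ i) y)"
            using eq i by (auto simp: initial_eq_iff left_shift_funpow)
          then have "R ((left_shift ^^ i) x) = R ((left_shift ^^ i) y)" by (rule R(1))
          moreover have "D ((left_shift ^^ i) x) = D ((left_shift ^^ i) y)"
            using eq i by (auto simp: orbit_eq_iff)
          ultimately show ?thesis by (auto simp: D_def split: if_splits)
        qed
        then show "orbit ?q n x = orbit ?q n y" by (simp add: orbit_eq_iff)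
      qed
      also have "\<dots> \<le> entropy_of \<nu> (initial (n + k)) + entropy_of \<nu> (orbit D n)"
        by (rule entropy_of_pair[OF simple_function_initial orb])
      also have "entropy_of \<nu> (orbit D n) \<le> real n * entropy_of \<nu> D"
        by (rule orbit_entropy_le[OF D])
      finally show ?thesis by simp
    qed
    note block_bound = this
    have bound: "entropy_of \<nu> (orbit ?q n) / real n
        \<le> entropy_of \<nu> (initial (n + k)) / real (n + k) * (real (n + k) / real n) + entropy_of \<nu> D"
      if n: "n \<ge> 1" for n
    proof -
      have "entropy_of \<nu> (orbit ?q n) / real n
          \<le> (entropy_of \<nu> (initial (n + k)) + real n * entropy_of \<nu> D) / real n"
        by (rule divide_right_mono[OF block_bound]) simp
      also have "\<dots> = entropy_of \<nu> (initial (n + k)) / real n + entropy_of \<nu> D"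
        using n by (simp add: add_divide_distrib)
      also have "entropy_of \<nu> (initial (n + k)) / real n
          = entropy_of \<nu> (initial (n + k)) / real (n + k) * (real (n + k) / real n)"
        using n by simp
      finally show ?thesis .
    qed
    have "(\<lambda>n. entropy_of \<nu> (initial (n + k)) / real (n + k)) \<longlonglongrightarrow> block_entropy_rate"
      using LIMSEQ_ignore_initial_segment[OF block_entropy_rate, of k] by simp
    moreover have "(\<lambda>n. real (n + k) / real n) \<longlonglongrightarrow> 1"
    proof -
      have "(\<lambda>n. 1 + real k / real n) \<longlonglongrightarrow> 1 + 0"
        by (intro tendsto_intros tendsto_divide_0[OF tendsto_const] filterlim_at_top_imp_at_infinity
            filterlim_real_sequentially)
      moreover have "\<forall>\<^sub>F n in sequentially. 1 + real k / real n = real (n + k) / real n"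
        by (intro eventually_sequentiallyI[of 1]) (simp add: field_simps)
      ultimately show ?thesis using Lim_transform_eventually by fastforce
    qed
    ultimately have "(\<lambda>n. entropy_of \<nu> (initial (n + k)) / real (n + k) * (real (n + k) / real n) + entropy_of \<nu> D)
        \<longlonglongrightarrow> block_entropy_rate * 1 + entropy_of \<nu> D"
      by (intro tendsto_intros)
    then have "h \<le> block_entropy_rate * 1 + entropy_of \<nu> D"
      by (rule LIMSEQ_le[OF h]) (use bound in blast)
    then show ?thesis using HD by simp
  qed
  moreover have "((\<lambda>d. block_entropy_rate + (d + 2 * real (card P) * sqrt d)) \<longlongrightarrow>
      block_entropy_rate + (0 + 2 * real (card P) * sqrt 0)) (at_right 0)"
    by (intro tendsto_intros)
  ultimately have "h \<le> block_entropy_rate"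
    using tendsto_lowerbound[of _ "block_entropy_rate + (0 + 2 * real (card P) * sqrt 0)" "at_right (0::real)" h]
    by (force simp: eventually_at_right_less intro: eventually_at_rightI[of 0 1])
  moreover have "partition_entropy_rate \<nu> left_shift P = h"
    unfolding partition_entropy_rate_def refined_partition_entropy[OF P] using h by (rule limI)
  ultimately show ?thesis by simp
qed

lemma coordinate_partition:
  defines "\<xi> \<equiv> (\<lambda>i. {x \<in> full_shift M. x 0 = i}) ` {1..M}"
  shows "finite_measurable_partition \<nu> \<xi>"
    and "\<And>x. x \<in> full_shift M \<Longrightarrow> cell \<xi> x = {y \<in> full_shift M. y 0 = x 0}"
proof -
  have "partition_on (full_shift M) \<xi>"
    unfolding partition_on_def
  proof (intro conjI)
    show "\<Union> \<xi> = full_shift M" by (auto simp: \<xi>_def full_shift_def)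
    show "disjoint \<xi>" by (auto simp: \<xi>_def disjoint_def)
    have "(\<lambda>_. i) \<in> {x \<in> full_shift M. x 0 = i}" if "i \<in> {1..M}" for i
      using that by (auto simp: full_shift_def)
    then show "{} \<notin> \<xi>" unfolding \<xi>_def by blast
  qed
  moreover have "{x \<in> full_shift M. x 0 = i} = clopen M 1 {[i]}" for i
    by (auto simp: clopen_def initial_def)
  ultimately show "finite_measurable_partition \<nu> \<xi>"
    by (auto simp: finite_measurable_partition_def \<xi>_def)
  show "cell \<xi> x = {y \<in> full_shift M. y 0 = x 0}" if "x \<in> full_shift M" for x
    using that by (intro cell_eq[OF \<open>partition_on _ _\<close>]) (auto simp: \<xi>_def full_shift_def)
qed

text \<open>
  The coordinate partition attains the supremum over all finite partitions.
\<close>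

theorem kolmogorov_sinai: "metric_entropy \<nu> left_shift = ereal block_entropy_rate"
proof (rule antisym)
  show "metric_entropy \<nu> left_shift \<le> ereal block_entropy_rate"
    unfolding metric_entropy_def by (intro SUP_least) (simp add: partition_entropy_rate_le)
  let ?\<xi> = "(\<lambda>i. {x \<in> full_shift M. x 0 = i}) ` {1..M}"
  note P = coordinate_partition(1)
  have "entropy_of \<nu> (initial n) = entropy_of \<nu> (orbit (cell ?\<xi>) n)" for n
  proof -
    have "cell ?\<xi> x = cell ?\<xi> y \<longleftrightarrow> x 0 = y 0" if "x \<in> full_shift M" "y \<in> full_shift M" for x y
      unfolding coordinate_partition(2)[OF that(1)] coordinate_partition(2)[OF that(2)] using that by auto
    then have "initial n x = initial n y \<longleftrightarrow> orbit (cell ?\<xi>) n x = orbit (cell ?\<xi>) n y"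
      if "x \<in> full_shift M" "y \<in> full_shift M" for x y
      unfolding orbit_eq_iff initial_eq_iff using that by (simp add: left_shift_funpow_in) (simp add: left_shift_funpow)
    then show ?thesis
      by (intro antisym entropy_of_mono simple_function_initial simple_function_orbit simple_function_cell P) auto
  qed
  then have "partition_entropy_rate \<nu> left_shift ?\<xi> = block_entropy_rate"
    unfolding partition_entropy_rate_def refined_partition_entropy[OF P] block_entropy_rate_def by simp
  then show "ereal block_entropy_rate \<le> metric_entropy \<nu> left_shift"
    unfolding metric_entropy_def using P by (intro SUP_upper2[of ?\<xi>]) auto
qed

end

section \<open>Growth rates and the variational inequality\<close>

context invariant_measure
begin

definition cyl_prob :: "nat list \<Rightarrow> real" where
  "cyl_prob w = prob (cylinder M w)"

lemma cyl_prob_nonneg [simp]: "0 \<le> cyl_prob w"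
  by (simp add: cyl_prob_def)

lemma cyl_prob_words: "w \<in> words M n \<Longrightarrow> cyl_prob w = prob (clopen M n {w})"
  by (simp add: cyl_prob_def words_def)

lemma prob_clopen: "prob (clopen M n S) = (\<Sum>w\<in>words M n \<inter> S. cyl_prob w)"
proof -
  have "full_shift M \<inter> clopen M m T = clopen M m T" for m T by (auto simp: clopen_def)
  then show ?thesis
    using measure_clopen[of \<nu> M "full_shift M" n S] finite_measure_axioms sets.top[of "shift_borel M"]
    by (simp add: cyl_prob_def)
qed

lemma sum_cyl_prob: "(\<Sum>w\<in>words M n. cyl_prob w) = 1"
proof -
  have "clopen M n UNIV = space \<nu>" by (auto simp: clopen_def)
  then show ?thesis using prob_clopen[of n UNIV] prob_space by simp
qed

lemma cylinder_append:
  "cylinder M (u @ v) = cylinder M u \<inter> shift_vimage M (length u) (cylinder M v)"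
  by (auto simp: clopen_def initial_add)

lemma sum_cyl_prob_right:
  assumes "u \<in> words M n"
  shows "(\<Sum>v\<in>words M m. cyl_prob (u @ v)) = cyl_prob u"
proof -
  have "cyl_prob u = prob (clopen M (n + m) {w. take n w = u})"
    using assms clopen_lift[of n "n + m" M "{u}"] by (simp add: cyl_prob_words)
  also have "\<dots> = (\<Sum>w\<in>words M (n + m) \<inter> {w. take n w = u}. cyl_prob w)"
    by (rule prob_clopen)
  also have "\<dots> = (\<Sum>v\<in>words M m. cyl_prob (u @ v))"
  proof (rule sum.reindex_bij_witness[of _ "\<lambda>v. u @ v" "drop n"])
    fix w assume w: "w \<in> words M (n + m) \<inter> {w. take n w = u}"
    then show "u @ drop n w = w" using append_take_drop_id[of n w] by simp
    then show "cyl_prob (u @ drop n w) = cyl_prob w" by simp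
    show "drop n w \<in> words M m" using w by (auto simp: words_def dest: in_set_dropD)
  qed (use assms in \<open>auto simp: words_def\<close>)
  finally show ?thesis by simp
qed

text \<open>
  This is the invariance of the measure, expressed on cylinders.
\<close>

lemma sum_cyl_prob_left:
  assumes "v \<in> words M m"
  shows "(\<Sum>u\<in>words M n. cyl_prob (u @ v)) = cyl_prob v"
proof -
  let ?U = "shift_vimage M n (cylinder M v)"
  have "(\<Sum>u\<in>words M n. cyl_prob (u @ v)) = (\<Sum>u\<in>words M n \<inter> UNIV. prob (?U \<inter> cylinder M u))"
    unfolding cyl_prob_def cylinder_append by (intro sum.cong) (auto simp: words_def Int_commute)
  also have "\<dots> = prob (?U \<inter> clopen M n UNIV)"
    by (rule measure_clopen[symmetric]) (auto simp: finite_measure_axioms intro: shift_vimage_sets)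
  also have "?U \<inter> clopen M n UNIV = ?U" by (auto simp: clopen_def)
  also have "prob ?U = cyl_prob v" unfolding cyl_prob_def by (rule measure_shift_vimage) simp
  finally show ?thesis .
qed

lemma cyl_prob_append_le:
  assumes "u \<in> words M n" "v \<in> words M m"
  shows "cyl_prob (u @ v) \<le> cyl_prob u" "cyl_prob (u @ v) \<le> cyl_prob v"
proof -
  show "cyl_prob (u @ v) \<le> cyl_prob u"
    unfolding sum_cyl_prob_right[OF assms(1), of m, symmetric] using assms by (intro member_le_sum) auto
  show "cyl_prob (u @ v) \<le> cyl_prob v"
    unfolding sum_cyl_prob_left[OF assms(2), of n, symmetric]
    using member_le_sum[OF assms(1), of "\<lambda>u. cyl_prob (u @ v)"] by auto
qed

lemma block_entropy_eq:
  "entropy_of \<nu> (initial n) = - (\<Sum>w\<in>words M n. cyl_prob w * ln (cyl_prob w))"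
proof -
  have "level_prob \<nu> (initial n) w = cyl_prob w" if "w \<in> words M n" for w
    using that by (simp add: level_prob_def cyl_prob_words clopen_def)
  then show ?thesis
    using entropy_of_superset[of "words M n" "initial n" \<nu>] initial_in_words by auto
qed

lemma nn_integral_initial:
  "(\<integral>\<^sup>+x. F (initial n x) \<partial>\<nu>) = (\<Sum>w\<in>words M n. F w * ennreal (cyl_prob w))"
proof -
  have "(\<integral>\<^sup>+x. F (initial n x) \<partial>\<nu>) = (\<integral>\<^sup>+x. (\<Sum>w\<in>words M n. F w * indicator (clopen M n {w}) x) \<partial>\<nu>)"
  proof (rule nn_integral_cong)
    fix x assume x: "x \<in> space \<nu>"
    have "F w * indicator (clopen M n {w}) x = (if w = initial n x then F w else 0)" for w
      using x by (simp add: clopen_def indicator_def eq_commute)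
    then show "F (initial n x) = (\<Sum>w\<in>words M n. F w * indicator (clopen M n {w}) x)"
      using x initial_in_words[of x M n] by simp
  qed
  also have "\<dots> = (\<Sum>w\<in>words M n. \<integral>\<^sup>+x. F w * indicator (clopen M n {w}) x \<partial>\<nu>)"
    by (rule nn_integral_sum) simp
  also have "\<dots> = (\<Sum>w\<in>words M n. F w * ennreal (cyl_prob w))"
    by (intro sum.cong refl)
      (simp add: nn_integral_cmult_indicator emeasure_eq_measure cyl_prob_words)
  finally show ?thesis .
qed

text \<open>
  The condition under which \<open>log g\<close> has integral \<open>- \<infinity>\<close>. Otherwise words with \<open>g w = 0\<close> have probability zero and
  do not affect \<open>energy g n\<close>, because \<open>ln 0 = 0\<close>.
\<close>

definition degenerate :: "(nat list \<Rightarrow> real) \<Rightarrow> nat \<Rightarrow> bool" where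
  "degenerate g n \<longleftrightarrow> (\<exists>w\<in>words M n. 0 < cyl_prob w \<and> g w = 0)"

definition energy :: "(nat list \<Rightarrow> real) \<Rightarrow> nat \<Rightarrow> real" where
  "energy g n = (\<Sum>w\<in>words M n. cyl_prob w * ln (g w))"

lemma ereal_integral_log:
  assumes g: "\<And>w. 0 \<le> g w"
  shows "ereal_integral \<nu> (\<lambda>x. log_ext (g (initial n x)))
    = (if degenerate g n then - \<infinity> else ereal (energy g n))"
proof -
  let ?a = "\<Sum>w\<in>words M n. max 0 (ln (g w)) * cyl_prob w"
  let ?b = "\<Sum>w\<in>words M n. max 0 (- ln (g w)) * cyl_prob w"
  have zero: "ennreal (max 0 t) = ennreal t" for t by (simp add: max_def ennreal_neg)
  have a: "(\<integral>\<^sup>+x. e2ennreal (log_ext (g (initial n x))) \<partial>\<nu>) = ennreal ?a"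
  proof -
    have "e2ennreal (log_ext (g w)) = ennreal (max 0 (ln (g w)))" for w
      using g[of w] by (cases "g w = 0") (auto simp: log_ext_def e2ennreal_neg zero)
    then have "e2ennreal (log_ext (g w)) * ennreal (cyl_prob w) = ennreal (max 0 (ln (g w)) * cyl_prob w)" for w
      by (simp add: ennreal_mult)
    then show ?thesis
      using nn_integral_initial[of "\<lambda>w. e2ennreal (log_ext (g w))" n] by (simp only:) (simp add: sum_ennreal)
  qed
  have neg: "e2ennreal (- log_ext (g w)) = (if g w = 0 then \<infinity> else ennreal (max 0 (- ln (g w))))" for w
    using g[of w] by (auto simp: log_ext_def zero)
  show ?thesis
  proof (cases "degenerate g n")
    case True
    then obtain w where w: "w \<in> words M n" "0 < cyl_prob w" "g w = 0"
      by (auto simp: degenerate_def)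
    have "\<infinity> * ennreal (cyl_prob w) = (\<infinity>::ennreal)" using w(2) by (simp add: ennreal_top_mult)
    moreover have "e2ennreal (- log_ext (g w)) * ennreal (cyl_prob w)
      \<le> (\<Sum>w\<in>words M n. e2ennreal (- log_ext (g w)) * ennreal (cyl_prob w))"
      using w(1) by (intro member_le_sum) auto
    moreover have "e2ennreal (- log_ext (g w)) = \<infinity>" using neg[of w] w(3) by simp
    ultimately have "(\<Sum>w\<in>words M n. e2ennreal (- log_ext (g w)) * ennreal (cyl_prob w)) = \<infinity>"
      by (simp only: infinity_ennreal_def top_unique)
    then have "(\<integral>\<^sup>+x. e2ennreal (- log_ext (g (initial n x))) \<partial>\<nu>) = \<infinity>"
      unfolding nn_integral_initial[of "\<lambda>w. e2ennreal (- log_ext (g w))" n] .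
    moreover have "0 \<le> ?a" by (auto intro!: sum_nonneg)
    ultimately show ?thesis using True a by (simp add: ereal_integral_def enn2ereal_ennreal)
  next
    case False
    have "e2ennreal (- log_ext (g w)) * ennreal (cyl_prob w) = ennreal (max 0 (- ln (g w)) * cyl_prob w)"
      if "w \<in> words M n" for w
    proof (cases "cyl_prob w = 0")
      case False
      then have "g w \<noteq> 0" using \<open>\<not> degenerate g n\<close> that cyl_prob_nonneg[of w]
        by (auto simp: degenerate_def less_le)
      then show ?thesis by (simp add: neg ennreal_mult)
    qed simp
    then have b: "(\<integral>\<^sup>+x. e2ennreal (- log_ext (g (initial n x))) \<partial>\<nu>) = ennreal ?b"
      using nn_integral_initial[of "\<lambda>w. e2ennreal (- log_ext (g w))" n]
      by (simp add: sum_ennreal)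
    have "?a - ?b = energy g n"
      unfolding energy_def sum_subtractf[symmetric] by (intro sum.cong refl) (auto simp: max_def)
    moreover have "0 \<le> ?a" "0 \<le> ?b" by (auto intro!: sum_nonneg)
    ultimately show ?thesis using False by (simp add: ereal_integral_def a b)
  qed
qed

text \<open>
  With \<open>g w = opnorm (word_product A w)\<close> this is the top Lyapunov exponent.
\<close>

definition growth_rate :: "(nat list \<Rightarrow> real) \<Rightarrow> ereal" where
  "growth_rate g = lim (\<lambda>n. ereal (1 / real n) * ereal_integral \<nu> (\<lambda>x. log_ext (g (initial n x))))"

lemma energy_subadditive:
  assumes g: "\<And>w. 0 \<le> g w" and sub: "\<And>u v. g (u @ v) \<le> g u * g v"
    and nondeg: "\<And>n. \<not> degenerate g n"
  shows "energy g (n + m) \<le> energy g n + energy g m"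
proof -
  have "energy g (n + m) = (\<Sum>u\<in>words M n. \<Sum>v\<in>words M m. cyl_prob (u @ v) * ln (g (u @ v)))"
    unfolding energy_def by (rule sum_words_add)
  also have "\<dots> \<le> (\<Sum>u\<in>words M n. \<Sum>v\<in>words M m. cyl_prob (u @ v) * ln (g u) + cyl_prob (u @ v) * ln (g v))"
  proof (intro sum_mono)
    fix u v assume uv: "u \<in> words M n" "v \<in> words M m"
    show "cyl_prob (u @ v) * ln (g (u @ v)) \<le> cyl_prob (u @ v) * ln (g u) + cyl_prob (u @ v) * ln (g v)"
    proof (cases "cyl_prob (u @ v) = 0")
      case False
      then have "0 < cyl_prob (u @ v)" using cyl_prob_nonneg[of "u @ v"] by linarith
      then have "0 < cyl_prob u" "0 < cyl_prob v" "0 < cyl_prob (u @ v)"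
        using cyl_prob_append_le[OF uv] by linarith+
      then have "g u \<noteq> 0" "g v \<noteq> 0" "g (u @ v) \<noteq> 0"
        using nondeg uv append_in_words[OF uv] unfolding degenerate_def by blast+
      then have pos: "0 < g u" "0 < g v" "0 < g (u @ v)" using g by (auto simp: less_le)
      then have "ln (g (u @ v)) \<le> ln (g u * g v)" using sub by simp
      also have "\<dots> = ln (g u) + ln (g v)" using pos by (simp add: ln_mult)
      finally have "cyl_prob (u @ v) * ln (g (u @ v)) \<le> cyl_prob (u @ v) * (ln (g u) + ln (g v))"
        by (rule mult_left_mono) simp
      then show ?thesis by (simp add: distrib_left)
    qed simp
  qed
  also have "\<dots> = (\<Sum>u\<in>words M n. (\<Sum>v\<in>words M m. cyl_prob (u @ v)) * ln (g u))
      + (\<Sum>v\<in>words M m. (\<Sum>u\<in>words M n. cyl_prob (u @ v)) * ln (g v))"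
    unfolding sum.distrib sum_distrib_right
    by (subst sum.swap[of "\<lambda>u v. cyl_prob (u @ v) * ln (g v)"]) (rule refl)
  also have "\<dots> = energy g n + energy g m"
    by (simp add: energy_def sum_cyl_prob_right sum_cyl_prob_left cong: sum.cong)
  finally show ?thesis .
qed

text \<open>
  A word of positive probability with \<open>g w = 0\<close> extends to such words of every greater length.
\<close>

lemma growth_rate_degenerate:
  assumes g: "\<And>w. 0 \<le> g w" and sub: "\<And>u v. g (u @ v) \<le> g u * g v" and d: "degenerate g k"
  shows "growth_rate g = - \<infinity>"
proof -
  let ?I = "\<lambda>n. ereal (1 / real n) * ereal_integral \<nu> (\<lambda>x. log_ext (g (initial n x)))"
  obtain w where w: "w \<in> words M k" "0 < cyl_prob w" "g w = 0"
    using d by (auto simp: degenerate_def)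
  have "?I n = - \<infinity>" if n: "n \<ge> Suc k" for n
  proof -
    have "(\<Sum>v\<in>words M (n - k). cyl_prob (w @ v)) \<noteq> 0"
      using sum_cyl_prob_right[OF w(1)] w(2) by simp
    then obtain v where v: "v \<in> words M (n - k)" "cyl_prob (w @ v) \<noteq> 0"
      by (rule sum.not_neutral_contains_not_neutral)
    have "g (w @ v) = 0" using sub[of w v] g[of "w @ v"] w(3) by simp
    moreover have "w @ v \<in> words M n" using append_in_words[OF w(1) v(1)] n by simp
    ultimately have "degenerate g n"
      using v(2) unfolding degenerate_def by (intro bexI[of _ "w @ v"]) (auto simp: less_le)
    then show ?thesis using n by (simp add: ereal_integral_log[of g, OF g])
  qed
  then have "?I \<longlonglongrightarrow> - \<infinity>"
    by (intro tendsto_eventually eventually_sequentiallyI[of "Suc k"])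
  then show ?thesis unfolding growth_rate_def by (rule limI)
qed

lemma growth_rate_nondegenerate:
  assumes g: "\<And>w. 0 \<le> g w" and sub: "\<And>u v. g (u @ v) \<le> g u * g v" and nd: "\<And>n. \<not> degenerate g n"
  shows "growth_rate g \<noteq> \<infinity>" "(\<lambda>n. ereal (energy g n / real n)) \<longlonglongrightarrow> growth_rate g"
proof -
  let ?I = "\<lambda>n. ereal (1 / real n) * ereal_integral \<nu> (\<lambda>x. log_ext (g (initial n x)))"
  let ?L = "INF n\<in>{1..}. ereal (energy g n / real n)"
  have L: "(\<lambda>n. ereal (energy g n / real n)) \<longlonglongrightarrow> ?L"
    by (rule fekete_ereal) (use energy_subadditive[OF g sub] nd in auto)
  moreover have "?I = (\<lambda>n. ereal (energy g n / real n))"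
    by (rule ext) (simp add: ereal_integral_log[of g, OF g] nd)
  ultimately have "growth_rate g = ?L" unfolding growth_rate_def by (simp add: limI)
  moreover have "?L \<le> ereal (energy g 1 / real 1)" by (intro INF_lower) auto
  ultimately show "growth_rate g \<noteq> \<infinity>" "(\<lambda>n. ereal (energy g n / real n)) \<longlonglongrightarrow> growth_rate g"
    using L by auto
qed

text \<open>
  Gibbs' inequality at level \<open>n\<close> for the word probabilities against the weights \<open>g w powr s\<close>, divided by \<open>n\<close>.
\<close>

theorem variational_inequality:
  assumes g: "\<And>w. 0 \<le> g w" and sub: "\<And>u v. g (u @ v) \<le> g u * g v" and s: "s > 0"
    and P: "(\<lambda>n. ln (\<Sum>w\<in>words M n. g w powr s) / real n) \<longlonglongrightarrow> P"
  shows "metric_entropy \<nu> left_shift + ereal s * growth_rate g \<le> ereal P"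
proof -
  consider "growth_rate g = - \<infinity>" | l where "growth_rate g = ereal l" "\<forall>n. \<not> degenerate g n"
      "(\<lambda>n. energy g n / real n) \<longlonglongrightarrow> l"
  proof (cases "\<exists>k. degenerate g k")
    case True
    then show ?thesis using growth_rate_degenerate[OF g sub] that(1) by blast
  next
    case False
    then have nd: "\<And>n. \<not> degenerate g n" by blast
    show ?thesis
      using growth_rate_nondegenerate[OF g sub nd] that nd by (cases "growth_rate g") auto
  qed
  then show ?thesis
  proof cases
    case 1
    then show ?thesis using s by (simp add: kolmogorov_sinai)
  next
    case (2 l)
    have "entropy_of \<nu> (initial n) + s * energy g n \<le> ln (\<Sum>w\<in>words M n. g w powr s)" for n
    proof -
      have zero: "cyl_prob w = 0" if "w \<in> words M n" "g w = 0" for w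
        using 2(2) that cyl_prob_nonneg[of w] unfolding degenerate_def by (metis less_le)
      have "(\<Sum>w\<in>words M n. cyl_prob w * ln (g w powr s)) - (\<Sum>w\<in>words M n. cyl_prob w * ln (cyl_prob w))
          \<le> ln (\<Sum>w\<in>words M n. g w powr s)"
        by (rule gibbs_inequality) (use sum_cyl_prob zero in auto)
      moreover have "(\<Sum>w\<in>words M n. cyl_prob w * ln (g w powr s)) = s * energy g n"
        unfolding energy_def sum_distrib_left
        by (intro sum.cong refl) (use g in \<open>auto simp: ln_powr\<close>)
      ultimately show ?thesis unfolding block_entropy_eq by linarith
    qed
    then have "(entropy_of \<nu> (initial n) + s * energy g n) / real n
        \<le> ln (\<Sum>w\<in>words M n. g w powr s) / real n" for n
      by (rule divide_right_mono) simp
    then have "entropy_of \<nu> (initial n) / real n + s * (energy g n / real n)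
        \<le> ln (\<Sum>w\<in>words M n. g w powr s) / real n" for n
      by (simp add: add_divide_distrib)
    moreover have "(\<lambda>n. entropy_of \<nu> (initial n) / real n + s * (energy g n / real n))
        \<longlonglongrightarrow> block_entropy_rate + s * l"
      by (intro tendsto_intros block_entropy_rate 2)
    ultimately have "block_entropy_rate + s * l \<le> P"
      using P by (intro LIMSEQ_le) auto
    then show ?thesis by (simp add: kolmogorov_sinai 2(1))
  qed
qed

text \<open>
  Taking logarithms in the upper Gibbs bound and averaging gives \<open>n P - ln C \<le> H\<^sub>n + s E\<^sub>n\<close> for block entropy
  and energy; in particular the growth rate is finite.
\<close>

theorem gibbs_upper_bound_attains_pressure:
  assumes g: "\<And>w. 0 \<le> g w" and sub: "\<And>u v. g (u @ v) \<le> g u * g v" and s: "s > 0" and C: "C > 0"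
    and bound: "\<And>n w. w \<in> words M n \<Longrightarrow> cyl_prob w \<le> C * g w powr s * exp (- real n * P)"
  shows "ereal P \<le> metric_entropy \<nu> left_shift + ereal s * growth_rate g"
proof -
  have pos: "g w > 0" if "w \<in> words M n" "cyl_prob w \<noteq> 0" for w n
    using bound[OF that(1)] that(2) cyl_prob_nonneg[of w] g[of w] by (cases "g w = 0") auto
  then have nd: "\<And>n. \<not> degenerate g n" unfolding degenerate_def by fastforce
  have "real n * P - ln C \<le> entropy_of \<nu> (initial n) + s * energy g n" for n
  proof -
    have "cyl_prob w * ln (cyl_prob w) \<le> cyl_prob w * (ln C - real n * P) + s * (cyl_prob w * ln (g w))"
      if w: "w \<in> words M n" for w
    proof (cases "cyl_prob w = 0")
      case False
      then have "cyl_prob w > 0" "g w > 0" using pos[OF w] cyl_prob_nonneg[of w] by linarith+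
      then have "ln (cyl_prob w) \<le> ln (C * g w powr s * exp (- real n * P))"
        using bound[OF w] by simp
      also have "\<dots> = ln C + s * ln (g w) - real n * P"
        using C \<open>g w > 0\<close> by (simp add: ln_mult ln_powr)
      finally have "cyl_prob w * ln (cyl_prob w) \<le> cyl_prob w * (ln C + s * ln (g w) - real n * P)"
        by (rule mult_left_mono) simp
      then show ?thesis by (simp add: algebra_simps)
    qed simp
    then have "(\<Sum>w\<in>words M n. cyl_prob w * ln (cyl_prob w))
        \<le> (\<Sum>w\<in>words M n. cyl_prob w * (ln C - real n * P) + s * (cyl_prob w * ln (g w)))"
      by (rule sum_mono)
    also have "\<dots> = ln C - real n * P + s * energy g n"
      by (simp add: sum.distrib energy_def sum_cyl_prob flip: sum_distrib_left sum_distrib_right)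
    finally show ?thesis unfolding block_entropy_eq by linarith
  qed
  note total = this
  have "(P - ln C / real n - entropy_of \<nu> (initial n) / real n) / s \<le> energy g n / real n" if n: "n \<ge> 1" for n
  proof -
    have "P - ln C / real n - entropy_of \<nu> (initial n) / real n
        = (real n * P - ln C - entropy_of \<nu> (initial n)) / real n"
      using n by (simp add: diff_divide_distrib)
    also have "\<dots> \<le> (s * energy g n) / real n"
      using total[of n] by (intro divide_right_mono) linarith+
    finally show ?thesis using s by (simp add: pos_divide_le_eq mult.commute)
  qed
  note low = this
  have "(\<lambda>n. (P - ln C / real n - entropy_of \<nu> (initial n) / real n) / s)
      \<longlonglongrightarrow> (P - 0 - block_entropy_rate) / s"
    using s by (intro tendsto_intros block_entropy_rate tendsto_divide_0[OF tendsto_const]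
        filterlim_at_top_imp_at_infinity filterlim_real_sequentially) auto
  then have "(\<lambda>n. ereal ((P - ln C / real n - entropy_of \<nu> (initial n) / real n) / s))
      \<longlonglongrightarrow> ereal ((P - 0 - block_entropy_rate) / s)" by (rule tendsto_ereal)
  then have "ereal ((P - 0 - block_entropy_rate) / s) \<le> growth_rate g"
    by (rule LIMSEQ_le[OF _ growth_rate_nondegenerate(2)[OF g sub nd]]) (use low in auto)
  moreover have "growth_rate g \<noteq> \<infinity>" by (rule growth_rate_nondegenerate(1)[OF g sub nd])
  ultimately obtain l where l: "growth_rate g = ereal l" "(P - block_entropy_rate) / s \<le> l"
    by (cases "growth_rate g") auto
  then have "P \<le> block_entropy_rate + s * l"
    using s by (simp add: pos_divide_le_eq mult.commute)
  then show ?thesis by (simp add: kolmogorov_sinai l(1))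
qed

end

section \<open>Measures with prescribed cylinder probabilities\<close>

text \<open>
  Weights that are consistent under prolongation to the right define a finitely additive function on clopen
  sets. It is a premeasure for a topological reason: clopen sets are compact, so that a decreasing sequence
  of them with empty intersection is eventually empty.
\<close>

locale consistent_word_weights =
  fixes M :: nat and p :: "nat list \<Rightarrow> real"
  assumes M_pos: "1 \<le> M"
    and weight_nonneg: "\<And>w. 0 \<le> p w"
    and weight_Nil: "p [] = 1"
    and weight_extend: "\<And>n w. w \<in> words M n \<Longrightarrow> (\<Sum>i\<in>{1..M}. p (w @ [i])) = p w"
begin

lemma sum_weight_append: "u \<in> words M n \<Longrightarrow> (\<Sum>v\<in>words M m. p (u @ v)) = p u"
proof (induction m arbitrary: n u)
  case (Suc m)
  have "(\<Sum>v\<in>words M (Suc m). p (u @ v)) = (\<Sum>v\<in>words M m. \<Sum>i\<in>{1..M}. p ((u @ v) @ [i]))"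
    using sum_words_add[of "\<lambda>v. p (u @ v)" M m 1] by (simp add: sum_words_1)
  also have "\<dots> = (\<Sum>v\<in>words M m. p (u @ v))"
    using append_in_words[OF Suc.prems] by (intro sum.cong refl weight_extend)
  finally show ?case using Suc by simp
qed simp

lemma sum_weight_lift:
  assumes "n \<le> m"
  shows "(\<Sum>w\<in>words M n \<inter> S. p w) = (\<Sum>w\<in>words M m \<inter> {w. take n w \<in> S}. p w)"
proof -
  obtain k where k: "m = n + k" using assms le_Suc_ex by blast
  have "(\<Sum>w\<in>words M m \<inter> {w. take n w \<in> S}. p w) = (\<Sum>w\<in>words M (n + k). if take n w \<in> S then p w else 0)"
    unfolding k by (simp add: sum.If_cases)
  also have "\<dots> = (\<Sum>u\<in>words M n. \<Sum>v\<in>words M k. if u \<in> S then p (u @ v) else 0)"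
    unfolding sum_words_add by (intro sum.cong refl) (simp add: words_def)
  also have "\<dots> = (\<Sum>u\<in>words M n. if u \<in> S then p u else 0)"
    by (intro sum.cong refl) (simp add: sum_weight_append)
  finally show ?thesis by (simp add: sum.If_cases)
qed

lemma words_eq_initial: "w \<in> words M n \<Longrightarrow> \<exists>x\<in>full_shift M. initial n x = w"
  using M_pos nth_mem
  by (intro bexI[of _ "\<lambda>i. if i < n then w ! i else 1"]) (auto simp: words_def full_shift_def list_eq_iff_nth_eq subset_iff)

text \<open>
  A clopen set is represented by words of any sufficiently large length; its weight does not depend on the length.
\<close>

lemma clopen_weight_unique:
  assumes "clopen M n S = clopen M m R"
  shows "(\<Sum>w\<in>words M n \<inter> S. p w) = (\<Sum>w\<in>words M m \<inter> R. p w)"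
proof -
  let ?N = "max n m"
  have "clopen M ?N {w. take n w \<in> S} = clopen M ?N {w. take m w \<in> R}"
    using assms clopen_lift[of n ?N M S] clopen_lift[of m ?N M R] by simp
  then have "words M ?N \<inter> {w. take n w \<in> S} = words M ?N \<inter> {w. take m w \<in> R}"
    using words_eq_initial[of _ ?N] by (fastforce simp: clopen_def)
  then show ?thesis using sum_weight_lift[of n ?N S] sum_weight_lift[of m ?N R] by simp
qed

definition weight :: "(nat \<Rightarrow> nat) set \<Rightarrow> real" where
  "weight E = (THE t. \<forall>n S. E = clopen M n S \<longrightarrow> t = (\<Sum>w\<in>words M n \<inter> S. p w))"

lemma weight_clopen: "weight (clopen M n S) = (\<Sum>w\<in>words M n \<inter> S. p w)"
  unfolding weight_def using clopen_weight_unique by (intro the_equality) blast+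

lemma weight_Un:
  assumes "E \<in> clopen_algebra M" "E' \<in> clopen_algebra M" "E \<inter> E' = {}"
  shows "weight (E \<union> E') = weight E + weight E'"
proof -
  obtain n S m R where E: "E = clopen M n S" "E' = clopen M m R" using assms by (auto simp: clopen_algebra_def)
  let ?N = "max n m" and ?S = "{w. take n w \<in> S}" and ?R = "{w. take m w \<in> R}"
  have lift: "E = clopen M ?N ?S" "E' = clopen M ?N ?R" unfolding E by (rule clopen_lift, simp)+
  have "E \<union> E' = clopen M ?N (?S \<union> ?R)" unfolding lift by (auto simp: clopen_def)
  moreover have "(words M ?N \<inter> ?S) \<inter> (words M ?N \<inter> ?R) = {}"
    using assms(3) words_eq_initial[of _ ?N] unfolding lift by (fastforce simp: clopen_def)
  then have "(\<Sum>w\<in>words M ?N \<inter> (?S \<union> ?R). p w) = (\<Sum>w\<in>words M ?N \<inter> ?S. p w) + (\<Sum>w\<in>words M ?N \<inter> ?R. p w)"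
    by (subst Int_Un_distrib, subst sum.union_disjoint) auto
  ultimately show ?thesis using lift by (simp only: weight_clopen)
qed

lemma weight_nonneg_clopen: "E \<in> clopen_algebra M \<Longrightarrow> 0 \<le> weight E"
  by (auto simp: clopen_algebra_def weight_clopen intro!: sum_nonneg weight_nonneg)

lemma compact_full_shift: "compact (full_shift M)"
proof -
  have "compactin (product_topology (\<lambda>_::nat. euclidean) UNIV) (PiE UNIV (\<lambda>_. {1..M}))"
    by (simp add: compactin_PiE finite_imp_compact)
  moreover have "PiE UNIV (\<lambda>_. {1..M}) = full_shift M" by (auto simp: full_shift_def PiE_def Pi_def)
  ultimately show ?thesis by (simp add: euclidean_product_topology)
qed

lemma closed_clopen: "closed (clopen M n S)"
proof -
  have coord: "closed {x :: nat \<Rightarrow> nat. x i = a}" for i a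
    by (intro closed_Collect_eq continuous_on_product_coordinates continuous_intros)
  have full: "full_shift M = (\<Inter>i. \<Union>a\<in>{1..M}. {x. x i = a})" by (auto simp: full_shift_def)
  let ?B = "\<lambda>w. \<Inter>i\<in>{..<n}. {x. x i = w ! i}"
  have mem: "x \<in> ?B w \<longleftrightarrow> initial n x = w" if "w \<in> words M n \<inter> S" for x w
    using that by (auto simp: words_def list_eq_iff_nth_eq)
  have "clopen M n S = full_shift M \<inter> (\<Union>w\<in>words M n \<inter> S. {x. initial n x = w})"
    using initial_in_words[of _ M n] by (auto simp: clopen_def)
  also have "(\<Union>w\<in>words M n \<inter> S. {x. initial n x = w}) = (\<Union>w\<in>words M n \<inter> S. ?B w)"
    by (intro SUP_cong refl set_eqI) (simp only: mem mem_Collect_eq)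
  also have "closed (full_shift M \<inter> \<dots>)"
    unfolding full by (intro closed_Int closed_UN closed_INT ballI coord) auto
  finally show ?thesis .
qed

text \<open>
  Caratheodory's extension theorem; continuity at the empty set is the compactness argument.
\<close>

lemma extension_exists:
  obtains m where "prob_space m" "sets m = sets (shift_borel M)"
    "\<And>n S. measure m (clopen M n S) = (\<Sum>w\<in>words M n \<inter> S. p w)"
proof -
  interpret A: algebra "full_shift M" "clopen_algebra M" by (rule clopen_algebra_algebra)
  let ?f = "\<lambda>E. ennreal (weight E)"
  have empty: "clopen M 0 {} = {}" by (simp add: clopen_def)
  have weight_empty: "weight {} = 0" using weight_clopen[of 0 "{}"] unfolding empty by simp
  have "\<exists>\<mu>. (\<forall>E\<in>clopen_algebra M. \<mu> E = ?f E) \<and> measure_space (full_shift M) (sigma_sets (full_shift M) (clopen_algebra M)) \<mu>"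
  proof (rule A.caratheodory_empty_continuous)
    show "positive (clopen_algebra M) ?f" by (simp add: positive_def weight_empty)
    show "additive (clopen_algebra M) ?f"
      by (simp add: additive_def weight_Un weight_nonneg_clopen)
    fix E :: "nat \<Rightarrow> (nat \<Rightarrow> nat) set"
    assume E: "range E \<subseteq> clopen_algebra M" "decseq E" "(\<Inter>i. E i) = {}"
    have "\<exists>k. E k = {}"
    proof (rule ccontr)
      assume ne: "\<not> ?thesis"
      have "full_shift M \<inter> \<Inter>(range E) \<noteq> {}"
      proof (rule compact_imp_fip[OF compact_full_shift])
        show "closed T" if "T \<in> range E" for T
          using that E(1) closed_clopen by (auto simp: clopen_algebra_def)
        fix F' assume F': "finite F'" "F' \<subseteq> range E"
        then obtain I where I: "finite I" "F' = E ` I" by (meson finite_subset_image)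
        have "E (Max (insert 0 I)) \<subseteq> E i" if "i \<in> I" for i
          using E(2) I(1) that by (simp add: decseq_def)
        moreover have "E (Max (insert 0 I)) \<subseteq> full_shift M" using E(1) A.space_closed by blast
        ultimately show "full_shift M \<inter> \<Inter>F' \<noteq> {}" using ne I(2) by blast
      qed
      then show False using E(3) by blast
    qed
    then obtain k where "E k = {}" ..
    then have "\<forall>\<^sub>F i in sequentially. ?f (E i) = 0"
      using E(2) by (intro eventually_sequentiallyI[of k]) (auto simp: decseq_def weight_empty dest!: spec)
    then show "(\<lambda>i. ?f (E i)) \<longlonglongrightarrow> 0" by (rule tendsto_eventually)
  qed auto
  then obtain \<mu> where \<mu>: "\<And>E. E \<in> clopen_algebra M \<Longrightarrow> \<mu> E = ?f E"
    "measure_space (full_shift M) (sigma_sets (full_shift M) (clopen_algebra M)) \<mu>" by blast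
  let ?A = "sigma_sets (full_shift M) (clopen_algebra M)"
  define m where "m = measure_of (full_shift M) ?A \<mu>"
  have sets: "sets m = sets (shift_borel M)"
    unfolding m_def sets_shift_borel
    by (subst sets_measure_of) (use sigma_sets_into_sp[OF A.space_closed] in \<open>auto simp: sigma_sets_sigma_sets_eq[OF A.space_closed]\<close>)
  have val: "emeasure m E = ?f E" if "E \<in> clopen_algebra M" for E
    using that \<mu> emeasure_measure_of_sigma[of "full_shift M" ?A \<mu> E]
    unfolding m_def measure_space_def by simp
  have full: "clopen M 0 UNIV = full_shift M" by (auto simp: clopen_def)
  have "emeasure m (full_shift M) = 1"
    using val[of "full_shift M"] weight_clopen[of 0 UNIV] weight_Nil A.top unfolding full by simp
  then have "prob_space m"
    using sets_eq_imp_space_eq[OF sets] by (intro prob_spaceI) simp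
  moreover have "measure m (clopen M n S) = (\<Sum>w\<in>words M n \<inter> S. p w)" for n S
  proof -
    have "clopen M n S \<in> clopen_algebra M" by (auto simp: clopen_algebra_def)
    then show ?thesis
      using val[of "clopen M n S"] by (simp add: measure_def weight_clopen sum_nonneg weight_nonneg)
  qed
  ultimately show ?thesis using sets by (intro that)
qed

text \<open>
  Consistency under prolongation to the left is invariance on clopen sets, which form a \<open>\<pi>\<close>-system.
\<close>

theorem invariant_extension_exists:
  assumes left: "\<And>n w. w \<in> words M n \<Longrightarrow> (\<Sum>i\<in>{1..M}. p (i # w)) = p w"
  obtains m where "m \<in> invariant_measures M" "\<And>n w. w \<in> words M n \<Longrightarrow> measure m (cylinder M w) = p w"
proof -
  obtain m where "prob_space m" and sets [simp, measurable_cong]: "sets m = sets (shift_borel M)"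
    and m: "\<And>n S. measure m (clopen M n S) = (\<Sum>w\<in>words M n \<inter> S. p w)"
    by (rule extension_exists) (rule that)
  interpret E: prob_space m by fact
  have sp: "space m = full_shift M" using sets_eq_imp_space_eq[OF sets] by simp
  have shift: "left_shift \<in> m \<rightarrow>\<^sub>M m" by measurable
  interpret A: algebra "full_shift M" "clopen_algebra M" by (rule clopen_algebra_algebra)
  have "distr m m left_shift = m"
  proof (rule measure_eqI_generator_eq[where E = "clopen_algebra M" and \<Omega> = "full_shift M" and A = "\<lambda>_. full_shift M"])
    show "Int_stable (clopen_algebra M)" by (auto simp: Int_stable_def)
    show "clopen_algebra M \<subseteq> Pow (full_shift M)" by (rule A.space_closed)
    fix X assume "X \<in> clopen_algebra M"
    then obtain n S where X: "X = clopen M n S" by (auto simp: clopen_algebra_def)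
    have "left_shift -` X \<inter> full_shift M = clopen M (1 + n) {w. drop 1 w \<in> S}"
      using shift_vimage_clopen[where k = 1 and n = n and S = S] by (simp add: X)
    then have "measure m (left_shift -` X \<inter> full_shift M)
        = (\<Sum>w\<in>words M (1 + n) \<inter> {w. drop 1 w \<in> S}. p w)" by (simp only: m)
    also have "\<dots> = (\<Sum>w\<in>words M (1 + n). p w * indicator S (drop 1 w))"
      by (rule sum.mono_neutral_cong_left) (auto simp: indicator_def)
    also have "\<dots> = (\<Sum>u\<in>words M n. \<Sum>i\<in>{1..M}. p (i # u) * indicator S u)"
      unfolding sum_words_add One_nat_def sum_words_1 append_Cons append_Nil drop_Suc_Cons drop_0
      by (rule sum.swap)
    also have "\<dots> = (\<Sum>u\<in>words M n. p u * indicator S u)"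
      by (intro sum.cong refl) (simp only: left flip: sum_distrib_right)
    also have "\<dots> = (\<Sum>w\<in>words M n \<inter> S. p w)"
      by (rule sum.mono_neutral_cong_right) (auto simp: indicator_def)
    also have "\<dots> = measure m X" unfolding X m ..
    finally show "emeasure (distr m m left_shift) X = emeasure m X"
      using emeasure_distr[OF shift, of X] X by (simp add: sp E.emeasure_eq_measure)
  next
    interpret D: prob_space "distr m m left_shift" by (rule E.prob_space_distr[OF shift])
    show "emeasure (distr m m left_shift) (full_shift M) \<noteq> \<infinity>" by simp
  qed (use A.top in \<open>auto simp: sets_shift_borel\<close>)
  then have "m \<in> invariant_measures M" using E.prob_space_axioms by (simp add: invariant_measures_def)
  moreover have "measure m (cylinder M w) = p w" if "w \<in> words M n" for n w
    using that m[of "length w" "{w}"] by (simp add: words_def)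
  ultimately show ?thesis by (rule that)
qed

end

section \<open>Gibbs measures of quasi-multiplicative potentials\<close>

text \<open>
  Any two words can be joined by a word from \<open>W\<close> at bounded multiplicative cost.
\<close>

definition connecting :: "nat list set \<Rightarrow> real \<Rightarrow> (nat list \<Rightarrow> real) \<Rightarrow> bool" where
  "connecting W c \<phi> \<longleftrightarrow> finite W \<and> 0 < c \<and> (\<forall>u v. \<exists>w\<in>W. c * (\<phi> u * \<phi> v) \<le> \<phi> (u @ w @ v))"

definition gibbs_bounds :: "nat \<Rightarrow> (nat list \<Rightarrow> real) \<Rightarrow> real \<Rightarrow> real \<Rightarrow> (nat \<Rightarrow> nat) measure \<Rightarrow> bool" where
  "gibbs_bounds M \<phi> P C m \<longleftrightarrow> 0 < C \<and> (\<forall>n. \<forall>w\<in>words M n.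
     measure m (cylinder M w) \<le> C * (\<phi> w * exp (- real n * P)) \<and>
     \<phi> w * exp (- real n * P) \<le> C * measure m (cylinder M w))"

locale quasi_multiplicative =
  fixes M :: nat and \<phi> :: "nat list \<Rightarrow> real" and W :: "nat list set" and c :: real
  assumes M_pos: "1 \<le> M"
    and phi_nonneg: "\<And>w. 0 \<le> \<phi> w" and phi_Nil: "\<phi> [] = 1"
    and phi_append: "\<And>u v. \<phi> (u @ v) \<le> \<phi> u * \<phi> v"
    and connecting: "connecting W c \<phi>" and W_words: "\<And>w. w \<in> W \<Longrightarrow> w \<in> words M (length w)"
    and nonvanishing: "\<And>n. \<exists>w\<in>words M n. 0 < \<phi> w"
begin

lemma finite_W: "finite W" and c_pos: "0 < c"
  and connect: "\<exists>w\<in>W. c * (\<phi> u * \<phi> v) \<le> \<phi> (u @ w @ v)"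
  using connecting unfolding connecting_def by auto

definition Z :: "nat \<Rightarrow> real" where
  "Z n = (\<Sum>w\<in>words M n. \<phi> w)"

text \<open>
  The weight of all words of length \<open>k + |w| + r\<close> that carry \<open>w\<close> at position \<open>k\<close>.
\<close>

definition S :: "nat \<Rightarrow> nat list \<Rightarrow> nat \<Rightarrow> real" where
  "S k w r = (\<Sum>u\<in>words M k. \<Sum>v\<in>words M r. \<phi> (u @ w @ v))"

lemma Z_pos: "0 < Z n"
proof -
  obtain w where w: "w \<in> words M n" "0 < \<phi> w" using nonvanishing by blast
  have "\<phi> w \<le> Z n" unfolding Z_def using w by (intro member_le_sum) (auto simp: phi_nonneg)
  with w show ?thesis by linarith
qed

lemma Z_0: "Z 0 = 1"
  by (simp add: Z_def phi_Nil)

lemma S_nonneg: "0 \<le> S k w r"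
  unfolding S_def by (intro sum_nonneg phi_nonneg)

lemma S_Nil: "S k [] r = Z (k + r)"
  unfolding S_def Z_def sum_words_add by simp

lemma S_le: "S k w r \<le> Z k * \<phi> w * Z r"
proof -
  have "S k w r \<le> (\<Sum>u\<in>words M k. \<Sum>v\<in>words M r. \<phi> u * (\<phi> w * \<phi> v))"
    unfolding S_def
  proof (intro sum_mono)
    fix u v
    have "\<phi> (u @ w @ v) \<le> \<phi> u * \<phi> (w @ v)" by (rule phi_append)
    also have "\<dots> \<le> \<phi> u * (\<phi> w * \<phi> v)" by (intro mult_left_mono phi_append phi_nonneg)
    finally show "\<phi> (u @ w @ v) \<le> \<phi> u * (\<phi> w * \<phi> v)" .
  qed
  also have "\<dots> = Z k * \<phi> w * Z r"
    by (simp add: Z_def algebra_simps flip: sum_distrib_left sum_distrib_right)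
  finally show ?thesis .
qed

definition gap_mass :: real where
  "gap_mass = (\<Sum>g\<in>W. Z (length g))"

definition \<kappa> :: real where
  "\<kappa> = (c / gap_mass)\<^sup>2"

lemma gap_mass_pos: "0 < gap_mass"
  unfolding gap_mass_def using finite_W connect[of "[]" "[]"] Z_pos by (intro sum_pos) auto

lemma kappa_pos: "0 < \<kappa>"
  using c_pos gap_mass_pos by (simp add: \<kappa>_def)

text \<open>
  Insert connecting words between \<open>u\<close> and \<open>x\<close>, then split off the first \<open>|g|\<close> letters of \<open>u g\<close>: up to a bounded factor the
  inserted letters disappear from the length, so that no gap remains on the right-hand side.
\<close>

lemma left_gap: "c * (Z k * \<phi> x) \<le> gap_mass * (\<Sum>u\<in>words M k. \<phi> (u @ x))"
proof -
  have "c * (Z k * \<phi> x) = (\<Sum>u\<in>words M k. c * (\<phi> u * \<phi> x))"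
    by (simp add: Z_def sum_distrib_left sum_distrib_right)
  also have "\<dots> \<le> (\<Sum>u\<in>words M k. \<Sum>g\<in>W. \<phi> (u @ g @ x))"
  proof (rule sum_mono)
    fix u
    obtain g where g: "g \<in> W" "c * (\<phi> u * \<phi> x) \<le> \<phi> (u @ g @ x)" using connect by blast
    have "\<phi> (u @ g @ x) \<le> (\<Sum>g\<in>W. \<phi> (u @ g @ x))"
      by (rule member_le_sum[OF g(1)]) (use finite_W phi_nonneg in auto)
    with g(2) show "c * (\<phi> u * \<phi> x) \<le> (\<Sum>g\<in>W. \<phi> (u @ g @ x))" by (rule order_trans)
  qed
  also have "\<dots> = (\<Sum>g\<in>W. \<Sum>u\<in>words M k. \<phi> (u @ g @ x))" by (rule sum.swap)
  also have "\<dots> \<le> (\<Sum>g\<in>W. Z (length g) * (\<Sum>u\<in>words M k. \<phi> (u @ x)))"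
  proof (rule sum_mono)
    fix g assume g: "g \<in> W"
    have "(\<Sum>u\<in>words M k. \<phi> (u @ g @ x)) \<le> (\<Sum>u\<in>words M k. \<Sum>y\<in>words M (length g). \<phi> ((u @ y) @ x))"
      using member_le_sum[OF W_words[OF g], of "\<lambda>y. \<phi> (_ @ y @ x)"]
      by (intro sum_mono) (auto simp: phi_nonneg)
    also have "\<dots> = (\<Sum>z\<in>words M (k + length g). \<phi> (z @ x))" by (rule sum_words_add[symmetric])
    also have "\<dots> = (\<Sum>z\<in>words M (length g + k). \<phi> (z @ x))" by (simp only: add.commute)
    also have "\<dots> \<le> (\<Sum>y\<in>words M (length g). \<Sum>u\<in>words M k. \<phi> y * \<phi> (u @ x))"
      unfolding sum_words_add append_assoc by (intro sum_mono phi_append)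
    finally show "(\<Sum>u\<in>words M k. \<phi> (u @ g @ x)) \<le> Z (length g) * (\<Sum>u\<in>words M k. \<phi> (u @ x))"
      by (simp add: Z_def sum_product)
  qed
  finally show ?thesis by (simp add: gap_mass_def sum_distrib_right)
qed

text \<open>
  The mirror image of the previous inequality.
\<close>

lemma right_gap: "c * (\<phi> x * Z r) \<le> gap_mass * (\<Sum>v\<in>words M r. \<phi> (x @ v))"
proof -
  have "c * (\<phi> x * Z r) = (\<Sum>v\<in>words M r. c * (\<phi> x * \<phi> v))"
    by (simp add: Z_def sum_distrib_left)
  also have "\<dots> \<le> (\<Sum>v\<in>words M r. \<Sum>g\<in>W. \<phi> (x @ g @ v))"
  proof (rule sum_mono)
    fix v
    obtain g where g: "g \<in> W" "c * (\<phi> x * \<phi> v) \<le> \<phi> (x @ g @ v)" using connect by blast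
    have "\<phi> (x @ g @ v) \<le> (\<Sum>g\<in>W. \<phi> (x @ g @ v))"
      by (rule member_le_sum[OF g(1)]) (use finite_W phi_nonneg in auto)
    with g(2) show "c * (\<phi> x * \<phi> v) \<le> (\<Sum>g\<in>W. \<phi> (x @ g @ v))" by (rule order_trans)
  qed
  also have "\<dots> = (\<Sum>g\<in>W. \<Sum>v\<in>words M r. \<phi> (x @ g @ v))" by (rule sum.swap)
  also have "\<dots> \<le> (\<Sum>g\<in>W. Z (length g) * (\<Sum>v\<in>words M r. \<phi> (x @ v)))"
  proof (rule sum_mono)
    fix g assume g: "g \<in> W"
    have "(\<Sum>v\<in>words M r. \<phi> (x @ g @ v)) \<le> (\<Sum>y\<in>words M (length g). \<Sum>v\<in>words M r. \<phi> (x @ y @ v))"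
      by (rule member_le_sum[OF W_words[OF g]]) (auto simp: phi_nonneg sum_nonneg)
    also have "\<dots> = (\<Sum>z\<in>words M (length g + r). \<phi> (x @ z))" by (rule sum_words_add[symmetric])
    also have "\<dots> = (\<Sum>z\<in>words M (r + length g). \<phi> (x @ z))" by (simp only: add.commute)
    also have "\<dots> \<le> (\<Sum>v\<in>words M r. \<Sum>y\<in>words M (length g). \<phi> (x @ v) * \<phi> y)"
      unfolding sum_words_add append_assoc[symmetric] by (intro sum_mono phi_append)
    finally show "(\<Sum>v\<in>words M r. \<phi> (x @ g @ v)) \<le> Z (length g) * (\<Sum>v\<in>words M r. \<phi> (x @ v))"
      by (subst mult.commute) (simp add: Z_def sum_product)
  qed
  finally show ?thesis by (simp add: gap_mass_def sum_distrib_right)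
qed

text \<open>
  The converse of \<open>S_le\<close> up to a constant: the weight is approximately independent on the three segments.
\<close>

lemma S_ge: "\<kappa> * (Z k * \<phi> w * Z r) \<le> S k w r"
proof -
  have "c\<^sup>2 * (Z k * \<phi> w * Z r) = c * Z k * (c * (\<phi> w * Z r))" by (simp add: power2_eq_square)
  also have "\<dots> \<le> c * Z k * (gap_mass * (\<Sum>v\<in>words M r. \<phi> (w @ v)))"
    using right_gap c_pos Z_pos[of k] by (intro mult_left_mono) auto
  also have "\<dots> = gap_mass * (\<Sum>v\<in>words M r. c * (Z k * \<phi> (w @ v)))"
    by (simp add: sum_distrib_left mult_ac)
  also have "\<dots> \<le> gap_mass * (\<Sum>v\<in>words M r. gap_mass * (\<Sum>u\<in>words M k. \<phi> (u @ w @ v)))"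
    using left_gap gap_mass_pos by (intro mult_left_mono sum_mono) auto
  also have "\<dots> = gap_mass\<^sup>2 * S k w r"
    unfolding S_def by (subst sum.swap) (simp add: sum_distrib_left power2_eq_square mult.assoc)
  finally show ?thesis
    using gap_mass_pos by (simp add: \<kappa>_def power_divide pos_divide_le_eq mult.commute)
qed

lemma kappa_le_1: "\<kappa> \<le> 1"
  using S_ge[of 0 "[]" 0] by (simp add: S_Nil Z_0 phi_Nil)

lemma Z_submult: "Z (n + m) \<le> Z n * Z m"
  using S_le[of n "[]" m] by (simp add: S_Nil phi_Nil)

lemma Z_supermult: "\<kappa> * (Z n * Z m) \<le> Z (n + m)"
  using S_ge[of n "[]" m] by (simp add: S_Nil phi_Nil)

text \<open>
  \<open>ln Z\<^sub>n\<close> is subadditive and \<open>- ln (\<kappa> Z\<^sub>n)\<close> is subadditive as well. The two sequences, divided by \<open>n\<close>, have opposite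
  limits, and each limit is an infimum; the two infima are the two bounds.
\<close>

lemma pressure:
  obtains P where "(\<lambda>n. ln (Z n) / real n) \<longlonglongrightarrow> P"
    "\<And>n. exp (real n * P) \<le> Z n" "\<And>n. \<kappa> * Z n \<le> exp (real n * P)"
proof -
  have up: "ln (Z (n + m)) \<le> ln (Z n) + ln (Z m)" for n m
  proof -
    have "ln (Z (n + m)) \<le> ln (Z n * Z m)" using Z_submult Z_pos by simp
    then show ?thesis using Z_pos by (simp add: ln_mult_pos)
  qed
  have low: "- ln (\<kappa> * Z (n + m)) \<le> - ln (\<kappa> * Z n) + - ln (\<kappa> * Z m)" for n m
  proof -
    have "\<kappa> * (\<kappa> * (Z n * Z m)) \<le> \<kappa> * Z (n + m)"
      using Z_supermult kappa_pos by (intro mult_left_mono) auto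
    then have "ln ((\<kappa> * Z n) * (\<kappa> * Z m)) \<le> ln (\<kappa> * Z (n + m))"
      using Z_pos kappa_pos by (subst ln_le_cancel_iff) (auto simp: algebra_simps)
    then show ?thesis
      using ln_mult_pos[of "\<kappa> * Z n" "\<kappa> * Z m"] Z_pos kappa_pos by simp
  qed
  have lnk: "ln (\<kappa> * Z n) = ln \<kappa> + ln (Z n)" for n
    using Z_pos[of n] kappa_pos by (simp add: ln_mult)
  have k0: "ln \<kappa> \<le> 0" using kappa_pos kappa_le_1 by simp
  have lnZ_up: "ln (Z n) \<le> real n * ln (Z 1)" for n
  proof (induction n)
    case (Suc n)
    then show ?case using up[of n 1] by (simp add: algebra_simps)
  qed (simp add: Z_0)
  have lnZ_low: "ln (Z n) \<ge> real n * (ln \<kappa> + ln (Z 1))" for n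
  proof (induction n)
    case (Suc n)
    have "ln \<kappa> + ln (Z n) + ln (Z 1) \<le> ln (Z (Suc n))" using low[of n 1] by (simp add: lnk)
    with Suc show ?case by (simp add: distrib_right)
  qed (simp add: Z_0)
  obtain l where l: "(\<lambda>n. ln (Z n) / real n) \<longlonglongrightarrow> l" "\<And>n. n \<ge> 1 \<Longrightarrow> l \<le> ln (Z n) / real n"
  proof (rule fekete[of "\<lambda>n. ln (Z n)" "ln \<kappa> + ln (Z 1)"])
    show "ln \<kappa> + ln (Z 1) \<le> ln (Z n) / real n" if "n \<ge> 1" for n
      using lnZ_low[of n] that by (simp add: pos_le_divide_eq mult.commute)
  qed (use up in auto)
  obtain l' where l': "(\<lambda>n. - ln (\<kappa> * Z n) / real n) \<longlonglongrightarrow> l'" "\<And>n. n \<ge> 1 \<Longrightarrow> l' \<le> - ln (\<kappa> * Z n) / real n"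
  proof (rule fekete[of "\<lambda>n. - ln (\<kappa> * Z n)" "- ln (Z 1)"])
    show "- ln (Z 1) \<le> - ln (\<kappa> * Z n) / real n" if n: "n \<ge> 1" for n
    proof -
      have "ln (\<kappa> * Z n) \<le> real n * ln (Z 1)" using lnZ_up[of n] k0 by (simp add: lnk)
      then have "ln (\<kappa> * Z n) / real n \<le> ln (Z 1)" using n by (simp add: pos_divide_le_eq mult.commute)
      then show ?thesis by simp
    qed
  qed (use low in auto)
  have "(\<lambda>n. - (ln \<kappa> / real n) - ln (Z n) / real n) \<longlonglongrightarrow> - 0 - l"
    by (intro tendsto_intros l(1) tendsto_divide_0[OF tendsto_const] filterlim_at_top_imp_at_infinity
        filterlim_real_sequentially)
  moreover have "- (ln \<kappa> / real n) - ln (Z n) / real n = - ln (\<kappa> * Z n) / real n" for n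
    by (simp add: lnk diff_divide_distrib)
  ultimately have "l' = - l" using LIMSEQ_unique[OF l'(1)] by simp
  show ?thesis
  proof (rule that[OF l(1)])
    fix n
    show "exp (real n * l) \<le> Z n"
    proof (cases "n = 0")
      case False
      then have "real n * l \<le> ln (Z n)" using l(2)[of n] by (simp add: pos_le_divide_eq mult.commute)
      then show ?thesis using Z_pos[of n] by (simp add: ln_ge_iff)
    qed (simp add: Z_0)
    show "\<kappa> * Z n \<le> exp (real n * l)"
    proof (cases "n = 0")
      case False
      then have "- l \<le> - ln (\<kappa> * Z n) / real n" using l'(2)[of n] by (simp add: \<open>l' = - l\<close>)
      then have "ln (\<kappa> * Z n) / real n \<le> l" by simp
      then have "ln (\<kappa> * Z n) \<le> real n * l" using False by (simp add: pos_divide_le_eq mult.commute)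
      then show ?thesis using Z_pos[of n] kappa_pos by (metis exp_le_cancel_iff exp_ln mult_pos_pos)
    qed (use kappa_le_1 in \<open>simp add: Z_0\<close>)
  qed
qed

lemma S_Suc_right: "(\<Sum>i\<in>{1..M}. S k (w @ [i]) r) = S k w (Suc r)"
proof -
  have "S k w (Suc r) = S k w (Suc 0 + r)" by simp
  also have "\<dots> = (\<Sum>u\<in>words M k. \<Sum>i\<in>{1..M}. \<Sum>v\<in>words M r. \<phi> (u @ w @ [i] @ v))"
    by (simp only: S_def sum_words_add sum_words_1)
  also have "\<dots> = (\<Sum>i\<in>{1..M}. \<Sum>u\<in>words M k. \<Sum>v\<in>words M r. \<phi> (u @ w @ [i] @ v))"
    by (rule sum.swap)
  finally show ?thesis by (simp add: S_def)
qed

lemma S_Suc_left: "(\<Sum>i\<in>{1..M}. S k (i # w) r) = S (Suc k) w r"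
proof -
  have "S (Suc k) w r = S (k + Suc 0) w r" by simp
  also have "\<dots> = (\<Sum>u\<in>words M k. \<Sum>i\<in>{1..M}. \<Sum>v\<in>words M r. \<phi> ((u @ [i]) @ w @ v))"
    by (simp only: S_def sum_words_add sum_words_1)
  also have "\<dots> = (\<Sum>i\<in>{1..M}. \<Sum>u\<in>words M k. \<Sum>v\<in>words M r. \<phi> ((u @ [i]) @ w @ v))"
    by (rule sum.swap)
  finally show ?thesis by (simp add: S_def)
qed

lemma S_le_Z:
  assumes "w \<in> words M l"
  shows "S k w r \<le> Z (k + l + r)"
proof -
  have "S k w r \<le> (\<Sum>w\<in>words M l. S k w r)"
    using assms by (intro member_le_sum) (auto simp: S_nonneg)
  also have "\<dots> = (\<Sum>u\<in>words M k. \<Sum>w\<in>words M l. \<Sum>v\<in>words M r. \<phi> (u @ w @ v))"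
    unfolding S_def by (rule sum.swap)
  also have "\<dots> = Z (k + l + r)"
    by (simp add: Z_def sum_words_add)
  finally show ?thesis .
qed

text \<open>
  The expected frequency of \<open>w\<close> as a subword of a random word of length \<open>L\<close> with law proportional to \<open>\<phi>\<close>.
  Positions \<open>k < L - |w|\<close> are counted, but always divided by \<open>L\<close>, so that consistency and invariance hold
  up to the contribution of one position, an error of order \<open>1 / L\<close>.
\<close>

definition freq :: "nat \<Rightarrow> nat list \<Rightarrow> real" where
  "freq L w = (if w \<in> words M (length w) \<and> length w \<le> L
     then (\<Sum>k<L - length w. S k w (L - length w - k)) / (real L * Z L) else 0)"

lemma freq_eq:
  assumes "w \<in> words M l" "L = l + n"
  shows "freq L w = (\<Sum>k<n. S k w (n - k)) / (real L * Z L)"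
  using assms by (simp add: freq_def words_def)

lemma freq_nonneg: "0 \<le> freq L w"
  using Z_pos[of L] by (auto simp: freq_def intro!: divide_nonneg_nonneg sum_nonneg S_nonneg)

lemma freq_le_1: "freq L w \<le> 1"
proof (cases "w \<in> words M (length w) \<and> length w \<le> L \<and> L \<noteq> 0")
  case True
  then obtain n where L: "L = length w + n" using le_Suc_ex by blast
  have "(\<Sum>k<n. S k w (n - k)) \<le> (\<Sum>k<n. Z L)"
  proof (rule sum_mono)
    fix k assume "k \<in> {..<n}"
    then have "k + length w + (n - k) = L" by (simp add: L)
    then show "S k w (n - k) \<le> Z L" using S_le_Z[of w "length w" k "n - k"] True by simp
  qed
  also have "\<dots> \<le> real L * Z L" using Z_pos[of L] by (simp add: L mult_right_mono)
  finally show ?thesis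
    using True Z_pos[of L] freq_eq[OF _ L] by (simp add: divide_le_eq_1)
qed (auto simp: freq_def)

lemma freq_Nil: "L \<ge> 1 \<Longrightarrow> freq L [] = 1"
  using freq_eq[of "[]" 0 L L] Z_pos[of L] by (simp add: S_Nil)

lemma boundary_term_le:
  assumes "0 \<le> t" "t \<le> Z L"
  shows "\<bar>- (t / (real L * Z L))\<bar> \<le> 1 / real L"
proof -
  have "t / (real L * Z L) \<le> Z L / (real L * Z L)"
    using assms Z_pos[of L] by (intro divide_right_mono) auto
  moreover have "Z L / (real L * Z L) = 1 / real L" using Z_pos[of L] by simp
  moreover have "0 \<le> t / (real L * Z L)" using assms Z_pos[of L] by (intro divide_nonneg_nonneg) auto
  ultimately show ?thesis by linarith
qed

text \<open>
  Prolonging \<open>w\<close> by a letter on the right loses the last admissible position.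
\<close>

lemma freq_append:
  assumes w: "w \<in> words M l" and L: "L > l"
  shows "\<bar>(\<Sum>i\<in>{1..M}. freq L (w @ [i])) - freq L w\<bar> \<le> 1 / real L"
proof -
  obtain n where n: "L = l + Suc n" using L less_imp_Suc_add by auto
  have "freq L (w @ [i]) = (\<Sum>k<n. S k (w @ [i]) (n - k)) / (real L * Z L)" if "i \<in> {1..M}" for i
    using w that n by (intro freq_eq[of _ "Suc l"]) (auto simp: words_def)
  then have "(\<Sum>i\<in>{1..M}. freq L (w @ [i])) = (\<Sum>i\<in>{1..M}. \<Sum>k<n. S k (w @ [i]) (n - k)) / (real L * Z L)"
    by (simp add: sum_divide_distrib)
  also have "(\<Sum>i\<in>{1..M}. \<Sum>k<n. S k (w @ [i]) (n - k)) = (\<Sum>k<n. S k w (Suc n - k))"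
    by (subst sum.swap) (auto simp only: S_Suc_right Suc_diff_le less_imp_le lessThan_iff intro!: sum.cong)
  finally have "(\<Sum>i\<in>{1..M}. freq L (w @ [i])) - freq L w = - (S n w 1 / (real L * Z L))"
    unfolding freq_eq[OF w n] by (simp add: diff_divide_distrib[symmetric])
  moreover have "S n w 1 \<le> Z L" using S_le_Z[OF w, of n 1] n by (simp add: ac_simps)
  ultimately show ?thesis using boundary_term_le S_nonneg by (simp only:)
qed

text \<open>
  Prolonging \<open>w\<close> by a letter on the left shifts the positions by one and loses the first of them.
\<close>

lemma freq_Cons:
  assumes w: "w \<in> words M l" and L: "L > l"
  shows "\<bar>(\<Sum>i\<in>{1..M}. freq L (i # w)) - freq L w\<bar> \<le> 1 / real L"
proof -
  obtain n where n: "L = l + Suc n" using L less_imp_Suc_add by auto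
  have "freq L (i # w) = (\<Sum>k<n. S k (i # w) (n - k)) / (real L * Z L)" if "i \<in> {1..M}" for i
    using w that n by (intro freq_eq[of _ "Suc l"]) (auto simp: words_def)
  then have "(\<Sum>i\<in>{1..M}. freq L (i # w)) = (\<Sum>i\<in>{1..M}. \<Sum>k<n. S k (i # w) (n - k)) / (real L * Z L)"
    by (simp add: sum_divide_distrib)
  also have "(\<Sum>i\<in>{1..M}. \<Sum>k<n. S k (i # w) (n - k)) = (\<Sum>k<n. S (Suc k) w (n - k))"
    by (subst sum.swap) (simp only: S_Suc_left)
  finally have "(\<Sum>i\<in>{1..M}. freq L (i # w)) - freq L w = - (S 0 w (Suc n) / (real L * Z L))"
    unfolding freq_eq[OF w n] by (simp add: diff_divide_distrib[symmetric] sum.lessThan_Suc_shift del: sum.lessThan_Suc)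
  moreover have "S 0 w (Suc n) \<le> Z L" using S_le_Z[OF w, of 0 "Suc n"] n by (simp add: ac_simps)
  ultimately show ?thesis using boundary_term_le S_nonneg by (simp only:)
qed

text \<open>
  The Gibbs bounds hold already for finite \<open>L\<close>, termwise in the position \<open>k\<close>, by \<open>S_le\<close>, \<open>S_ge\<close> and the growth of \<open>Z\<close>.
\<close>

lemma freq_bounds:
  assumes w: "w \<in> words M l" and L: "L > l"
    and P: "\<And>n. exp (real n * P) \<le> Z n" "\<And>n. \<kappa> * Z n \<le> exp (real n * P)"
  shows "freq L w \<le> \<phi> w * exp (- real l * P) / \<kappa>\<^sup>2"
    and "(1 - real l / real L) * (\<kappa>\<^sup>2 * (\<phi> w * exp (- real l * P))) \<le> freq L w"
proof -
  obtain n where n: "L = l + n" "n \<ge> 1" using L by (metis less_imp_add_positive Suc_leI One_nat_def)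
  let ?e = "\<lambda>n. exp (real n * P)"
  \<comment> \<open>Here \<open>n\<close> counts the letters outside \<open>w\<close>, which is also the number of admissible positions.\<close>
  have inv: "?e n = ?e L * exp (- real l * P)" unfolding exp_add[symmetric] by (simp add: n(1) algebra_simps)
  have term_le: "S k w (n - k) \<le> ?e n * \<phi> w / \<kappa>\<^sup>2" and term_ge: "\<kappa> * (?e n * \<phi> w) \<le> S k w (n - k)" if k: "k < n" for k
  proof -
    have split: "?e k * ?e (n - k) = ?e n" using k by (simp add: of_nat_diff left_diff_distrib flip: exp_add)
    have Zle: "Z j \<le> ?e j / \<kappa>" for j using P(2)[of j] kappa_pos by (simp add: pos_le_divide_eq mult.commute)
    have "S k w (n - k) \<le> Z k * \<phi> w * Z (n - k)" by (rule S_le)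
    also have "\<dots> \<le> (?e k / \<kappa>) * \<phi> w * (?e (n - k) / \<kappa>)"
      using Zle Z_pos kappa_pos by (intro mult_mono mult_nonneg_nonneg phi_nonneg) (auto simp: less_imp_le)
    also have "\<dots> = (?e k * ?e (n - k)) * \<phi> w / \<kappa>\<^sup>2" by (simp add: power2_eq_square)
    finally show "S k w (n - k) \<le> ?e n * \<phi> w / \<kappa>\<^sup>2" unfolding split .
    have "\<kappa> * (?e n * \<phi> w) = \<kappa> * (?e k * \<phi> w * ?e (n - k))" unfolding split[symmetric] by simp
    also have "\<dots> \<le> \<kappa> * (Z k * \<phi> w * Z (n - k))"
      using P(1) Z_pos kappa_pos
      by (intro mult_left_mono[of _ _ \<kappa>] mult_mono mult_nonneg_nonneg phi_nonneg) (auto simp: less_imp_le)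
    also have "\<dots> \<le> S k w (n - k)" by (rule S_ge)
    finally show "\<kappa> * (?e n * \<phi> w) \<le> S k w (n - k)" .
  qed
  have LZ: "0 < real L * Z L" using Z_pos[of L] L by simp
  have "(\<Sum>k<n. S k w (n - k)) \<le> (\<Sum>k<n. ?e n * \<phi> w / \<kappa>\<^sup>2)" using term_le by (intro sum_mono) auto
  also have "\<dots> = real n * (?e n * \<phi> w / \<kappa>\<^sup>2)" by simp
  also have "\<dots> \<le> real L * (?e n * \<phi> w / \<kappa>\<^sup>2)"
    using phi_nonneg[of w] by (intro mult_right_mono) (auto simp: n)
  also have "\<dots> = (real L * ?e L) * (\<phi> w * exp (- real l * P) / \<kappa>\<^sup>2)" by (simp add: inv)
  also have "\<dots> \<le> (real L * Z L) * (\<phi> w * exp (- real l * P) / \<kappa>\<^sup>2)"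
    using P(1)[of L] phi_nonneg[of w] by (intro mult_right_mono mult_left_mono) auto
  finally show "freq L w \<le> \<phi> w * exp (- real l * P) / \<kappa>\<^sup>2"
    unfolding freq_eq[OF w n(1)] using LZ by (simp add: pos_divide_le_eq mult.commute)
  have nL: "1 - real l / real L = real n / real L" using n by (simp add: field_simps)
  have "real n * (\<kappa>\<^sup>2 * (\<phi> w * exp (- real l * P))) * Z L = real n * (\<kappa> * (\<phi> w * exp (- real l * P))) * (\<kappa> * Z L)"
    by (simp add: power2_eq_square)
  also have "\<dots> \<le> real n * (\<kappa> * (\<phi> w * exp (- real l * P))) * ?e L"
    using P(2)[of L] phi_nonneg[of w] kappa_pos by (intro mult_left_mono) auto
  also have "\<dots> = (\<Sum>k<n. \<kappa> * (?e n * \<phi> w))" by (simp add: inv)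
  also have "\<dots> \<le> (\<Sum>k<n. S k w (n - k))" using term_ge by (intro sum_mono) auto
  finally have "real n * (\<kappa>\<^sup>2 * (\<phi> w * exp (- real l * P))) * Z L / (real L * Z L) \<le> freq L w"
    unfolding freq_eq[OF w n(1)] using LZ by (intro divide_right_mono) auto
  then show "(1 - real l / real L) * (\<kappa>\<^sup>2 * (\<phi> w * exp (- real l * P))) \<le> freq L w"
    unfolding nL using Z_pos[of L] by simp
qed

text \<open>
  Sequential compactness of a countable power of the unit interval.
\<close>

lemma freq_subsequence:
  obtains p r where "strict_mono r" "\<And>w. (\<lambda>j. freq (r j) w) \<longlonglongrightarrow> p w"
proof -
  have "compactin (product_topology (\<lambda>_::nat list. euclidean) UNIV) (PiE UNIV (\<lambda>_. {0..1::real}))"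
    by (simp add: compactin_PiE)
  then have "compact (PiE UNIV (\<lambda>_::nat list. {0..1::real}))"
    by (simp add: euclidean_product_topology)
  then have "seq_compact (PiE UNIV (\<lambda>_::nat list. {0..1::real}))"
    by (rule compact_imp_seq_compact)
  moreover have "\<And>L. freq L \<in> PiE UNIV (\<lambda>_. {0..1})"
    using freq_nonneg freq_le_1 by auto
  ultimately obtain p r where r: "strict_mono r" "(freq \<circ> r) \<longlonglongrightarrow> p"
    unfolding seq_compact_def by blast
  have "(\<lambda>j. freq (r j) w) \<longlonglongrightarrow> p w" for w
  proof -
    have "continuous_on UNIV (\<lambda>x::nat list \<Rightarrow> real. x w)" by (rule continuous_on_product_coordinates)
    then have "isCont (\<lambda>x::nat list \<Rightarrow> real. x w) p"
      using continuous_on_eq_continuous_at[OF open_UNIV] by blast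
    from isCont_tendsto_compose[OF this r(2)] show ?thesis by (simp add: comp_def)
  qed
  with r(1) show ?thesis by (rule that)
qed

text \<open>
  Limits of frequencies are consistent word weights, since the error terms \<open>1 / L\<close> vanish; the measure extending
  them is invariant and inherits the bounds.
\<close>

theorem gibbs_measure_exists:
  obtains P m C where "(\<lambda>n. ln (\<Sum>w\<in>words M n. \<phi> w) / real n) \<longlonglongrightarrow> P"
    "m \<in> invariant_measures M" "gibbs_bounds M \<phi> P C m"
proof -
  obtain P where P: "(\<lambda>n. ln (Z n) / real n) \<longlonglongrightarrow> P"
    "\<And>n. exp (real n * P) \<le> Z n" "\<And>n. \<kappa> * Z n \<le> exp (real n * P)"
    by (rule pressure) (rule that)
  obtain p r where r: "strict_mono r" and p: "\<And>w. (\<lambda>j. freq (r j) w) \<longlonglongrightarrow> p w"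
    by (rule freq_subsequence) (rule that)
  have r_top: "filterlim (\<lambda>j. real (r j)) at_top sequentially"
    using filterlim_compose[OF filterlim_real_sequentially filterlim_subseq[OF r]] .
  then have small: "(\<lambda>j. a / real (r j)) \<longlonglongrightarrow> 0" for a
    by (intro tendsto_divide_0[OF tendsto_const] filterlim_at_top_imp_at_infinity)
  have large: "\<forall>\<^sub>F j in sequentially. l < r j" for l
    using seq_suble[OF r] by (intro eventually_sequentiallyI[of "Suc l"]) (meson Suc_le_lessD order_trans)
  have limit_eq: "x = y" if "f \<longlonglongrightarrow> x" "g \<longlonglongrightarrow> y" "\<forall>\<^sub>F j in sequentially. \<bar>f j - g j\<bar> \<le> 1 / real (r j)"
    for f g :: "nat \<Rightarrow> real" and x y
  proof -
    have "(\<lambda>j. f j - g j) \<longlonglongrightarrow> 0"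
      by (rule Lim_null_comparison[OF _ small[of 1]]) (use that(3) in simp)
    then show ?thesis using LIMSEQ_unique[OF _ tendsto_diff[OF that(1,2)]] by fastforce
  qed
  interpret ext: consistent_word_weights M p
  proof
    show "1 \<le> M" by (rule M_pos)
    show "0 \<le> p w" for w using p[of w] freq_nonneg by (intro LIMSEQ_le_const) auto
    have "\<forall>\<^sub>F j in sequentially. freq (r j) [] = 1"
      using large[of 0] by eventually_elim (simp add: freq_Nil)
    then have "(\<lambda>j. freq (r j) []) \<longlonglongrightarrow> 1" by (rule tendsto_eventually)
    then show "p [] = 1" using LIMSEQ_unique[OF p[of "[]"]] by simp
    fix n w assume w: "w \<in> words M n"
    have "(\<lambda>j. \<Sum>i\<in>{1..M}. freq (r j) (w @ [i])) \<longlonglongrightarrow> (\<Sum>i\<in>{1..M}. p (w @ [i]))"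
      by (intro tendsto_sum p)
    moreover have "\<forall>\<^sub>F j in sequentially. \<bar>(\<Sum>i\<in>{1..M}. freq (r j) (w @ [i])) - freq (r j) w\<bar> \<le> 1 / real (r j)"
      using large[of n] by eventually_elim (rule freq_append[OF w])
    ultimately show "(\<Sum>i\<in>{1..M}. p (w @ [i])) = p w"
      using p[of w] by (intro limit_eq)
  qed
  have left: "(\<Sum>i\<in>{1..M}. p (i # w)) = p w" if w: "w \<in> words M n" for n w
  proof (rule limit_eq[OF _ p[of w]])
    show "(\<lambda>j. \<Sum>i\<in>{1..M}. freq (r j) (i # w)) \<longlonglongrightarrow> (\<Sum>i\<in>{1..M}. p (i # w))"
      by (intro tendsto_sum p)
    show "\<forall>\<^sub>F j in sequentially. \<bar>(\<Sum>i\<in>{1..M}. freq (r j) (i # w)) - freq (r j) w\<bar> \<le> 1 / real (r j)"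
      using large[of n] by eventually_elim (rule freq_Cons[OF w])
  qed
  obtain m where m: "m \<in> invariant_measures M" "\<And>n w. w \<in> words M n \<Longrightarrow> measure m (cylinder M w) = p w"
    by (rule ext.invariant_extension_exists[OF left]) (assumption, rule that)
  show ?thesis
  proof (rule that)
    show "(\<lambda>n. ln (\<Sum>w\<in>words M n. \<phi> w) / real n) \<longlonglongrightarrow> P" using P(1) by (simp add: Z_def)
    show "m \<in> invariant_measures M" by (rule m(1))
    show "gibbs_bounds M \<phi> P (1 / \<kappa>\<^sup>2) m"
      unfolding gibbs_bounds_def
    proof (intro conjI allI ballI)
      show "0 < 1 / \<kappa>\<^sup>2" using kappa_pos by simp
      fix n w assume w: "w \<in> words M n"
      let ?q = "\<phi> w * exp (- real n * P)"
      have "\<forall>\<^sub>F j in sequentially. freq (r j) w \<le> ?q / \<kappa>\<^sup>2"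
        using large[of n] by eventually_elim (rule freq_bounds(1)[OF w _ P(2,3)])
      then have "p w \<le> ?q / \<kappa>\<^sup>2"
        by (rule tendsto_upperbound[OF p[of w]]) simp
      then show "measure m (cylinder M w) \<le> 1 / \<kappa>\<^sup>2 * ?q"
        by (simp add: m(2)[OF w])
      have "\<forall>\<^sub>F j in sequentially. (1 - real n / real (r j)) * (\<kappa>\<^sup>2 * ?q) \<le> freq (r j) w"
        using large[of n] by eventually_elim (rule freq_bounds(2)[OF w _ P(2,3)])
      moreover have "(\<lambda>j. (1 - real n / real (r j)) * (\<kappa>\<^sup>2 * ?q)) \<longlonglongrightarrow> (1 - 0) * (\<kappa>\<^sup>2 * ?q)"
        by (intro tendsto_intros small)
      ultimately have "(1 - 0) * (\<kappa>\<^sup>2 * ?q) \<le> p w"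
        using p[of w] by (intro tendsto_le[OF trivial_limit_sequentially])
      then show "?q \<le> 1 / \<kappa>\<^sup>2 * measure m (cylinder M w)"
        using kappa_pos by (simp add: m(2)[OF w] pos_le_divide_eq mult.commute)
    qed
  qed
qed

end

section \<open>Norms of products of irreducible matrices\<close>

text \<open>
  Later letters act on the left, so concatenation of words reverses the order of the factors.
\<close>

primrec word_product :: "(nat \<Rightarrow> real^'n^'n) \<Rightarrow> nat list \<Rightarrow> real^'n^'n" where
  "word_product A [] = mat 1"
| "word_product A (i # w) = word_product A w ** A i"

lemma word_product_append: "word_product A (u @ v) = word_product A v ** word_product A u"
  by (induction u) (auto simp: matrix_mul_assoc)

lemma matrix_product_eq_word_product: "matrix_product A x n = word_product A (initial n x)"
  by (induction n) (simp_all add: initial_def word_product_append)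

lemma matrix_products_eq: "matrix_products M A n = word_product A ` words M n"
proof (intro set_eqI iffI)
  fix B assume "B \<in> matrix_products M A n"
  then obtain i where "B = word_product A (initial n i)" "\<forall>k<n. i k \<in> {1..M}"
    by (auto simp: matrix_products_def matrix_product_eq_word_product)
  moreover from this have "initial n i \<in> words M n" by (auto simp: words_def initial_def)
  ultimately show "B \<in> word_product A ` words M n" by blast
next
  fix B assume "B \<in> word_product A ` words M n"
  then obtain w where w: "w \<in> words M n" "B = word_product A w" by blast
  have "initial n (\<lambda>k. w ! k) = w" using w(1) by (simp add: words_def list_eq_iff_nth_eq)
  moreover have "\<forall>k<n. w ! k \<in> {1..M}" using w(1) nth_mem unfolding words_def by blast
  ultimately show "B \<in> matrix_products M A n"
    unfolding matrix_products_def using w(2) by (auto simp: matrix_product_eq_word_product intro!: exI[of _ "\<lambda>k. w ! k"])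
qed

lemma opnorm_nonneg: "0 \<le> opnorm B"
  unfolding opnorm_def by (rule onorm_pos_le) simp

lemma opnorm_mult: "opnorm (B ** C) \<le> opnorm B * opnorm C"
proof -
  have "(\<lambda>v. (B ** C) *v v) = (\<lambda>v. B *v v) \<circ> (\<lambda>v. C *v v)"
    by (auto simp: matrix_vector_mul_assoc)
  then show ?thesis unfolding opnorm_def
    by (simp only:) (rule onorm_compose; simp)
qed

lemma opnorm_eq_0_iff: "opnorm B = 0 \<longleftrightarrow> B = 0"
  unfolding opnorm_def by (subst onorm_eq_0) (auto simp: matrix_eq)

lemma opnorm_mat_1: "opnorm (mat 1 :: real^'n^'n) = 1"
proof -
  have "(\<lambda>v. (mat 1 :: real^'n^'n) *v v) = (\<lambda>v. v)" by auto
  then show ?thesis unfolding opnorm_def by (simp only: onorm_id)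
qed

lemma opnorm_le_norm: "opnorm (B :: real^'n^'n) \<le> (real CARD('n))\<^sup>2 * norm B"
proof -
  have "\<bar>B $ i $ j\<bar> \<le> norm B" for i j
    using Finite_Cartesian_Product.norm_nth_le[of "B $ i" j] Finite_Cartesian_Product.norm_nth_le[of B i] by simp
  then show ?thesis
    using onorm_le_matrix_component[of B "norm B"] by (simp add: opnorm_def power2_eq_square)
qed

lemma norm_le_opnorm: "norm (B :: real^'n^'n) \<le> (real CARD('n))\<^sup>2 * opnorm B"
proof -
  have "norm B \<le> (\<Sum>i\<in>UNIV. norm (B $ i))" unfolding norm_vec_def[of B] by (rule L2_set_le_sum) simp
  also have "\<dots> \<le> (\<Sum>i\<in>(UNIV :: 'n set). real CARD('n) * opnorm B)"
  proof (rule sum_mono)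
    fix i
    have "norm (B $ i) \<le> (\<Sum>j\<in>UNIV. \<bar>B $ i $ j\<bar>)" by (rule norm_le_l1_cart)
    also have "\<dots> \<le> (\<Sum>j\<in>(UNIV :: 'n set). opnorm B)"
      unfolding opnorm_def by (intro sum_mono matrix_component_le_onorm)
    finally show "norm (B $ i) \<le> real CARD('n) * opnorm B" by simp
  qed
  finally show ?thesis by (simp add: power2_eq_square)
qed

text \<open>
  Words formed from blocks of length \<open>n\<close>, including the empty word; their products form the monoid generated
  by the \<open>n\<close>-step products.
\<close>

definition step_words :: "nat \<Rightarrow> nat \<Rightarrow> nat list set" where
  "step_words M n = {w. w \<in> words M (length w) \<and> n dvd length w}"

text \<open>
  For \<open>y = Y x \<noteq> 0\<close> the span of the vectors \<open>A\<^sub>w y\<close> is nonzero and invariant, hence everything; a matrix \<open>X\<close>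
  vanishing on all of them would be zero.
\<close>

lemma irreducible_connects:
  fixes A :: "nat \<Rightarrow> real^'n^'n"
  assumes irr: "irreducible_matrices (word_product A ` words M n)" and X: "X \<noteq> 0" and Y: "Y \<noteq> 0"
  shows "\<exists>w\<in>step_words M n. X ** word_product A w ** Y \<noteq> 0"
proof (rule ccontr)
  assume "\<not> ?thesis"
  then have zero: "X ** word_product A w ** Y = 0" if "w \<in> step_words M n" for w using that by blast
  obtain x where x: "Y *v x \<noteq> 0" using Y by (metis matrix_eq matrix_vector_mult_0)
  define T where "T = (\<lambda>w. word_product A w *v (Y *v x)) ` step_words M n"
  have "(\<lambda>v. B *v v) ` span T \<subseteq> span T" if B: "B \<in> word_product A ` words M n" for B
  proof -
    obtain u where u: "u \<in> words M n" "B = word_product A u" using B by blast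
    have "(\<lambda>v. B *v v) ` T \<subseteq> T"
    proof
      fix y assume "y \<in> (\<lambda>v. B *v v) ` T"
      then obtain w where w: "w \<in> step_words M n" "y = B *v (word_product A w *v (Y *v x))"
        by (auto simp: T_def)
      have "w @ u \<in> step_words M n" using w(1) u(1) by (auto simp: step_words_def words_def)
      moreover have "y = word_product A (w @ u) *v (Y *v x)"
        by (simp add: w(2) u(2) word_product_append matrix_vector_mul_assoc matrix_mul_assoc)
      ultimately show "y \<in> T" unfolding T_def by blast
    qed
    then have "span ((\<lambda>v. B *v v) ` T) \<subseteq> span T" by (rule span_mono)
    then show ?thesis by (simp add: linear_span_image matrix_vector_mul_linear)
  qed
  moreover have "Y *v x \<in> T"
    unfolding T_def by (rule image_eqI[of _ _ "[]"]) (auto simp: step_words_def)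
  then have "Y *v x \<in> span T" by (rule span_base)
  then have "0 < dim (span T)"
    using x dim_eq_0[of "span T"] by auto
  ultimately have "\<not> dim (span T) < CARD('n)"
    using irr subspace_span unfolding irreducible_matrices_def by blast
  moreover have "dim (span T) \<le> CARD('n)" using dim_subset_UNIV[of "span T"] by simp
  ultimately have "dim T = DIM(real^'n)" by simp
  then have full: "span T = UNIV" by (simp only: dim_eq_full)
  have "X *v t = 0" if t: "t \<in> T" for t
  proof -
    obtain w where w: "w \<in> step_words M n" "t = word_product A w *v (Y *v x)"
      using t by (auto simp: T_def)
    have "X *v t = (X ** word_product A w ** Y) *v x"
      by (simp add: w(2) matrix_vector_mul_assoc matrix_mul_assoc)
    then show ?thesis using zero[OF w(1)] by simp
  qed
  then have "X *v t = 0" if "t \<in> span T" for t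
    using linear_eq_0_on_span[of "\<lambda>v. X *v v" T t] that by (simp add: matrix_vector_mul_linear)
  then have "X = 0" unfolding full by (simp add: matrix_eq)
  with X show False by simp
qed

lemma continuous_on_matrix_mult [continuous_intros]:
  fixes f :: "'a::topological_space \<Rightarrow> real^'n^'m" and g :: "'a \<Rightarrow> real^'k^'n"
  assumes "continuous_on S f" "continuous_on S g"
  shows "continuous_on S (\<lambda>x. f x ** g x)"
  unfolding matrix_matrix_mult_def by (intro continuous_intros assms)

lemma matrix_mult_scaleR: "(a *\<^sub>R X) ** B ** (b *\<^sub>R Y) = (a * b) *\<^sub>R (X ** B ** (Y :: real^'n^'n))"
  by (simp add: matrix_matrix_mult_def vec_eq_iff sum_distrib_left sum_distrib_right algebra_simps)

text \<open>
  Compactness of pairs of unit matrices yields finitely many words, and the minimum of the continuous function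
  \<open>\<Sum>\<^sub>w \<parallel>X A\<^sub>w Y\<parallel>\<close> gives the constant; homogeneity extends the estimate to all matrices. The argument runs in the
  Euclidean norm of matrices, which is equivalent to the operator norm.
\<close>

lemma irreducible_connecting_words:
  fixes A :: "nat \<Rightarrow> real^'n^'n"
  assumes irr: "irreducible_matrices (word_product A ` words M n)"
  obtains W c where "finite W" "W \<subseteq> step_words M n" "0 < c"
    "\<And>X Y. \<exists>w\<in>W. c * (opnorm X * opnorm Y) \<le> opnorm (X ** word_product A w ** Y)"
proof -
  let ?K = "sphere (0 :: real^'n^'n) 1 \<times> sphere (0 :: real^'n^'n) 1"
  let ?f = "\<lambda>w (Z :: (real^'n^'n) \<times> (real^'n^'n)). fst Z ** word_product A w ** snd Z"
  have K: "compact ?K" by (intro compact_Times compact_sphere)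
  have cont: "continuous_on S (?f w)" for w S by (intro continuous_intros)
  have op: "open {Z. ?f w Z \<noteq> 0}" for w
    using open_vimage[of "- {0}" "?f w"] cont[of UNIV w] by (simp add: vimage_def open_Compl)
  have cover: "?K \<subseteq> (\<Union>w\<in>step_words M n. {Z. ?f w Z \<noteq> 0})"
  proof
    fix Z assume "Z \<in> ?K"
    then have "fst Z \<noteq> 0" "snd Z \<noteq> 0" by auto
    from irreducible_connects[OF irr this] show "Z \<in> (\<Union>w\<in>step_words M n. {Z. ?f w Z \<noteq> 0})" by blast
  qed
  obtain W where W: "W \<subseteq> step_words M n" "finite W" "?K \<subseteq> (\<Union>w\<in>W. {Z. ?f w Z \<noteq> 0})"
    by (rule compactE_image[OF K op cover]) (rule that)
  obtain U :: "real^'n^'n" where U: "norm U = 1" using vector_choose_size[of 1] by auto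
  then have K_ne: "?K \<noteq> {}" by (auto intro!: exI[of _ U])
  then have W_ne: "W \<noteq> {}" using W(3) by blast
  define N where "N = real (card W)"
  have N: "N > 0" using W(2) W_ne by (simp add: N_def card_gt_0_iff)
  obtain Z0 where Z0: "Z0 \<in> ?K" "\<And>Z. Z \<in> ?K \<Longrightarrow> (\<Sum>w\<in>W. norm (?f w Z0)) \<le> (\<Sum>w\<in>W. norm (?f w Z))"
  proof -
    have "continuous_on ?K (\<lambda>Z. \<Sum>w\<in>W. norm (?f w Z))" by (intro continuous_intros)
    from continuous_attains_inf[OF K K_ne this] show ?thesis using that by blast
  qed
  define e where "e = (\<Sum>w\<in>W. norm (?f w Z0))"
  have e: "e > 0"
  proof -
    obtain w where "w \<in> W" "?f w Z0 \<noteq> 0" using Z0(1) W(3) by blast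
    then show ?thesis unfolding e_def using W(2) by (intro sum_pos2[of W w]) auto
  qed
  have "\<exists>w\<in>W. (e / N) * (norm X * norm Y) \<le> norm (X ** word_product A w ** Y)" for X Y :: "real^'n^'n"
  proof (cases "X = 0 \<or> Y = 0")
    case True
    then show ?thesis using W_ne by auto
  next
    case False
    define X' Y' where "X' = (1 / norm X) *\<^sub>R X" and "Y' = (1 / norm Y) *\<^sub>R Y"
    have "(X', Y') \<in> ?K" using False by (simp add: X'_def Y'_def)
    then have "e \<le> (\<Sum>w\<in>W. norm (X' ** word_product A w ** Y'))"
      using Z0(2)[of "(X', Y')"] by (simp add: e_def)
    have "\<exists>w\<in>W. e / N \<le> norm (X' ** word_product A w ** Y')"
    proof (rule ccontr)
      assume "\<not> ?thesis"
      then have "(\<Sum>w\<in>W. norm (X' ** word_product A w ** Y')) < (\<Sum>w\<in>W. e / N)"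
        using W(2) W_ne by (intro sum_strict_mono) auto
      also have "\<dots> = e" using N by (simp add: N_def)
      finally show False using \<open>e \<le> _\<close> by simp
    qed
    then obtain w where w: "w \<in> W" "e / N \<le> norm (X' ** word_product A w ** Y')" by blast
    have "X' ** word_product A w ** Y' = ((1 / norm X) * (1 / norm Y)) *\<^sub>R (X ** word_product A w ** Y)"
      unfolding X'_def Y'_def by (rule matrix_mult_scaleR)
    then have "norm (X' ** word_product A w ** Y') = norm (X ** word_product A w ** Y) / (norm X * norm Y)"
      by (simp add: divide_inverse mult.commute)
    then have "(e / N) * (norm X * norm Y) \<le> norm (X ** word_product A w ** Y)"
      using w(2) False by (simp add: pos_le_divide_eq)
    then show ?thesis using w(1) by blast
  qed
  note connect = this
  define q where "q = (real CARD('n))\<^sup>2"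
  have q: "q > 0" by (simp add: q_def)
  have "\<exists>w\<in>W. (e / N / q ^ 3) * (opnorm X * opnorm Y) \<le> opnorm (X ** word_product A w ** Y)"
    for X Y :: "real^'n^'n"
  proof -
    obtain w where w: "w \<in> W" "(e / N) * (norm X * norm Y) \<le> norm (X ** word_product A w ** Y)"
      using connect by blast
    have "(e / N / q ^ 3) * (opnorm X * opnorm Y) \<le> (e / N / q ^ 3) * ((q * norm X) * (q * norm Y))"
      using e N q opnorm_nonneg unfolding q_def by (intro mult_left_mono mult_mono opnorm_le_norm) auto
    also have "\<dots> = ((e / N) * (norm X * norm Y)) / q" using q by (simp add: power3_eq_cube)
    also have "\<dots> \<le> norm (X ** word_product A w ** Y) / q" using w(2) q by (intro divide_right_mono) auto
    also have "\<dots> \<le> opnorm (X ** word_product A w ** Y)"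
      using norm_le_opnorm[of "X ** word_product A w ** Y"] q by (simp add: pos_divide_le_eq q_def mult.commute)
    finally show ?thesis using w(1) by blast
  qed
  moreover have "0 < e / N / q ^ 3" using e N q by simp
  ultimately show ?thesis using that W(1,2) by blast
qed

lemma words_1_products: "word_product A ` words M 1 = A ` {1..M}"
proof -
  have "words M 1 = (\<lambda>i. [i]) ` {1..M}" by (auto simp: words_def length_Suc_conv)
  then show ?thesis by (simp add: image_image)
qed

text \<open>
  A nonzero product of length \<open>n\<close> can be joined to a nonzero letter, and initial segments of a word with nonzero
  product have nonzero products.
\<close>

lemma nonzero_words:
  fixes A :: "nat \<Rightarrow> real^'n^'n"
  assumes irr: "irreducible_matrices (A ` {1..M})" and i: "i \<in> {1..M}" "A i \<noteq> 0"
  shows "\<exists>w\<in>words M n. word_product A w \<noteq> 0"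
proof (induction n)
  case 0
  have "opnorm (mat 1 :: real^'n^'n) \<noteq> 0" by (simp add: opnorm_mat_1)
  then show ?case using opnorm_eq_0_iff by auto
next
  case (Suc n)
  then obtain u where u: "u \<in> words M n" "word_product A u \<noteq> 0" by blast
  obtain w where w: "w \<in> step_words M 1" "A i ** word_product A w ** word_product A u \<noteq> 0"
    using irreducible_connects[of A M 1 "A i" "word_product A u"] irr i(2) u(2)
    unfolding words_1_products by blast
  define v where "v = u @ w @ [i]"
  have v: "word_product A v \<noteq> 0" "set v \<subseteq> {1..M}" "length v \<ge> Suc n"
    using w u(1) i(1) by (auto simp: v_def word_product_append matrix_mul_assoc words_def step_words_def)
  have "word_product A v = word_product A (drop (Suc n) v) ** word_product A (take (Suc n) v)"
    by (simp flip: word_product_append)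
  then have "word_product A (take (Suc n) v) \<noteq> 0" using v(1) by auto
  moreover have "take (Suc n) v \<in> words M (Suc n)"
    using v by (auto simp: words_def dest: in_set_takeD)
  ultimately show ?case by blast
qed

definition norm_potential :: "(nat \<Rightarrow> real^'n^'n) \<Rightarrow> real \<Rightarrow> nat list \<Rightarrow> real" where
  "norm_potential A s w = opnorm (word_product A w) powr s"

lemma norm_potential_connecting:
  fixes A :: "nat \<Rightarrow> real^'n^'n"
  assumes irr: "irreducible_matrices (word_product A ` words M n)" and s: "s > 0"
  obtains W c where "W \<subseteq> step_words M n" "connecting W c (norm_potential A s)"
proof -
  obtain W c where W: "finite W" "W \<subseteq> step_words M n" "0 < c"
    and c: "\<And>X Y. \<exists>w\<in>W. c * (opnorm X * opnorm Y) \<le> opnorm (X ** word_product A w ** Y)"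
    by (rule irreducible_connecting_words[OF irr]) (rule that)
  let ?\<phi> = "norm_potential A s"
  have "\<exists>w\<in>W. c powr s * (?\<phi> u * ?\<phi> v) \<le> ?\<phi> (u @ w @ v)" for u v
  proof -
    let ?X = "word_product A v" and ?Y = "word_product A u"
    obtain w where w: "w \<in> W" "c * (opnorm ?X * opnorm ?Y) \<le> opnorm (?X ** word_product A w ** ?Y)"
      using c by blast
    then have "(c * (opnorm ?X * opnorm ?Y)) powr s \<le> opnorm (word_product A (u @ w @ v)) powr s"
      using s W(3) opnorm_nonneg
      by (intro powr_mono2 mult_nonneg_nonneg) (auto simp: word_product_append less_imp_le)
    then show ?thesis using w(1) W(3) opnorm_nonneg
      by (intro bexI[of _ w]) (auto simp: norm_potential_def powr_mult mult.commute)
  qed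
  then have "connecting W (c powr s) ?\<phi>" using W(1,3) by (simp add: connecting_def)
  with W(2) show ?thesis by (rule that)
qed

lemma norm_potential_append:
  "s > 0 \<Longrightarrow> norm_potential A s (u @ v) \<le> norm_potential A s u * norm_potential A s v"
  unfolding norm_potential_def word_product_append
  using powr_mono2[OF _ opnorm_nonneg opnorm_mult, of s "word_product A v" "word_product A u"] opnorm_nonneg
  by (simp add: powr_mult mult.commute)

lemma growth_rate_eq_top_lyapunov:
  assumes "invariant_measure M \<nu>"
  shows "invariant_measure.growth_rate \<nu> (\<lambda>w. opnorm (word_product A w)) = top_lyapunov A \<nu>"
  unfolding invariant_measure.growth_rate_def[OF assms] top_lyapunov_def matrix_product_eq_word_product ..

section \<open>Tail events under independence up to bounded gaps\<close>

lemma shift_vimage_add: "shift_vimage M a (shift_vimage M b Y) = shift_vimage M (b + a) Y"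
  by (auto simp: funpow_add)

context invariant_measure
begin

lemma shift_vimage_events: "Y \<in> events \<Longrightarrow> shift_vimage M k Y \<in> events"
  using shift_vimage_sets by simp

text \<open>
  Continuity in measure on both sides reduces an inequality for events to clopen sets.
\<close>

lemma clopen_approx_le:
  assumes a: "0 \<le> a" and K: "0 \<le> K"
    and clopen: "\<And>n S. a * prob (clopen M n S) \<le> g (clopen M n S)"
    and lip: "\<And>Y E. Y \<in> events \<Longrightarrow> E \<in> events \<Longrightarrow> g E \<le> g Y + K * (prob (Y - E) + prob (E - Y))"
    and Y: "Y \<in> events"
  shows "a * prob Y \<le> g Y"
proof (rule field_le_epsilon)
  fix e :: real assume e: "e > 0"
  obtain n S where nS: "prob (Y - clopen M n S) + prob (clopen M n S - Y) < e / (a + K + 1)"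
    using clopen_approximation[of Y "e / (a + K + 1)"] Y e a K by (auto simp: add_nonneg_pos)
  define E d where "E = clopen M n S" and "d = prob (Y - E) + prob (E - Y)"
  have E: "E \<in> events" by (simp add: E_def)
  have d: "(a + K) * d \<le> e"
  proof -
    have "(a + K) * d \<le> (a + K + 1) * (e / (a + K + 1))"
      using nS a K by (intro mult_mono) (auto simp: E_def d_def)
    then show ?thesis using a K by (simp add: add_nonneg_pos less_imp_neq[symmetric])
  qed
  have "prob Y \<le> prob (E \<union> (Y - E))" using E Y by (intro finite_measure_mono) auto
  also have "\<dots> \<le> prob E + prob (Y - E)" using E Y by (intro measure_Un_le) auto
  finally have "prob Y \<le> prob E + d"
    unfolding d_def using measure_nonneg[of \<nu> "E - Y"] by linarith
  then have "a * prob Y \<le> a * (prob E + d)" using a by (rule mult_left_mono)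
  also have "\<dots> \<le> g E + a * d" using clopen[of n S] by (simp add: E_def distrib_left)
  also have "\<dots> \<le> g Y + (a + K) * d" using lip[OF Y E] by (simp add: d_def distrib_right)
  finally show "a * prob Y \<le> g Y + e" using d by simp
qed

lemma prob_Int_shift_lipschitz:
  assumes U: "U \<in> events" and Y: "Y \<in> events" and E: "E \<in> events"
  shows "prob (U \<inter> shift_vimage M k E) \<le> prob (U \<inter> shift_vimage M k Y) + (prob (Y - E) + prob (E - Y))"
proof -
  note sh = shift_vimage_events[OF Y] shift_vimage_events[OF E] shift_vimage_events[OF sets.Diff[OF E Y]]
  have "prob (U \<inter> shift_vimage M k E) \<le> prob ((U \<inter> shift_vimage M k Y) \<union> shift_vimage M k (E - Y))"
    by (intro finite_measure_mono sets.Un sets.Int[OF U] sh) auto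
  also have "\<dots> \<le> prob (U \<inter> shift_vimage M k Y) + prob (shift_vimage M k (E - Y))"
    by (intro measure_Un_le sets.Int[OF U] sh)
  also have "prob (shift_vimage M k (E - Y)) = prob (E - Y)"
    using Y E by (intro measure_shift_vimage) auto
  finally show ?thesis using measure_nonneg[of \<nu> "Y - E"] by linarith
qed

text \<open>
  For at least one gap \<open>j \<in> J\<close> the words \<open>u\<close> and \<open>v\<close> occur together as often as if they were independent, up to the
  factor \<open>c\<close>; which gap it is may depend on the two words.
\<close>

definition gap_independent :: "nat \<Rightarrow> nat set \<Rightarrow> real \<Rightarrow> bool" where
  "gap_independent n J c \<longleftrightarrow> finite J \<and> (\<forall>j\<in>J. n dvd j) \<and> 0 < c \<and>
     (\<forall>l m. \<forall>u\<in>words M l. \<forall>v\<in>words M m. \<exists>j\<in>J.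
        c * (cyl_prob u * cyl_prob v) \<le> prob (cylinder M u \<inter> shift_vimage M (l + j) (cylinder M v)))"

lemma gap_independent_nonempty: "gap_independent n J c \<Longrightarrow> J \<noteq> {}"
  unfolding gap_independent_def using words_0 by blast

text \<open>
  Summing over all gaps makes the inequality additive in \<open>v\<close>, so that it extends from words to events.
\<close>

lemma gap_independent_events:
  assumes gap: "gap_independent n J c" and u: "u \<in> words M l" and Y: "Y \<in> events"
  shows "(c * cyl_prob u) * prob Y \<le> (\<Sum>j\<in>J. prob (cylinder M u \<inter> shift_vimage M (l + j) Y))"
proof (rule clopen_approx_le[where K = "real (card J)"])
  have J: "finite J" and c: "0 < c"
    and conn: "\<And>m v. v \<in> words M m \<Longrightarrow> \<exists>j\<in>J. c * (cyl_prob u * cyl_prob v)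
      \<le> prob (cylinder M u \<inter> shift_vimage M (l + j) (cylinder M v))"
    using gap u unfolding gap_independent_def by blast+
  show "0 \<le> c * cyl_prob u" using c by simp
  show "Y \<in> events" by (rule Y)
  show "(\<Sum>j\<in>J. prob (cylinder M u \<inter> shift_vimage M (l + j) E))
      \<le> (\<Sum>j\<in>J. prob (cylinder M u \<inter> shift_vimage M (l + j) Y)) + real (card J) * (prob (Y - E) + prob (E - Y))"
    if "Y \<in> events" "E \<in> events" for Y E
    using sum_mono[of J, OF prob_Int_shift_lipschitz[OF _ that, of "cylinder M u"]]
    by (simp add: sum.distrib)
  fix m S
  have "c * cyl_prob u * prob (clopen M m S) = (\<Sum>v\<in>words M m \<inter> S. c * (cyl_prob u * cyl_prob v))"
    by (simp add: prob_clopen sum_distrib_left mult.assoc)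
  also have "\<dots> \<le> (\<Sum>v\<in>words M m \<inter> S. \<Sum>j\<in>J. prob (cylinder M u \<inter> shift_vimage M (l + j) (cylinder M v)))"
  proof (rule sum_mono)
    fix v assume "v \<in> words M m \<inter> S"
    then obtain j where j: "j \<in> J" "c * (cyl_prob u * cyl_prob v)
        \<le> prob (cylinder M u \<inter> shift_vimage M (l + j) (cylinder M v))" using conn by blast
    have "prob (cylinder M u \<inter> shift_vimage M (l + j) (cylinder M v))
        \<le> (\<Sum>j\<in>J. prob (cylinder M u \<inter> shift_vimage M (l + j) (cylinder M v)))"
      by (rule member_le_sum[OF j(1)]) (use J in auto)
    with j(2) show "c * (cyl_prob u * cyl_prob v)
        \<le> (\<Sum>j\<in>J. prob (cylinder M u \<inter> shift_vimage M (l + j) (cylinder M v)))" by (rule order_trans)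
  qed
  also have "\<dots> = (\<Sum>j\<in>J. \<Sum>v\<in>words M m \<inter> S. prob (cylinder M u \<inter> shift_vimage M (l + j) (cylinder M v)))"
    by (rule sum.swap)
  also have "\<dots> = (\<Sum>j\<in>J. prob (cylinder M u \<inter> shift_vimage M (l + j) (clopen M m S)))"
    by (intro sum.cong refl measure_shift_clopen[symmetric]) (simp_all add: finite_measure_axioms)
  finally show "c * cyl_prob u * prob (clopen M m S)
      \<le> (\<Sum>j\<in>J. prob (cylinder M u \<inter> shift_vimage M (l + j) (clopen M m S)))" .
qed simp

text \<open>
  For \<open>n = 1\<close> these are the events of the tail \<open>\<sigma>\<close>-algebra; every \<open>\<sigma>\<^sup>n\<close>-invariant event is an example for general \<open>n\<close>.
\<close>

definition tail_event :: "nat \<Rightarrow> (nat \<Rightarrow> nat) set \<Rightarrow> bool" where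
  "tail_event n X \<longleftrightarrow> X \<in> events \<and> (\<forall>l. \<exists>Y\<in>events. X = shift_vimage M (l * n) Y)"

text \<open>
  Write \<open>X = \<sigma>\<^bsup>-|u|\<^esup>Y\<close> with \<open>\<mu> Y = \<mu> X\<close>. Independence of \<open>u\<close> and \<open>Y\<close> up to a gap then says that the union \<open>V\<close> of
  the sets \<open>\<sigma>\<^bsup>-j\<^esup>X\<close> occupies a proportion of the cylinder of \<open>u\<close> that is bounded below independently of \<open>u\<close>. By
  approximation the same holds for every event in place of the cylinder, in particular for the complement
  of \<open>V\<close>, which is therefore null.
\<close>

theorem tail_event_translates_cover:
  assumes gap: "gap_independent n J c" and n: "n \<ge> 1" and tail: "tail_event n X" and X: "prob X > 0"
  shows "prob (\<Union>j\<in>J. shift_vimage M j X) = 1"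
proof -
  define V where "V = (\<Union>j\<in>J. shift_vimage M j X)"
  have J: "finite J" "J \<noteq> {}" and c: "0 < c"
    using gap gap_independent_nonempty by (auto simp: gap_independent_def)
  have XM: "X \<in> events" using tail by (simp add: tail_event_def)
  have sX: "shift_vimage M j X \<in> events" for j using shift_vimage_sets XM by simp
  have V: "V \<in> events" unfolding V_def using J(1) sX by (intro sets.finite_UN) auto
  have word: "c * prob X * cyl_prob u \<le> real (card J) * prob (cylinder M u \<inter> V)" if u: "u \<in> words M (l * n)" for u l
  proof -
    obtain Y where Y: "Y \<in> events" "X = shift_vimage M (l * n) Y"
      using tail unfolding tail_event_def by blast
    have "prob Y = prob X" unfolding Y(2) using Y(1) by (simp add: measure_shift_vimage)
    then have "c * prob X * cyl_prob u = (c * cyl_prob u) * prob Y" by simp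
    also have "\<dots> \<le> (\<Sum>j\<in>J. prob (cylinder M u \<inter> shift_vimage M (l * n + j) Y))"
      by (rule gap_independent_events[OF gap u Y(1)])
    also have "\<dots> = (\<Sum>j\<in>J. prob (cylinder M u \<inter> shift_vimage M j X))"
      unfolding Y(2) shift_vimage_add ..
    also have "\<dots> \<le> (\<Sum>j\<in>J. prob (cylinder M u \<inter> V))"
      using V by (intro sum_mono finite_measure_mono sets.Int) (auto simp: V_def)
    finally show ?thesis by simp
  qed
  have "c * prob X * prob (space \<nu> - V) \<le> real (card J) * prob ((space \<nu> - V) \<inter> V)"
  proof (rule clopen_approx_le[where K = "real (card J)"])
    fix m S
    have "m \<le> m * n" using n by simp
    then obtain S' where S': "clopen M m S = clopen M (m * n) S'" using clopen_lift by metis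
    have "c * prob X * prob (clopen M (m * n) S') = (\<Sum>u\<in>words M (m * n) \<inter> S'. c * prob X * cyl_prob u)"
      by (simp add: prob_clopen sum_distrib_left)
    also have "\<dots> \<le> (\<Sum>u\<in>words M (m * n) \<inter> S'. real (card J) * prob (cylinder M u \<inter> V))"
      using word by (intro sum_mono) auto
    also have "\<dots> = real (card J) * prob (clopen M (m * n) S' \<inter> V)"
      using measure_clopen[of \<nu> M V "m * n" S'] V finite_measure_axioms
      by (simp add: sum_distrib_left Int_commute)
    finally show "c * prob X * prob (clopen M m S) \<le> real (card J) * prob (clopen M m S \<inter> V)"
      unfolding S' .
  next
    fix Y E assume YE: "Y \<in> events" "E \<in> events"
    have "prob (E \<inter> V) \<le> prob (Y \<inter> V) + (prob (Y - E) + prob (E - Y))"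
    proof -
      have "prob (E \<inter> V) \<le> prob ((Y \<inter> V) \<union> (E - Y))"
        using YE V by (intro finite_measure_mono) auto
      also have "\<dots> \<le> prob (Y \<inter> V) + prob (E - Y)" using YE V by (intro measure_Un_le) auto
      finally show ?thesis using measure_nonneg[of \<nu> "Y - E"] by linarith
    qed
    then have "real (card J) * prob (E \<inter> V) \<le> real (card J) * (prob (Y \<inter> V) + (prob (Y - E) + prob (E - Y)))"
      by (rule mult_left_mono) simp
    then show "real (card J) * prob (E \<inter> V) \<le> real (card J) * prob (Y \<inter> V) + real (card J) * (prob (Y - E) + prob (E - Y))"
      by (simp only: distrib_left)
  next
    show "space \<nu> - V \<in> events" using V by (rule sets.compl_sets)
  qed (use c in auto)
  moreover have "(space \<nu> - V) \<inter> V = {}" by blast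
  ultimately have "c * prob X * prob (space \<nu> - V) \<le> 0" by (metis measure_empty mult_zero_right)
  then have "prob (space \<nu> - V) \<le> 0" using c X by (simp add: mult_le_0_iff)
  then have "prob V = 1" using prob_compl[OF V] measure_nonneg[of \<nu> "space \<nu> - V"] by linarith
  then show ?thesis by (simp add: V_def)
qed

theorem gap_independent_imp_ergodic:
  assumes gap: "gap_independent n J c" and n: "n \<ge> 1"
  shows "ergodic \<nu> (left_shift ^^ n)"
  unfolding ergodic_def
proof (intro ballI impI)
  fix X assume X: "X \<in> events" and inv: "(left_shift ^^ n) -` X \<inter> space \<nu> = X"
  have power: "shift_vimage M (l * n) X = X" for l
  proof (induction l)
    case 0
    then show ?case using sets.sets_into_space[OF X] by auto
  next
    case (Suc l)
    have "shift_vimage M (Suc l * n) X = shift_vimage M n (shift_vimage M (l * n) X)"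
      by (simp only: shift_vimage_add mult_Suc add.commute)
    also have "\<dots> = X" unfolding Suc.IH using inv by simp
    finally show ?case .
  qed
  show "prob X = 0 \<or> prob X = 1"
  proof (cases "prob X = 0")
    case False
    then have pos: "prob X > 0" using measure_nonneg[of \<nu> X] by linarith
    have "tail_event n X" unfolding tail_event_def using X power by metis
    from tail_event_translates_cover[OF gap n this pos]
    have "prob (\<Union>j\<in>J. shift_vimage M j X) = 1" .
    moreover have "shift_vimage M j X = X" if j: "j \<in> J" for j
    proof -
      have "n dvd j" using gap j unfolding gap_independent_def by blast
      then obtain l where "j = n * l" by (rule dvdE)
      then show ?thesis using power[of l] by (simp only: mult.commute)
    qed
    then have "(\<Union>j\<in>J. shift_vimage M j X) = X" using gap_independent_nonempty[OF gap] by auto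
    ultimately show ?thesis by simp
  qed simp
qed

lemma tail_event_events: "tail_event n X \<Longrightarrow> X \<in> events"
  by (simp add: tail_event_def)

lemma tail_event_Diff: "tail_event n X \<Longrightarrow> tail_event n Y \<Longrightarrow> tail_event n (X - Y)"
  unfolding tail_event_def
proof (intro conjI allI; elim conjE)
  fix l assume "\<forall>l. \<exists>Z\<in>events. X = shift_vimage M (l * n) Z" "\<forall>l. \<exists>Z\<in>events. Y = shift_vimage M (l * n) Z"
  then obtain Z Z' where "Z \<in> events" "Z' \<in> events" "X = shift_vimage M (l * n) Z" "Y = shift_vimage M (l * n) Z'"
    by meson
  then show "\<exists>Z\<in>events. X - Y = shift_vimage M (l * n) Z" by (intro bexI[of _ "Z - Z'"]) auto
qed auto

lemma tail_event_Int: "tail_event n X \<Longrightarrow> tail_event n Y \<Longrightarrow> tail_event n (X \<inter> Y)"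
  using tail_event_Diff[OF _ tail_event_Diff, of n X X Y] by (simp add: Diff_Diff_Int)

lemma tail_event_space: "tail_event n (full_shift M)"
proof -
  have "full_shift M \<in> events" using sets.top[of \<nu>] by simp
  moreover have "full_shift M = shift_vimage M k (full_shift M)" for k by auto
  ultimately show ?thesis unfolding tail_event_def by blast
qed

lemma tail_event_shift:
  assumes "tail_event n X"
  shows "tail_event n (shift_vimage M k X)"
  unfolding tail_event_def
proof (intro conjI allI)
  show "shift_vimage M k X \<in> events" using assms shift_vimage_sets by (simp add: tail_event_def)
  fix l
  obtain Z where "Z \<in> events" "X = shift_vimage M (l * n) Z"
    using assms unfolding tail_event_def by blast
  then show "\<exists>Z\<in>events. shift_vimage M k X = shift_vimage M (l * n) Z"
    using shift_vimage_events[of Z k]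
    by (intro bexI[of _ "shift_vimage M k Z"]) (simp_all only: shift_vimage_add add.commute)
qed

text \<open>
  The union of all preimages of \<open>X\<close> exceeds the union of all proper preimages by a null set, since the second is
  a preimage of the first.
\<close>

lemma poincare_recurrence:
  assumes X: "X \<in> events" "prob X > 0"
  shows "\<exists>j\<ge>1. prob (X \<inter> shift_vimage M j X) > 0"
proof (rule ccontr)
  assume "\<not> ?thesis"
  then have null: "prob (X \<inter> shift_vimage M j X) = 0" if "j \<ge> 1" for j
    using that measure_nonneg[of \<nu> "X \<inter> shift_vimage M j X"] by (metis less_le)
  have sX: "shift_vimage M j X \<in> events" for j using shift_vimage_sets X by simp
  define V where "V = (\<Union>j. shift_vimage M j X)"
  have V: "V \<in> events" unfolding V_def using sX by (intro sets.countable_UN) auto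
  define V1 where "V1 = shift_vimage M 1 V"
  have V1: "V1 \<in> events" unfolding V1_def by (rule shift_vimage_events[OF V])
  have V1_eq: "V1 = (\<Union>j. shift_vimage M (Suc j) X)"
  proof -
    have "V1 = (\<Union>j. shift_vimage M 1 (shift_vimage M j X))" unfolding V1_def V_def by blast
    then show ?thesis by (simp only: shift_vimage_add Suc_eq_plus1)
  qed
  have sub: "V1 \<subseteq> V" unfolding V1_eq V_def by blast
  have "prob V1 = prob V" unfolding V1_def using V by (intro measure_shift_vimage) simp
  then have diff: "prob (V - V1) = 0" using finite_measure_Diff[OF V V1 sub] by simp
  have X_V1: "X \<inter> V1 = (\<Union>j. X \<inter> shift_vimage M (Suc j) X)" unfolding V1_eq by blast
  have "X \<inter> shift_vimage M (Suc j) X \<in> null_sets \<nu>" for j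
    using null[of "Suc j"] X sX[of "Suc j"] by (intro null_setsI) (auto simp: emeasure_eq_measure)
  then have "X \<inter> V1 \<in> null_sets \<nu>" unfolding X_V1 by (intro null_sets_UN') auto
  then have "prob (X \<inter> V1) = 0" by (simp add: measure_eq_0_null_sets)
  moreover have "X \<subseteq> (X \<inter> V1) \<union> (V - V1)"
  proof -
    have "X \<subseteq> shift_vimage M 0 X" using sets.sets_into_space[OF X(1)] by auto
    then show ?thesis unfolding V_def by blast
  qed
  then have "prob X \<le> prob ((X \<inter> V1) \<union> (V - V1))" using X V V1 by (intro finite_measure_mono) auto
  moreover have "\<dots> \<le> prob (X \<inter> V1) + prob (V - V1)" using X V V1 by (intro measure_Un_le) auto
  ultimately show False using X(2) diff by linarith
qed

text \<open>
  The upper limit of the preimages of \<open>X\<close> is strictly invariant and differs from \<open>X\<close> by a null set.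
\<close>

lemma almost_invariant_trivial:
  assumes erg: "ergodic \<nu> (left_shift ^^ j)" and X: "X \<in> events"
    and inv: "prob (X - shift_vimage M j X) = 0" "prob (shift_vimage M j X - X) = 0"
  shows "prob X = 0 \<or> prob X = 1"
proof -
  define s where "s n = shift_vimage M (n * j) X" for n
  have sX: "s n \<in> events" for n unfolding s_def by (rule shift_vimage_events[OF X])
  define X' where "X' = (\<Inter>N. \<Union>n\<in>{N..}. s n)"
  have X': "X' \<in> events" 
  proof -
    have "(\<Union>n\<in>{N..}. s n) \<in> events" for N
      by (rule sets.countable_UN') (use sX in blast)+
    then show ?thesis unfolding X'_def by (intro sets.countable_INT) (blast | simp)+
  qed
  have shift: "shift_vimage M j (s n) = s (Suc n)" for n
    unfolding s_def by (simp only: shift_vimage_add mult_Suc add.commute)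
  have X'_inv: "shift_vimage M j X' = X'"
  proof (rule set_eqI)
    fix x
    have "x \<in> shift_vimage M j X' \<longleftrightarrow> (\<forall>N. \<exists>n\<ge>N. x \<in> shift_vimage M j (s n))"
    proof (cases "x \<in> full_shift M")
      case True
      then show ?thesis unfolding X'_def by auto
    next
      case False
      then show ?thesis by auto
    qed
    also have "\<dots> \<longleftrightarrow> (\<forall>N. \<exists>n\<ge>N. x \<in> s (Suc n))" unfolding shift by (rule refl)
    also have "\<dots> \<longleftrightarrow> (\<forall>N. \<exists>n\<ge>N. x \<in> s n)"
    proof (intro iffI allI)
      fix N assume "\<forall>N. \<exists>n\<ge>N. x \<in> s (Suc n)"
      then show "\<exists>n\<ge>N. x \<in> s n" using le_SucI by blast
    next
      fix N assume "\<forall>N. \<exists>n\<ge>N. x \<in> s n"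
      then obtain n where "n \<ge> Suc N" "x \<in> s n" by blast
      then show "\<exists>n\<ge>N. x \<in> s (Suc n)" by (intro exI[of _ "n - 1"]) auto
    qed
    also have "\<dots> \<longleftrightarrow> x \<in> X'" unfolding X'_def by auto
    finally show "x \<in> shift_vimage M j X' \<longleftrightarrow> x \<in> X'" .
  qed
  have step: "AE x in \<nu>. x \<in> s n \<longleftrightarrow> x \<in> s (Suc n)" for n
  proof -
    have eq: "s (Suc n) = shift_vimage M (n * j) (shift_vimage M j X)"
      unfolding s_def by (simp only: shift_vimage_add mult_Suc add.commute)
    have sj: "shift_vimage M j X \<in> events" by (rule shift_vimage_events[OF X])
    have "s n - s (Suc n) = shift_vimage M (n * j) (X - shift_vimage M j X)"
      unfolding eq unfolding s_def by blast
    then have "prob (s n - s (Suc n)) = prob (X - shift_vimage M j X)"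
      using X sj by (simp only:) (rule measure_shift_vimage, simp)
    then have 1: "s n - s (Suc n) \<in> null_sets \<nu>"
      using sX inv(1) by (intro null_setsI) (auto simp: emeasure_eq_measure)
    have "s (Suc n) - s n = shift_vimage M (n * j) (shift_vimage M j X - X)"
      unfolding eq unfolding s_def by blast
    then have "prob (s (Suc n) - s n) = prob (shift_vimage M j X - X)"
      using X sj by (simp only:) (rule measure_shift_vimage, simp)
    then have 2: "s (Suc n) - s n \<in> null_sets \<nu>"
      using sX inv(2) by (intro null_setsI) (auto simp: emeasure_eq_measure)
    show ?thesis using AE_not_in[OF 1] AE_not_in[OF 2] by eventually_elim blast
  qed
  have "AE x in \<nu>. \<forall>n. x \<in> s n \<longleftrightarrow> x \<in> s (Suc n)" using step by (simp add: AE_all_countable)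
  then have "AE x in \<nu>. x \<in> X' \<longleftrightarrow> x \<in> X"
    using AE_space
  proof eventually_elim
    case (elim x)
    have "x \<in> s n \<longleftrightarrow> x \<in> X" for n
    proof (induction n)
      case 0
      then show ?case using elim(2) by (simp add: s_def)
    next
      case (Suc n)
      then show ?case using elim(1) by blast
    qed
    then show ?case unfolding X'_def by auto
  qed
  then have "prob X' = prob X" using X X' by (intro measure_eq_AE)
  moreover have "prob X' = 0 \<or> prob X' = 1"
    using erg X' X'_inv unfolding ergodic_def by simp
  ultimately show ?thesis by simp
qed

text \<open>
  A tail event \<open>B\<close> whose measure is less than twice the infimum \<open>p\<close> of the positive measures of tail events is
  an atom. By recurrence it coincides up to a null set with some \<open>\<sigma>\<^bsup>-j\<^esup>B\<close>, so by total ergodicity it has full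
  measure. Thus \<open>p > 1/2\<close>, and a tail event and its complement cannot both have positive measure.
\<close>

theorem totally_ergodic_tail_trivial:
  assumes gap: "gap_independent 1 J c" and erg: "totally_ergodic \<nu> left_shift"
    and X: "tail_event 1 X"
  shows "prob X = 0 \<or> prob X = 1"
proof -
  define T where "T = {prob Y | Y. tail_event 1 Y \<and> prob Y > 0}"
  have J: "finite J" "J \<noteq> {}"
    using gap gap_independent_nonempty by (auto simp: gap_independent_def)
  have low: "1 / real (card J) \<le> t" if t: "t \<in> T" for t
  proof -
    obtain Y where Y: "tail_event 1 Y" "prob Y > 0" "t = prob Y" using t unfolding T_def by blast
    have "1 = prob (\<Union>j\<in>J. shift_vimage M j Y)"
      using tail_event_translates_cover[OF gap _ Y(1,2)] by simp
    also have "\<dots> \<le> (\<Sum>j\<in>J. prob (shift_vimage M j Y))"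
      using J(1) tail_event_events[OF Y(1)] shift_vimage_sets by (intro measure_UNION_le) auto
    also have "\<dots> = real (card J) * t"
      using tail_event_events[OF Y(1)] by (simp add: measure_shift_vimage Y(3))
    finally show ?thesis using J by (simp add: pos_divide_le_eq mult.commute card_gt_0_iff)
  qed
  have ne: "T \<noteq> {}" unfolding T_def using tail_event_space prob_space by force
  have bdd: "bdd_below T" using low by (intro bdd_belowI)
  \<comment> \<open>The lower bound for members of \<open>T\<close> makes \<open>p\<close> positive, which is what produces an atom.\<close>
  define p where "p = Inf T"
  have "1 / real (card J) \<le> p" unfolding p_def using ne low by (intro cInf_greatest)
  then have p: "p > 0" using J by (metis card_gt_0_iff less_le_trans of_nat_0_less_iff zero_less_divide_1_iff)
  have p_le: "p \<le> prob Y" if "tail_event 1 Y" "prob Y > 0" for Y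
    unfolding p_def using that bdd by (intro cInf_lower) (auto simp: T_def)
  have "Inf T < 2 * p" using p by (simp add: p_def)
  then obtain t where "t \<in> T" "t < 2 * p" using cInf_lessD[OF ne] by blast
  then obtain B where B: "tail_event 1 B" "prob B > 0" "prob B < 2 * p" by (auto simp: T_def)
  note BM = tail_event_events[OF B(1)]
  obtain j where j: "j \<ge> 1" "prob (B \<inter> shift_vimage M j B) > 0" using poincare_recurrence[OF BM B(2)] by blast
  let ?B' = "shift_vimage M j B"
  have B': "tail_event 1 ?B'" by (rule tail_event_shift[OF B(1)])
  note BM' = tail_event_events[OF B']
  have split: "prob (B - ?B') = prob B - prob (B \<inter> ?B')" by (rule finite_measure_Diff'[OF BM BM'])
  have "prob (B - ?B') = 0"
  proof (rule ccontr)
    assume "prob (B - ?B') \<noteq> 0"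
    then have "prob (B - ?B') > 0" using measure_nonneg[of \<nu> "B - ?B'"] by linarith
    then have "p \<le> prob (B - ?B')" by (rule p_le[OF tail_event_Diff[OF B(1) B']])
    moreover have "p \<le> prob (B \<inter> ?B')" using j(2) by (rule p_le[OF tail_event_Int[OF B(1) B']])
    ultimately show False using split B(3) by linarith
  qed
  moreover have "prob (?B' - B) = prob ?B' - prob (?B' \<inter> B)" by (rule finite_measure_Diff'[OF BM' BM])
  moreover have "prob ?B' = prob B" using BM by (simp add: measure_shift_vimage)
  ultimately have "prob (?B' - B) = 0" using split by (simp add: Int_commute)
  then have "prob B = 1"
    using almost_invariant_trivial[OF _ BM \<open>prob (B - ?B') = 0\<close>] erg j(1) B(2)
    by (auto simp: totally_ergodic_def)
  then have half: "p > 1 / 2" using B(3) by simp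
  show ?thesis
  proof (rule ccontr)
    assume not: "\<not> ?thesis"
    have XM: "X \<in> events" by (rule tail_event_events[OF X])
    have "prob X > 0" "prob X < 1" using not measure_nonneg[of \<nu> X] prob_le_1[of X] by linarith+
    moreover have "prob (full_shift M - X) = 1 - prob X" using prob_compl[OF XM] by simp
    ultimately have "p \<le> prob X" "p \<le> prob (full_shift M - X)"
      using p_le[OF X] p_le[OF tail_event_Diff[OF tail_event_space X]] by auto
    then show False using half \<open>prob (full_shift M - X) = 1 - prob X\<close> by linarith
  qed
qed

end

section \<open>Trivial tails and mixing\<close>

context prob_space
begin

text \<open>
  The covariance of the two indicator functions. As a function of \<open>A\<close> it is a signed measure of total mass zero.
\<close>

definition covariance :: "'a set \<Rightarrow> 'a set \<Rightarrow> real" where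
  "covariance X A = prob (X \<inter> A) - prob X * prob A"

lemma covariance_modular:
  assumes "X \<in> events" "A \<in> events" "B \<in> events"
  shows "covariance X (A \<union> B) + covariance X (A \<inter> B) = covariance X A + covariance X B"
proof -
  have modular: "prob (C \<union> E) + prob (C \<inter> E) = prob C + prob E" if "C \<in> events" "E \<in> events" for C E
    using finite_measure_Union'[OF that] finite_measure_Diff'[OF that(2,1)] by (simp add: Int_commute)
  have "X \<inter> (A \<union> B) = (X \<inter> A) \<union> (X \<inter> B)" "X \<inter> (A \<inter> B) = (X \<inter> A) \<inter> (X \<inter> B)" by auto
  then have "prob (X \<inter> (A \<union> B)) + prob (X \<inter> (A \<inter> B)) = prob (X \<inter> A) + prob (X \<inter> B)"
    using modular[of "X \<inter> A" "X \<inter> B"] assms by auto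
  moreover have "prob X * prob (A \<union> B) + prob X * prob (A \<inter> B) = prob X * prob A + prob X * prob B"
    using modular[OF assms(2,3)] by (simp flip: distrib_left)
  ultimately show ?thesis unfolding covariance_def by linarith
qed

lemma covariance_incseq:
  assumes "X \<in> events" "range A \<subseteq> events" "incseq A"
  shows "(\<lambda>n. covariance X (A n)) \<longlonglongrightarrow> covariance X (\<Union>n. A n)"
proof -
  have "(\<lambda>n. prob (X \<inter> A n)) \<longlonglongrightarrow> prob (\<Union>n. X \<inter> A n)"
    using assms by (intro finite_Lim_measure_incseq) (auto simp: incseq_def)
  moreover have "(\<lambda>n. prob (A n)) \<longlonglongrightarrow> prob (\<Union>n. A n)"
    using assms by (intro finite_Lim_measure_incseq)
  ultimately show ?thesis unfolding covariance_def Int_UN_distrib by (intro tendsto_intros)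
qed

lemma covariance_decseq:
  assumes "X \<in> events" "range A \<subseteq> events" "decseq A"
  shows "(\<lambda>n. covariance X (A n)) \<longlonglongrightarrow> covariance X (\<Inter>n. A n)"
proof -
  have "(\<lambda>n. prob (X \<inter> A n)) \<longlonglongrightarrow> prob (\<Inter>n. X \<inter> A n)"
    using assms by (intro finite_Lim_measure_decseq) (auto simp: decseq_def)
  moreover have "(\<lambda>n. prob (A n)) \<longlonglongrightarrow> prob (\<Inter>n. A n)"
    using assms by (intro finite_Lim_measure_decseq)
  moreover have "(\<Inter>n. X \<inter> A n) = X \<inter> (\<Inter>n. A n)" by auto
  ultimately show ?thesis unfolding covariance_def by (simp only:) (intro tendsto_intros)
qed

lemma covariance_trivial:
  assumes "X \<in> events" "A \<in> events" "prob A = 0 \<or> prob A = 1"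
  shows "covariance X A = 0"
  using assms(3)
proof
  assume "prob A = 0"
  then show ?thesis
    using finite_measure_mono[of "X \<inter> A" A] assms measure_nonneg[of M "X \<inter> A"] by (simp add: covariance_def)
next
  assume "prob A = 1"
  then have "prob (X \<inter> A) = prob X"
    using prob_compl[OF assms(2)] finite_measure_Diff'[OF assms(1,2)]
      finite_measure_mono[of "X - A" "space M - A"] sets.sets_into_space[OF assms(1)] assms(1,2)
      measure_nonneg[of M "X - A"] by (simp add: Diff_mono)
  with \<open>prob A = 1\<close> show ?thesis by (simp add: covariance_def)
qed

text \<open>
  Let \<open>\<delta> n\<close> be the supremum of the covariances of \<open>X\<close> with events of \<open>F n\<close>; it decreases to some \<open>d \<ge> 0\<close>. Take \<open>Z k\<close> in
  \<open>F k\<close> with covariance above \<open>\<delta> k - 2\<^bsup>-k\<^esup>\<close>. As in the proof of the Hahn decomposition, modularity shows that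
  adjoining \<open>Z k\<close> to an event of \<open>F (k + 1)\<close> costs at most \<open>2\<^bsup>-k\<^esup>\<close>, because the intersection lies in \<open>F k\<close> and has
  covariance at most \<open>\<delta> k\<close>. Hence the upper limit of the \<open>Z k\<close> has covariance at least \<open>d\<close>. It belongs to all
  \<open>F n\<close>, so it is trivial and has covariance zero.
\<close>

lemma decreasing_algebras_asymptotic_independence:
  fixes F :: "nat \<Rightarrow> 'a measure"
  assumes sub: "\<And>n. subalgebra M (F n)" and dec: "\<And>n m. n \<le> m \<Longrightarrow> sets (F m) \<subseteq> sets (F n)"
    and triv: "\<And>A. (\<And>n. A \<in> sets (F n)) \<Longrightarrow> prob A = 0 \<or> prob A = 1"
    and X: "X \<in> events" and A: "\<And>n. A n \<in> sets (F n)"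
  shows "(\<lambda>n. prob (X \<inter> A n) - prob X * prob (A n)) \<longlonglongrightarrow> 0"
proof -
  let ?D = "covariance X"
  have ev: "B \<in> events" if "B \<in> sets (F n)" for B n
    using that sub[of n] by (auto simp: subalgebra_def)
  have D_le_1: "?D B \<le> 1" for B
    unfolding covariance_def using prob_le_1[of "X \<inter> B"] by (simp add: add_increasing2 diff_le_eq)
  define \<delta> where "\<delta> n = Sup (?D ` sets (F n))" for n
  have bdd: "bdd_above (?D ` sets (F n))" for n using D_le_1 by (intro bdd_aboveI[of _ 1]) auto
  have D_le: "?D B \<le> \<delta> n" if "B \<in> sets (F n)" for B n
    unfolding \<delta>_def using that bdd by (intro cSUP_upper)
  have "?D {} = 0" by (simp add: covariance_def)
  then have \<delta>_nonneg: "0 \<le> \<delta> n" for n using D_le[of "{}" n] by simp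
  have "decseq \<delta>"
    unfolding decseq_def \<delta>_def using dec bdd by (intro allI impI cSUP_subset_mono) auto
  then obtain d where d: "\<delta> \<longlonglongrightarrow> d" "\<And>n. d \<le> \<delta> n"
    using decseq_convergent[of \<delta> 0] \<delta>_nonneg by auto
  have "\<exists>B\<in>sets (F k). \<delta> k - (1 / 2) ^ k < ?D B" for k
  proof -
    have "\<delta> k - (1 / 2) ^ k < Sup (?D ` sets (F k))" by (simp add: \<delta>_def)
    then show ?thesis using bdd by (subst (asm) less_cSUP_iff) auto
  qed
  then obtain Z where Z: "\<And>k. Z k \<in> sets (F k)" "\<And>k. \<delta> k - (1 / 2) ^ k < ?D (Z k)" by metis
  have ZF: "Z k \<in> sets (F n)" if "n \<le> k" for n k using Z(1) dec[OF that] by blast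
  have unions: "d - 2 * (1 / 2) ^ N \<le> ?D (\<Union>k\<in>{N..N + j}. Z k)" for N j
  proof (induction j arbitrary: N)
    case 0
    have "d - 2 * (1 / 2) ^ N \<le> \<delta> N - (1 / 2) ^ N"
      using d(2)[of N] zero_le_power[of "1 / 2 :: real" N] by linarith
    then show ?case using Z(2)[of N] by simp
  next
    case (Suc j)
    let ?U = "\<Union>k\<in>{Suc N..Suc N + j}. Z k"
    have U: "?U \<in> sets (F N)" using ZF by (intro sets.finite_UN) auto
    have "{N..N + Suc j} = insert N {Suc N..Suc N + j}" by auto
    then have "(\<Union>k\<in>{N..N + Suc j}. Z k) = Z N \<union> ?U" by simp
    moreover have "?D (Z N \<union> ?U) + ?D (Z N \<inter> ?U) = ?D (Z N) + ?D ?U"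
      by (rule covariance_modular[OF X ev[OF Z(1)] ev[OF U]])
    moreover have "?D (Z N \<inter> ?U) \<le> \<delta> N" using Z(1) U by (intro D_le sets.Int)
    moreover have "d - 2 * (1 / 2) ^ Suc N \<le> ?D ?U" by (rule Suc.IH)
    ultimately show ?case using Z(2)[of N] by simp
  qed
  define V where "V N = (\<Union>j. \<Union>k\<in>{N..N + j}. Z k)" for N
  have VF: "V N \<in> sets (F n)" if "n \<le> N" for n N
    unfolding V_def using that ZF by (intro sets.countable_UN image_subsetI sets.finite_UN) auto
  have V_low: "d - 2 * (1 / 2) ^ N \<le> ?D (V N)" for N
  proof (rule LIMSEQ_le_const)
    show "(\<lambda>j. ?D (\<Union>k\<in>{N..N + j}. Z k)) \<longlonglongrightarrow> ?D (V N)"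
      unfolding V_def using ZF[of N] ev[of _ N]
      by (intro covariance_incseq X) (fastforce simp: incseq_def intro!: sets.finite_UN)+
  qed (use unions in blast)
  have V_eq: "V N = (\<Union>k\<in>{N..}. Z k)" for N
    unfolding V_def by (auto simp: Bex_def) (metis le_add_diff_inverse order_refl)
  have V_dec: "decseq V" unfolding decseq_def V_eq by force
  have "?D (\<Inter>N. V N) = 0"
  proof (rule covariance_trivial[OF X])
    have "(\<Inter>N. V N) \<in> sets (F n)" for n
    proof -
      have "(\<Inter>N. V N) = (\<Inter>N. V (N + n))"
        using V_dec unfolding decseq_def by (auto dest: le_add1[THEN subsetD[OF V_dec[unfolded decseq_def, rule_format]]])
      then show ?thesis using VF[of n] by (simp add: sets.countable_INT image_subset_iff)
    qed
    then show "(\<Inter>N. V N) \<in> events" "prob (\<Inter>N. V N) = 0 \<or> prob (\<Inter>N. V N) = 1"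
      using ev triv by blast+
  qed
  moreover have "(\<lambda>N. ?D (V N)) \<longlonglongrightarrow> ?D (\<Inter>N. V N)"
    using VF[OF order_refl] ev by (intro covariance_decseq X V_dec) blast
  moreover have "(\<lambda>N. d - 2 * (1 / 2) ^ N) \<longlonglongrightarrow> d - 2 * 0"
    by (intro tendsto_intros LIMSEQ_power_zero) simp
  ultimately have "d \<le> 0" using V_low LIMSEQ_le[of _ "d - 2 * 0" _ 0] by auto
  moreover have "0 \<le> d" using d(1) \<delta>_nonneg by (intro LIMSEQ_le_const) auto
  ultimately have \<delta>_0: "\<delta> \<longlonglongrightarrow> 0" using d(1) by simp
  have "\<bar>?D (A n)\<bar> \<le> \<delta> n" for n
  proof -
    have compl: "space M - A n \<in> sets (F n)" using sets.compl_sets[OF A, of n] sub[of n] by (simp add: subalgebra_def)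
    have An: "A n \<in> events" using ev[OF A] .
    have "?D (A n) + ?D (space M - A n) = ?D (space M) + ?D {}"
      using covariance_modular[OF X An ev[OF compl]] sets.sets_into_space[OF An] by (simp add: Un_absorb1 Diff_partition)
    moreover have "?D (space M) = 0" using prob_space by (intro covariance_trivial X) auto
    ultimately show ?thesis using D_le[OF A, of n] D_le[OF compl] \<open>?D {} = 0\<close> by linarith
  qed
  then have "(\<lambda>n. ?D (A n)) \<longlonglongrightarrow> 0"
    by (intro Lim_null_comparison[OF _ \<delta>_0]) simp
  then show ?thesis by (simp add: covariance_def)
qed

end

context invariant_measure
begin

theorem tail_trivial_imp_mixing:
  assumes triv: "\<And>X. tail_event 1 X \<Longrightarrow> prob X = 0 \<or> prob X = 1"
  shows "mixing \<nu> left_shift"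
  unfolding mixing_def
proof (intro ballI)
  fix X Y assume X: "X \<in> events" and Y: "Y \<in> events"
  define F where "F n = vimage_algebra (full_shift M) (left_shift ^^ n) \<nu>" for n
  have sF: "sets (F n) = {shift_vimage M n A | A. A \<in> events}" for n
    unfolding F_def by (rule sets_vimage_algebra2) auto
  have sub: "subalgebra \<nu> (F n)" for n
    using shift_vimage_events unfolding subalgebra_def sF by (auto simp: F_def)
  have dec: "sets (F m) \<subseteq> sets (F n)" if "n \<le> m" for n m
  proof
    fix B assume "B \<in> sets (F m)"
    then obtain A where A: "A \<in> events" "B = shift_vimage M m A" unfolding sF by blast
    then have "B = shift_vimage M n (shift_vimage M (m - n) A)" using that by (simp only: shift_vimage_add) simp
    then show "B \<in> sets (F n)" unfolding sF using shift_vimage_events[OF A(1)] by blast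
  qed
  have tail: "prob A = 0 \<or> prob A = 1" if A: "\<And>n. A \<in> sets (F n)" for A
  proof (rule triv)
    have "A \<in> events" using A[of 0] sub[of 0] unfolding subalgebra_def by blast
    then show "tail_event 1 A" using A unfolding tail_event_def sF by fastforce
  qed
  have "shift_vimage M n Y \<in> sets (F n)" for n unfolding sF using Y by blast
  from decreasing_algebras_asymptotic_independence[OF sub dec tail X this]
  have "(\<lambda>n. prob (X \<inter> shift_vimage M n Y) - prob X * prob Y) \<longlonglongrightarrow> 0"
    using Y by (simp add: measure_shift_vimage)
  then have "(\<lambda>n. prob (X \<inter> shift_vimage M n Y)) \<longlonglongrightarrow> prob X * prob Y" by (rule LIM_zero_cancel)
  then show "(\<lambda>n. prob (X \<inter> ((left_shift ^^ n) -` Y \<inter> space \<nu>))) \<longlonglongrightarrow> prob X * prob Y" by simp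
qed

end

section \<open>Ergodic properties of the equilibrium state\<close>

context invariant_measure
begin

text \<open>
  Through the Gibbs bounds the connecting inequality for \<open>\<phi>\<close> becomes one for the measure; the lengths of the
  connecting words are the gaps.
\<close>

lemma gibbs_imp_gap_independent:
  assumes gibbs: "gibbs_bounds M \<phi> P C \<nu>" and nonneg: "\<And>w. 0 \<le> \<phi> w"
    and conn: "connecting W c \<phi>" and words_W: "W \<subseteq> step_words M n"
  obtains J d where "gap_independent n J d"
proof -
  have C: "0 < C"
    and upper: "\<And>n w. w \<in> words M n \<Longrightarrow> cyl_prob w \<le> C * (\<phi> w * exp (- real n * P))"
    and lower: "\<And>n w. w \<in> words M n \<Longrightarrow> \<phi> w * exp (- real n * P) \<le> C * cyl_prob w"
    using gibbs unfolding gibbs_bounds_def cyl_prob_def by blast+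
  have W: "finite W" "W \<subseteq> step_words M n" and c: "0 < c"
    and connect: "\<And>u v. \<exists>w\<in>W. c * (\<phi> u * \<phi> v) \<le> \<phi> (u @ w @ v)"
    using conn words_W unfolding connecting_def by auto
  have W_ne: "W \<noteq> {}" using connect by blast
  \<comment> \<open>The Gibbs factor of a connecting word is bounded below since there are finitely many of them.\<close>
  define q where "q = Min ((\<lambda>w. exp (- real (length w) * P)) ` W)"
  have q: "q > 0" unfolding q_def using W(1) W_ne by (subst Min_gr_iff) auto
  have q_le: "q \<le> exp (- real (length w) * P)" if "w \<in> W" for w
    unfolding q_def using W(1) that by (intro Min_le) auto
  have "gap_independent n (length ` W) (c * q / C ^ 3)"
    unfolding gap_independent_def
  proof (intro conjI allI ballI)
    show "finite (length ` W)" using W(1) by simp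
    show "n dvd j" if "j \<in> length ` W" for j using that W(2) by (auto simp: step_words_def)
    show "0 < c * q / C ^ 3" using c q C by simp
    fix l m u v assume u: "u \<in> words M l" and v: "v \<in> words M m"
    obtain w where w: "w \<in> W" "c * (\<phi> u * \<phi> v) \<le> \<phi> (u @ w @ v)" using connect by blast
    have wW: "w \<in> words M (length w)" using w(1) W(2) by (auto simp: step_words_def)
    let ?e = "\<lambda>n. exp (- real n * P)"
    have split: "?e (l + (length w + m)) = ?e l * ?e m * ?e (length w)"
      by (simp add: algebra_simps flip: exp_add)
    have "c * q * (cyl_prob u * cyl_prob v) \<le> c * q * ((C * (\<phi> u * ?e l)) * (C * (\<phi> v * ?e m)))"
      using c q C nonneg upper[OF u] upper[OF v] by (intro mult_left_mono mult_mono) auto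
    also have "\<dots> = C ^ 2 * (c * (\<phi> u * \<phi> v)) * (?e l * ?e m) * q"
      by (simp add: power2_eq_square algebra_simps)
    also have "\<dots> \<le> C ^ 2 * \<phi> (u @ w @ v) * (?e l * ?e m) * ?e (length w)"
      using w(2) q_le[OF w(1)] q C nonneg c by (intro mult_mono mult_left_mono mult_right_mono) auto
    also have "\<dots> = C ^ 2 * (\<phi> (u @ w @ v) * ?e (l + (length w + m)))"
      unfolding split by simp
    also have "\<dots> \<le> C ^ 2 * (C * cyl_prob (u @ w @ v))"
      using append_in_words[OF u append_in_words[OF wW v]] by (intro mult_left_mono lower) auto
    finally have "c * q / C ^ 3 * (cyl_prob u * cyl_prob v) \<le> cyl_prob (u @ w @ v)"
      using C by (simp add: pos_divide_le_eq power2_eq_square power3_eq_cube algebra_simps)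
    also have "\<dots> \<le> prob (cylinder M u \<inter> shift_vimage M (l + length w) (cylinder M v))"
    proof -
      have "cylinder M (u @ w @ v) \<subseteq> cylinder M u \<inter> shift_vimage M (length u + length w) (cylinder M v)"
      proof -
        have "cylinder M (u @ w @ v) \<subseteq> cylinder M u"
          unfolding cylinder_append[of u] by blast
        moreover have "cylinder M (u @ w @ v) \<subseteq> shift_vimage M (length u + length w) (cylinder M v)"
          using cylinder_append[of "u @ w" v] by auto
        ultimately show ?thesis by blast
      qed
      then show ?thesis unfolding cyl_prob_def
        using u by (intro finite_measure_mono sets.Int shift_vimage_events) (auto simp: words_def)
    qed
    finally show "\<exists>j\<in>length ` W. c * q / C ^ 3 * (cyl_prob u * cyl_prob v)
        \<le> prob (cylinder M u \<inter> shift_vimage M (l + j) (cylinder M v))"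
      using w(1) by blast
  qed
  then show ?thesis by (rule that)
qed

end

lemma return_invariant:
  assumes "i \<in> {1..M}"
  shows "return (shift_borel M) (\<lambda>_. i) \<in> invariant_measures M"
proof -
  let ?N = "shift_borel M"
  have x: "(\<lambda>_. i) \<in> space ?N" using assms by (auto simp: full_shift_def)
  have "distr (return ?N (\<lambda>_. i)) (return ?N (\<lambda>_. i)) left_shift = distr (return ?N (\<lambda>_. i)) ?N left_shift"
    by (rule distr_cong) auto
  also have "\<dots> = return ?N (left_shift (\<lambda>_. i))" by (rule distr_return) (use x in auto)
  also have "left_shift (\<lambda>_. i) = (\<lambda>_. i)" by (simp add: left_shift_def)
  finally show ?thesis using prob_space_return[OF x] by (simp add: invariant_measures_def)
qed

text \<open>
  The point masses at two constant sequences.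
\<close>

lemma two_invariant_measures:
  assumes "M \<ge> 2"
  shows "\<not> (\<exists>\<mu>. invariant_measures M \<subseteq> {\<mu>})"
proof
  assume "\<exists>\<mu>. invariant_measures M \<subseteq> {\<mu>}"
  then have "return (shift_borel M) (\<lambda>_. 1) = return (shift_borel M) (\<lambda>_. 2)"
    using return_invariant[of 1 M] return_invariant[of 2 M] assms by auto
  then have "measure (return (shift_borel M) (\<lambda>_. 1)) (clopen M 1 {[1]})
      = measure (return (shift_borel M) (\<lambda>_. 2)) (clopen M 1 {[1]})" by simp
  then show False
    unfolding measure_return[OF clopen_in_sets]
    using assms by (simp add: clopen_def initial_def full_shift_def)
qed

lemma opnorm_word_product_append:
  "opnorm (word_product A (u @ v)) \<le> opnorm (word_product A u) * opnorm (word_product A v)"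
  using opnorm_mult[of "word_product A v" "word_product A u"]
  by (simp add: word_product_append mult.commute)

text \<open>
  All exponents are \<open>- \<infinity>\<close> and all entropies are finite, so the supremum \<open>- \<infinity>\<close> is attained by every measure.
\<close>

lemma zero_matrices_equilibrium:
  fixes A :: "nat \<Rightarrow> real^'n^'n"
  assumes zero: "\<And>i. i \<in> {1..M} \<Longrightarrow> A i = 0" and s: "s > 0"
  shows "equilibrium_states M A s = invariant_measures M"
proof -
  have minus_infinity: "metric_entropy \<nu> left_shift + ereal s * top_lyapunov A \<nu> = - \<infinity>" if \<nu>: "\<nu> \<in> invariant_measures M" for \<nu>
  proof -
    interpret invariant_measure M \<nu> by unfold_locales (rule \<nu>)
    let ?g = "\<lambda>w. opnorm (word_product A w)"
    have "(\<Sum>w\<in>words M 1. cyl_prob w) \<noteq> 0" by (simp add: sum_cyl_prob)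
    then obtain w where w: "w \<in> words M 1" "cyl_prob w \<noteq> 0" by (rule sum.not_neutral_contains_not_neutral)
    have "word_product A w = 0"
      using w(1) zero by (auto simp: words_def length_Suc_conv)
    then have "degenerate ?g 1"
      using w unfolding degenerate_def by (intro bexI[of _ w]) (auto simp: opnorm_eq_0_iff less_le)
    then have "growth_rate ?g = - \<infinity>"
      by (intro growth_rate_degenerate[of ?g 1] opnorm_nonneg opnorm_word_product_append)
    then show ?thesis
      using s growth_rate_eq_top_lyapunov[OF invariant_measure_axioms, of A] by (simp add: kolmogorov_sinai)
  qed
  then have "(SUP \<nu>\<in>invariant_measures M. metric_entropy \<nu> left_shift + ereal s * top_lyapunov A \<nu>) \<le> - \<infinity>"
    by (intro SUP_least) simp
  then have "(SUP \<nu>\<in>invariant_measures M. metric_entropy \<nu> left_shift + ereal s * top_lyapunov A \<nu>) = - \<infinity>"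
    by (simp only: ereal_infty_less_eq)
  then show ?thesis unfolding equilibrium_states_def using minus_infinity by (simp only:) blast
qed

text \<open>
  The Gibbs measure attains the bound \<open>P\<close> that holds for all invariant measures.
\<close>

theorem gibbs_equilibrium_state:
  fixes A :: "nat \<Rightarrow> real^'n^'n"
  assumes M: "1 \<le> M" and irr: "irreducible_matrices (A ` {1..M})" and s: "s > 0"
    and i: "i \<in> {1..M}" "A i \<noteq> 0"
  obtains P m C where "m \<in> equilibrium_states M A s" "gibbs_bounds M (norm_potential A s) P C m"
proof -
  have "irreducible_matrices (word_product A ` words M 1)"
    using irr by (simp only: words_1_products)
  then obtain W c where W: "W \<subseteq> step_words M 1" and conn: "connecting W c (norm_potential A s)"
    by (rule norm_potential_connecting[OF _ s]) (rule that)
  interpret Q: quasi_multiplicative M "norm_potential A s" W c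
  proof
    show "w \<in> words M (length w)" if "w \<in> W" for w using that W by (auto simp: step_words_def)
    show "\<exists>w\<in>words M n. 0 < norm_potential A s w" for n
      using nonzero_words[OF irr i, of n] by (auto simp: norm_potential_def opnorm_eq_0_iff)
    show "norm_potential A s (u @ v) \<le> norm_potential A s u * norm_potential A s v" for u v
      using s by (rule norm_potential_append)
  qed (use M conn in \<open>auto simp: norm_potential_def opnorm_mat_1\<close>)
  obtain P m C where P: "(\<lambda>n. ln (\<Sum>w\<in>words M n. norm_potential A s w) / real n) \<longlonglongrightarrow> P"
    and m: "m \<in> invariant_measures M" and gibbs: "gibbs_bounds M (norm_potential A s) P C m"
    by (rule Q.gibbs_measure_exists) (rule that)
  let ?g = "\<lambda>w. opnorm (word_product A w)"
  let ?F = "\<lambda>\<nu>. metric_entropy \<nu> left_shift + ereal s * top_lyapunov A \<nu>"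
  have g: "0 \<le> ?g w" "?g (u @ v) \<le> ?g u * ?g v" for u v w
    by (rule opnorm_nonneg, rule opnorm_word_product_append)
  have upper: "?F \<nu> \<le> ereal P" if \<nu>: "\<nu> \<in> invariant_measures M" for \<nu>
  proof -
    interpret invariant_measure M \<nu> by unfold_locales (rule \<nu>)
    show ?thesis
      using variational_inequality[of ?g s P] g s P growth_rate_eq_top_lyapunov[OF invariant_measure_axioms, of A]
      by (simp add: norm_potential_def)
  qed
  have "ereal P \<le> ?F m"
  proof -
    interpret invariant_measure M m by unfold_locales (rule m)
    have "ereal P \<le> metric_entropy m left_shift + ereal s * growth_rate ?g"
    proof (rule gibbs_upper_bound_attains_pressure[OF g s])
      show "0 < C" using gibbs by (simp add: gibbs_bounds_def)
      show "cyl_prob w \<le> C * ?g w powr s * exp (- real n * P)" if "w \<in> words M n" for n w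
        using gibbs that by (simp add: gibbs_bounds_def cyl_prob_def norm_potential_def mult.assoc)
    qed
    then show ?thesis by (simp only: growth_rate_eq_top_lyapunov[OF invariant_measure_axioms])
  qed
  then have "?F m = ereal P" using upper[OF m] by (rule antisym[rotated])
  moreover have "(SUP \<nu>\<in>invariant_measures M. ?F \<nu>) = ereal P"
    using upper m \<open>?F m = ereal P\<close> by (intro antisym SUP_least) (auto intro: SUP_upper2)
  ultimately have "m \<in> equilibrium_states M A s"
    using m by (simp add: equilibrium_states_def)
  from this gibbs show ?thesis by (rule that)
qed

text \<open>
  Both parts follow from independence up to gaps divisible by \<open>n\<close>: for every \<open>n\<close> with irreducible \<open>n\<close>-step products
  in the first part, and for \<open>n = 1\<close> in the second, where irreducibility of the letters suffices.
\<close>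

theorem theorem5:
  fixes M :: nat and A :: "nat \<Rightarrow> real^'n^'n" and s :: real
    and \<mu> :: "(nat \<Rightarrow> nat) measure"
  assumes "M \<ge> 2"
    and "irreducible_matrices (A ` {1..M})"
    and "s > 0"
    and "equilibrium_states M A s = {\<mu>}"
  shows "((\<forall>n\<ge>1. irreducible_matrices (matrix_products M A n)) \<longrightarrow> totally_ergodic \<mu> left_shift)
       \<and> (totally_ergodic \<mu> left_shift \<longrightarrow> mixing \<mu> left_shift)"
proof -
  have "\<exists>i\<in>{1..M}. A i \<noteq> 0"
  proof (rule ccontr)
    assume "\<not> ?thesis"
    then have "equilibrium_states M A s = invariant_measures M"
      using assms(3) by (intro zero_matrices_equilibrium) auto
    then show False using two_invariant_measures[OF assms(1)] assms(4) by auto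
  qed
  then obtain i where i: "i \<in> {1..M}" "A i \<noteq> 0" by blast
  have M: "1 \<le> M" using assms(1) by simp
  obtain P m C where m: "m \<in> equilibrium_states M A s" and gibbs: "gibbs_bounds M (norm_potential A s) P C m"
    by (rule gibbs_equilibrium_state[OF M assms(2,3) i]) (rule that)
  have "m = \<mu>" using m assms(4) by simp
  have "\<mu> \<in> invariant_measures M" using m \<open>m = \<mu>\<close> by (simp add: equilibrium_states_def)
  then interpret invariant_measure M \<mu> by unfold_locales
  have gap: "\<exists>J d. gap_independent n J d" if irr: "irreducible_matrices (word_product A ` words M n)" for n
  proof -
    obtain W c where W: "W \<subseteq> step_words M n" and conn: "connecting W c (norm_potential A s)"
      by (rule norm_potential_connecting[OF irr assms(3)]) (rule that)
    have "gibbs_bounds M (norm_potential A s) P C \<mu>" using gibbs unfolding \<open>m = \<mu>\<close> .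
    then obtain J d where "gap_independent n J d"
      by (rule gibbs_imp_gap_independent[OF _ _ conn W]) (auto simp: norm_potential_def intro: that)
    then show ?thesis by blast
  qed
  show ?thesis
  proof (intro conjI impI)
    assume irr: "\<forall>n\<ge>1. irreducible_matrices (matrix_products M A n)"
    show "totally_ergodic \<mu> left_shift"
      unfolding totally_ergodic_def
    proof (intro allI impI)
      fix n :: nat assume n: "n \<ge> 1"
      then obtain J d where "gap_independent n J d"
        using gap[of n] irr by (auto simp: matrix_products_eq)
      then show "ergodic \<mu> (left_shift ^^ n)" using n by (rule gap_independent_imp_ergodic)
    qed
  next
    assume erg: "totally_ergodic \<mu> left_shift"
    have "irreducible_matrices (word_product A ` words M 1)"
      using assms(2) by (simp only: words_1_products)
    then obtain J d where "gap_independent 1 J d" using gap[of 1] by blast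
    then show "mixing \<mu> left_shift"
      using totally_ergodic_tail_trivial[OF _ erg] by (intro tail_trivial_imp_mixing) blast
  qed
qed

end
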